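(* Let $k\ge2$, $\alpha,\beta>0$. For $u,v\in[-1,1]$ and $z,w\in\mathbb{C}$ put $\tilde z^k:=v\,\mathrm{Re}(z^k)+iu\,\mathrm{Im}(z^k)$, $R:=\mathrm{Re}(\tilde z^k\,\overline{w^k})$, $D:=\sqrt{|zw|^{2k}-R^2}\ge0$, and for $t=(t_0,\dots,t_{k-1})$ $$h_{u,v,t}(z,w)=\exp\Big(\sum_{j=0}^{k-1}t_j\,\mathrm{Re}\big(\sqrt[k]{R+iD}\big)_j\Big)+\exp\Big(\sum_{j=0}^{k-1}t_j\,\mathrm{Re}\big(\sqrt[k]{-R+iD}\big)_j\Big),$$ where $(\sqrt[k]{\zeta})_j$, $j=0,\dots,k-1$, are the $k$ complex $k$-th roots of $\zeta$ (in any order). Then the generalized Bessel function of $I_{2k}$ with multiplicity $(\alpha,\beta)$ is $$\mathcal J_\kappa(z,w)=\frac{\Gamma(k(\alpha+\beta))}{2\Gamma(\alpha+\beta)^k}\int_{-1}^1\int_{-1}^1\int_{T^{k-1}}h_{u,v,t}(z,w)\prod_{j=0}^{k-1}t_j^{\alpha+\beta-1}\,dt_1\cdots dt_{k-1}\,d\nu^\alpha(u)\,d\nu^\beta(v),\qquad t_0=1-\sum_{j=1}^{k-1}t_j.$$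
   Context: Identify $\mathbb{R}^2$ with $\mathbb{C}$, $\langle z,w\rangle=\mathrm{Re}(z\bar w)$. The dihedral group $I_{2k}$ (order $4k$) contains the reflections $z\mapsto\bar ze^{ij\pi/k}$, $j=0,\dots,2k-1$, forming two conjugacy classes ($j$ even, containing $z\mapsto\bar z$; $j$ odd); $\kappa=(\alpha,\beta)$ is $\alpha$ on the class with $j$ even and $\beta$ on the class with $j$ odd. The Dunkl kernel $E_\kappa$ is the joint eigenfunction of the Dunkl operators normalized by $E_\kappa(0,y)=1$, and $\mathcal J_\kappa(x,y)=\frac1{|G|}\sum_{g\in G}E_\kappa(x,gy)$. $d\nu^\alpha(u)=\frac{\Gamma(\alpha+1/2)}{\sqrt\pi\Gamma(\alpha)}(1-u^2)^{\alpha-1}du$ on $[-1,1]$. $T^{k-1}$ is the open unit simplex $\{t_j>0,\sum_{j=1}^{k-1}t_j<1\}$. *)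

theory Defs
  imports "HOL-Analysis.Analysis"
begin

text \<open>The plane R^2 is identified with the type complex; the inner product
  on complex is Re(z * cnj w).\<close>

definition refl_dih :: "nat \<Rightarrow> nat \<Rightarrow> complex \<Rightarrow> complex" where
  "refl_dih k j z = cnj z * exp (\<i> * complex_of_real (real j * pi / real k))"

definition rot_dih :: "nat \<Rightarrow> nat \<Rightarrow> complex \<Rightarrow> complex" where
  "rot_dih k j z = z * exp (\<i> * complex_of_real (real j * pi / real k))"

text \<open>A root (normal vector of the mirror) of the reflection refl_dih k j.\<close>
definition root_dih :: "nat \<Rightarrow> nat \<Rightarrow> complex" where
  "root_dih k j = \<i> * exp (\<i> * complex_of_real (real j * pi / (2 * real k)))"

definition mult_dih :: "real \<Rightarrow> real \<Rightarrow> nat \<Rightarrow> real" where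
  "mult_dih \<alpha> \<beta> j = (if even j then \<alpha> else \<beta>)"

text \<open>f is a C^1 joint eigenfunction of the Dunkl operators
  T_xi f(x) = d_xi f(x) + sum_j kappa_j <a_j,xi> (f(x) - f(sigma_j x)) / <a_j,x>
  with eigenvalues <xi,y> (the equation is required on the regular set, where
  it is literally defined; elsewhere it holds by continuous extension).\<close>
definition dunkl_eigen :: "nat \<Rightarrow> real \<Rightarrow> real \<Rightarrow> complex \<Rightarrow> (complex \<Rightarrow> real) \<Rightarrow> bool" where
  "dunkl_eigen k \<alpha> \<beta> y f \<longleftrightarrow>
     (\<exists>g :: complex \<Rightarrow> complex. continuous_on UNIV g \<and>
        (\<forall>x. (f has_derivative (\<lambda>h. g x \<bullet> h)) (at x)) \<and>
        (\<forall>x. (\<forall>j<2*k. root_dih k j \<bullet> x \<noteq> 0) \<longrightarrow>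
           (\<forall>\<xi>. g x \<bullet> \<xi> +
                 (\<Sum>j<2*k. mult_dih \<alpha> \<beta> j * (root_dih k j \<bullet> \<xi>) *
                     (f x - f (refl_dih k j x)) / (root_dih k j \<bullet> x))
                 = (\<xi> \<bullet> y) * f x)))"

definition dunkl_kernel :: "nat \<Rightarrow> real \<Rightarrow> real \<Rightarrow> complex \<Rightarrow> complex \<Rightarrow> real" where
  "dunkl_kernel k \<alpha> \<beta> x y = (THE f. dunkl_eigen k \<alpha> \<beta> y f \<and> f 0 = 1) x"

definition gen_bessel :: "nat \<Rightarrow> real \<Rightarrow> real \<Rightarrow> complex \<Rightarrow> complex \<Rightarrow> real" where
  "gen_bessel k \<alpha> \<beta> x y = (1 / (4 * real k)) *
     (\<Sum>j<2*k. dunkl_kernel k \<alpha> \<beta> x (rot_dih k j y) + dunkl_kernel k \<alpha> \<beta> x (refl_dih k j y))"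

definition nu_meas :: "real \<Rightarrow> real measure" where
  "nu_meas \<alpha> = density lborel (\<lambda>u. ennreal (indicator {-1..1} u *
      (Gamma (\<alpha> + 1/2) / (sqrt pi * Gamma \<alpha>)) * (1 - u\<^sup>2) powr (\<alpha> - 1)))"

definition simplex_T :: "nat \<Rightarrow> (nat \<Rightarrow> real) set" where
  "simplex_T k = {t. (\<forall>j\<in>{1..<k}. 0 < t j) \<and> (\<Sum>j\<in>{1..<k}. t j) < 1}"

definition kth_root :: "nat \<Rightarrow> nat \<Rightarrow> complex \<Rightarrow> complex" where
  "kth_root k j \<zeta> = \<zeta> powr (1 / of_nat k) * exp (\<i> * complex_of_real (2 * pi * real j / real k))"

definition R_val :: "nat \<Rightarrow> real \<Rightarrow> real \<Rightarrow> complex \<Rightarrow> complex \<Rightarrow> real" where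
  "R_val k u v z w = Re (Complex (v * Re (z ^ k)) (u * Im (z ^ k)) * cnj (w ^ k))"

definition D_val :: "nat \<Rightarrow> real \<Rightarrow> real \<Rightarrow> complex \<Rightarrow> complex \<Rightarrow> real" where
  "D_val k u v z w = sqrt (cmod (z * w) ^ (2 * k) - (R_val k u v z w)\<^sup>2)"

text \<open>h_{u,v,t}(z,w); the orderings of the roots are given by the permutations p and q.\<close>
definition h_fun :: "nat \<Rightarrow> (nat \<Rightarrow> nat) \<Rightarrow> (nat \<Rightarrow> nat) \<Rightarrow> real \<Rightarrow> real \<Rightarrow> (nat \<Rightarrow> real)
    \<Rightarrow> complex \<Rightarrow> complex \<Rightarrow> real" where
  "h_fun k p q u v t z w =
     exp (\<Sum>j<k. t j * Re (kth_root k (p j) (Complex (R_val k u v z w) (D_val k u v z w)))) +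
     exp (\<Sum>j<k. t j * Re (kth_root k (q j) (Complex (- R_val k u v z w) (D_val k u v z w))))"

definition ext_t :: "nat \<Rightarrow> (nat \<Rightarrow> real) \<Rightarrow> nat \<Rightarrow> real" where
  "ext_t k t j = (if j = 0 then 1 - (\<Sum>i\<in>{1..<k}. t i) else t j)"

end

theory Submission
  imports Defs
begin

text \<open>
  Write \<open>\<gamma> = k (\<alpha> + \<beta>)\<close>, \<open>\<omega> = exp (i \<pi> / k)\<close> and let \<open>c n\<close> be the sum of \<open>\<kappa> j * \<omega> ^ (j n)\<close> over
  all reflections. In complex notation the Dunkl operators are spanned by \<open>T\<close> and its conjugate.
  There are homogeneous polynomials \<open>\<phi> n\<close> of degree \<open>n\<close>, annihilated by the conjugate of \<open>T\<close>, with
  \<open>T (\<phi> n) = \<phi> (n - 1)\<close>; they satisfy \<open>z * \<phi> (n - 1) z = (n + \<gamma>) * \<phi> n z - c n * cnj (\<phi> n z)\<close>, which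
  determines them recursively. The Dunkl kernel is then an explicit Bessel-type series in the
  \<open>\<phi> n\<close>. It is the only eigenfunction because already the Euler-type equation (the Dunkl equation
  with \<open>\<xi> = x\<close>) has a unique solution: along a ray the sum of squares over a group orbit obeys a
  Gronwall inequality.

  The recursion for \<open>\<phi>\<close> sees \<open>k\<close> only through \<open>z ^ k\<close>: up to constants depending on \<open>k\<close>, \<open>m\<close> and
  \<open>\<alpha> + \<beta>\<close> only, \<open>\<phi> (k m)\<close> at \<open>z\<close> for \<open>k\<close> equals \<open>\<phi> m\<close> at \<open>z ^ k\<close> for \<open>k = 1\<close>. Hence the formula follows
  from three explicit kernels, each identified by uniqueness for the Euler equation: for \<open>k = 1\<close>
  a product of rank-one kernels, whose average is the double integral of \<open>exp R\<close>; for \<open>k = 1\<close>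
  with multiplicity \<open>(\<alpha> + \<beta>, 0)\<close> and \<open>w = 1\<close> the function \<open>exp (Re z)\<close>; and for general \<open>k\<close> with
  multiplicity \<open>(\<alpha> + \<beta>, 0)\<close> and \<open>w = 1\<close> a kernel whose rotation average is the Dirichlet integral
  of \<open>exp\<close>.
\<close>

section \<open>Harmonic polynomials\<close>

text \<open>The choice of D is the hinge. The function exp R is exp (Re c) for every complex c with
  real part R; taking c = R + i D fixes the modulus of c at |z w|^k for all u and v in [-1, 1]. The
  expansions for multiplicities (alpha, beta) and (alpha + beta, 0) at k = 1 then have the same
  coefficients, constant in u and v, because Bessel coefficients see only alpha + beta and powers of
  |c| are constant. So the identity for exp R can be split into one identity for each harmonic
  degree, and these can be reassembled with the Bessel coefficients belonging to k. The second
  exponential in h repairs a mismatch: averaging over the whole group keeps the degrees divisible by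
  2 k, while the rotation average of the comparison kernel keeps all multiples k m. Its argument is
  -cnj c; replacing c by -cnj c multiplies the part of degree k m by (-1)^m, so the sum of both
  loses the odd m and doubles the even ones, whence the factor 1/2.\<close>

definition dih_coef :: "nat \<Rightarrow> real \<Rightarrow> real \<Rightarrow> nat \<Rightarrow> real" where
  "dih_coef k \<alpha> \<beta> n = (if k dvd n then real k * (\<alpha> + (-1) ^ (n div k) * \<beta>) else 0)"

definition dih_ratio :: "nat \<Rightarrow> real \<Rightarrow> real \<Rightarrow> nat \<Rightarrow> real" where
  "dih_ratio k \<alpha> \<beta> n = dih_coef k \<alpha> \<beta> n / (real n + real k * (\<alpha> + \<beta>))"

text \<open>\<open>mult_hprev\<close> and its conjugate form a linear system for the polynomial of
  degree n and its conjugate. With g = n + gamma and s the ratio, its determinant is g^2 (1 - s^2),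
  and the recursion is its solution.\<close>

fun dih_harm :: "nat \<Rightarrow> real \<Rightarrow> real \<Rightarrow> nat \<Rightarrow> complex \<Rightarrow> complex" where
  "dih_harm k \<alpha> \<beta> 0 z = 1"
| "dih_harm k \<alpha> \<beta> (Suc n) z =
     (z * dih_harm k \<alpha> \<beta> n z + of_real (dih_ratio k \<alpha> \<beta> (Suc n)) * cnj (z * dih_harm k \<alpha> \<beta> n z)) /
     of_real ((real (Suc n) + real k * (\<alpha> + \<beta>)) * (1 - (dih_ratio k \<alpha> \<beta> (Suc n))\<^sup>2))"

text \<open>Forced by \<open>gterm_up_plus_dn\<close>: with this recursion the two contributions to
  a pair (i, m) add up to cnj w times the summand of the kernel. The start 1/2 makes
  \<open>hterm\<close> equal to 1 in degree 0.\<close>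

fun hcoef :: "nat \<Rightarrow> real \<Rightarrow> real \<Rightarrow> nat \<Rightarrow> complex \<Rightarrow> complex" where
  "hcoef k \<alpha> \<beta> 0 w = 1 / 2"
| "hcoef k \<alpha> \<beta> (Suc n) w =
     cnj w / 2 * (hcoef k \<alpha> \<beta> n w + of_real (dih_ratio k \<alpha> \<beta> n) * cnj (hcoef k \<alpha> \<beta> n w))"

declare dih_harm.simps(2) [simp del] hcoef.simps(2) [simp del]

text \<open>Convention: the polynomial of degree \<open>-1\<close> is \<open>0\<close>.\<close>
definition hprev :: "nat \<Rightarrow> real \<Rightarrow> real \<Rightarrow> nat \<Rightarrow> complex \<Rightarrow> complex" where
  "hprev k \<alpha> \<beta> n z = (case n of 0 \<Rightarrow> 0 | Suc m \<Rightarrow> dih_harm k \<alpha> \<beta> m z)"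

definition hterm :: "nat \<Rightarrow> real \<Rightarrow> real \<Rightarrow> nat \<Rightarrow> complex \<Rightarrow> complex \<Rightarrow> real" where
  "hterm k \<alpha> \<beta> n z w = 2 * Re (hcoef k \<alpha> \<beta> n w * dih_harm k \<alpha> \<beta> n z)"

text \<open>Taylor coefficients in x^2 of the modified Bessel function of index n + gamma,
  normalised to 1 at 0.\<close>

definition bessel_coef :: "real \<Rightarrow> nat \<Rightarrow> nat \<Rightarrow> real" where
  "bessel_coef \<gamma> j n = 1 / (4 ^ j * fact j * pochhammer (real n + \<gamma> + 1) j)"

text \<open>The part of degree \<open>N\<close> of the Dunkl kernel.\<close>
definition hom_kernel :: "nat \<Rightarrow> real \<Rightarrow> real \<Rightarrow> nat \<Rightarrow> complex \<Rightarrow> complex \<Rightarrow> real" where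
  "hom_kernel k \<alpha> \<beta> N z w = (\<Sum>j\<le>N div 2. bessel_coef (real k * (\<alpha> + \<beta>)) j (N - 2 * j) *
      ((z \<bullet> z) * (w \<bullet> w)) ^ j * hterm k \<alpha> \<beta> (N - 2 * j) z w)"

lemma refl_dih_cis: "refl_dih k j z = cnj z * cis (real j * pi / real k)"
  by (simp add: refl_dih_def cis_conv_exp)

lemma rot_dih_cis: "rot_dih k j z = z * cis (real j * pi / real k)"
  by (simp add: rot_dih_def cis_conv_exp)

lemma of_real_inner_self: "complex_of_real (z \<bullet> z) = z * cnj z"
  by (simp add: complex_eq_iff inner_complex_def)

section \<open>Sums of powers of roots of unity\<close>

lemma cis_eq_1_nat: "x = 2 * pi * real n \<Longrightarrow> cis x = 1"
  by (metis cis_multiple_2pi Ints_of_nat)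

lemma sum_cis_powers:
  fixes k n :: nat assumes "k > 0"
  shows "(\<Sum>i<k. cis (2 * pi * real n / real k) ^ i) = (if k dvd n then of_nat k else 0)"
proof (cases "k dvd n")
  case True
  then obtain m where "n = k * m" by blast
  then have "2 * pi * real n / real k = 2 * pi * real m" using assms by simp
  then have "cis (2 * pi * real n / real k) = 1" by (rule cis_eq_1_nat)
  then show ?thesis using True by simp
next
  case False
  let ?x = "cis (2 * pi * real n / real k)"
  have "real k * (2 * pi * real n / real k) = 2 * pi * real n" using assms by simp
  then have 1: "?x ^ k = 1" unfolding Complex.DeMoivre by (rule cis_eq_1_nat)
  have "?x \<noteq> 1"
  proof
    assume "?x = 1"
    then have "cos (2 * pi * real n / real k) = 1" by (metis cis.sel(1) one_complex.sel(1))
    then obtain m :: int where "2 * pi * real n / real k = of_int m * (2 * pi)"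
      by (auto simp: cos_one_2pi_int)
    then have "real n = of_int m * real k" using assms by (simp add: field_simps)
    then have "int n = m * int k" by (metis of_int_eq_iff of_int_mult of_int_of_nat_eq)
    then have "k dvd n" by (metis dvd_triv_right int_dvd_int_iff)
    then show False using False by simp
  qed
  then show ?thesis using 1 False by (simp add: sum_gp_strict)
qed

lemma sum_lessThan_double:
  fixes f :: "nat \<Rightarrow> 'a::comm_monoid_add"
  shows "(\<Sum>j<2*k. f j) = (\<Sum>i<k. f (2*i)) + (\<Sum>i<k. f (2*i+1))"
  by (induction k) (simp_all add: ac_simps)

lemma harm_inversion:
  fixes g s X Y :: complex
  assumes "g * (1 - s\<^sup>2) \<noteq> 0"
  shows "g * ((X + s * Y) / (g * (1 - s\<^sup>2))) - s * g * ((Y + s * X) / (g * (1 - s\<^sup>2))) = X"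
proof -
  have "g * ((X + s * Y) / (g * (1 - s\<^sup>2))) - s * g * ((Y + s * X) / (g * (1 - s\<^sup>2)))
      = (g * (1 - s\<^sup>2)) * X / (g * (1 - s\<^sup>2))"
    by (simp add: diff_divide_distrib[symmetric] algebra_simps power2_eq_square)
  then show ?thesis using assms by simp
qed

text \<open>The range of the parameters is wider than in the theorem because the comparison kernels
  have k = 1 or multiplicity (alpha + beta, 0).\<close>

locale dihedral =
  fixes k :: nat and \<alpha> \<beta> :: real
  assumes k_pos: "k > 0" and alpha_nonneg: "\<alpha> \<ge> 0" and beta_nonneg: "\<beta> \<ge> 0"
    and sum_pos: "\<alpha> + \<beta> > 0"
begin

abbreviation \<gamma> :: real where "\<gamma> \<equiv> real k * (\<alpha> + \<beta>)"
abbreviation c :: "nat \<Rightarrow> real" where "c \<equiv> dih_coef k \<alpha> \<beta>"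
abbreviation s :: "nat \<Rightarrow> real" where "s \<equiv> dih_ratio k \<alpha> \<beta>"
abbreviation \<phi> :: "nat \<Rightarrow> complex \<Rightarrow> complex" where "\<phi> \<equiv> dih_harm k \<alpha> \<beta>"
abbreviation A :: "nat \<Rightarrow> complex \<Rightarrow> complex" where "A \<equiv> hcoef k \<alpha> \<beta>"
abbreviation u :: "nat \<Rightarrow> complex \<Rightarrow> complex \<Rightarrow> real" where "u \<equiv> hterm k \<alpha> \<beta>"
abbreviation E :: "nat \<Rightarrow> complex \<Rightarrow> complex \<Rightarrow> real" where "E \<equiv> hom_kernel k \<alpha> \<beta>"
abbreviation \<theta> :: "nat \<Rightarrow> nat \<Rightarrow> real" where "\<theta> \<equiv> bessel_coef (real k * (\<alpha> + \<beta>))"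
abbreviation \<mu> :: "nat \<Rightarrow> complex \<Rightarrow> complex" where "\<mu> \<equiv> hprev k \<alpha> \<beta>"
abbreviation \<kappa> :: "nat \<Rightarrow> real" where "\<kappa> \<equiv> mult_dih \<alpha> \<beta>"
abbreviation \<sigma> :: "nat \<Rightarrow> complex \<Rightarrow> complex" where "\<sigma> \<equiv> refl_dih k"
abbreviation \<rho> :: "nat \<Rightarrow> complex" where "\<rho> \<equiv> root_dih k"
abbreviation \<omega> :: "nat \<Rightarrow> complex" where "\<omega> j \<equiv> cis (real j * pi / real k)"

lemma gamma_pos: "\<gamma> > 0" using k_pos sum_pos by simp

lemma abs_coef_le: "\<bar>c n\<bar> \<le> \<gamma>"
proof -
  have "\<bar>\<alpha> + (-1) ^ (n div k) * \<beta>\<bar> \<le> \<alpha> + \<beta>"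
    using alpha_nonneg beta_nonneg by (cases "even (n div k)") auto
  then show ?thesis
    using gamma_pos by (auto simp: dih_coef_def abs_mult intro!: mult_left_mono)
qed

lemma coef_0: "c 0 = \<gamma>" by (simp add: dih_coef_def)

lemma ratio_0: "s 0 = 1" using k_pos sum_pos by (simp add: dih_ratio_def coef_0)

lemma coef_eq_ratio: "c n = s n * (real n + \<gamma>)"
proof -
  have "real n + \<gamma> > 0" using gamma_pos by linarith
  then show ?thesis unfolding dih_ratio_def by (metis nonzero_eq_divide_eq order_less_irrefl)
qed

lemma abs_ratio_less: "n > 0 \<Longrightarrow> \<bar>s n\<bar> < 1"
proof -
  assume "n > 0"
  then have "\<bar>c n\<bar> < real n + \<gamma>" "real n + \<gamma> > 0"
    using abs_coef_le[of n] gamma_pos by linarith+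
  then show ?thesis by (simp only: dih_ratio_def abs_divide abs_of_pos divide_less_eq_1_pos)
qed

lemma abs_ratio_le_1: "\<bar>s n\<bar> \<le> 1"
  using ratio_0 abs_ratio_less[of n] by (cases "n = 0") simp_all

lemma harm_denominator_nonzero:
  "n > 0 \<Longrightarrow> (real n + \<gamma>) * (1 - (s n)\<^sup>2) \<noteq> 0"
proof -
  assume n: "n > 0"
  have "real n + \<gamma> \<noteq> 0" using gamma_pos by linarith
  moreover have "1 - (s n)\<^sup>2 \<noteq> 0"
    using abs_ratio_less[OF n] abs_square_eq_1[of "s n"] by auto
  ultimately show ?thesis by simp
qed

text \<open>Both conjugacy classes give the same geometric sum over k-th roots of unity; the odd
  class carries the extra factor cis (pi n / k), which is (-1)^(n / k) when k divides n.\<close>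

lemma coef_sum: "(\<Sum>j<2*k. of_real (\<kappa> j) * \<omega> j ^ n) = of_real (c n)"
proof -
  let ?x = "cis (2 * pi * real n / real k)"
  have e: "\<omega> (2*i) ^ n = ?x ^ i" for i
    unfolding Complex.DeMoivre by (rule arg_cong[where f=cis]) (simp add: field_simps)
  have o: "\<omega> (2*i+1) ^ n = cis (pi * real n / real k) * ?x ^ i" for i
    unfolding Complex.DeMoivre cis_mult using k_pos by (intro arg_cong[where f=cis]) (simp add: field_simps)
  have "(\<Sum>j<2*k. of_real (\<kappa> j) * \<omega> j ^ n) =
     (\<Sum>i<k. of_real \<alpha> * ?x ^ i) + (\<Sum>i<k. of_real \<beta> * (cis (pi * real n / real k) * ?x ^ i))"
    unfolding sum_lessThan_double e o by (simp add: mult_dih_def)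
  also have "\<dots> = (of_real \<alpha> + of_real \<beta> * cis (pi * real n / real k)) * (\<Sum>i<k. ?x ^ i)"
    by (simp only: sum_distrib_left distrib_right mult.assoc sum.distrib)
  also have "\<dots> = of_real (c n)"
  proof (cases "k dvd n")
    case True
    then obtain m where m: "n = k * m" by blast
    have "cis (pi * real n / real k) = cis pi ^ m" unfolding Complex.DeMoivre using m k_pos by (intro arg_cong[where f=cis]) simp
    then show ?thesis unfolding sum_cis_powers[OF k_pos] using m k_pos by (simp add: dih_coef_def mult_ac)
  next
    case False
    then show ?thesis unfolding sum_cis_powers[OF k_pos] by (simp add: dih_coef_def)
  qed
  finally show ?thesis .
qed

lemma sum_mult_dih: "(\<Sum>j<2*k. \<kappa> j) = \<gamma>"
proof -
  have "complex_of_real (\<Sum>j<2*k. \<kappa> j) = of_real \<gamma>"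
    using coef_sum[of 0] by (simp add: coef_0)
  then show ?thesis by (simp only: of_real_eq_iff)
qed

lemma mult_dih_nonneg: "\<kappa> j \<ge> 0"
  using alpha_nonneg beta_nonneg by (simp add: mult_dih_def)

lemma omega_sq_power: "k dvd n \<Longrightarrow> \<omega> j ^ n * \<omega> j ^ n = 1"
proof -
  assume "k dvd n"
  then obtain m where m: "n = k * m" by blast
  have "real n * (real j * pi / real k) + real n * (real j * pi / real k) = 2 * pi * real (j * m)"
    using k_pos m by (simp add: field_simps)
  then show ?thesis unfolding Complex.DeMoivre cis_mult by (rule cis_eq_1_nat)
qed

lemma cnj_omega_power: "k dvd n \<Longrightarrow> cnj (\<omega> j ^ n) = \<omega> j ^ n"
proof -
  assume "k dvd n"
  then have "\<omega> j ^ n * \<omega> j ^ n = 1" by (rule omega_sq_power)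
  moreover have "cnj (\<omega> j ^ n) * \<omega> j ^ n = 1" by (simp add: cis_cnj cis_mult flip: power_mult_distrib)
  ultimately show ?thesis by (metis mult.commute mult_cancel_left zero_neq_one mult_zero_left)
qed

lemma ratio_zero: "\<not> k dvd n \<Longrightarrow> s n = 0"
  by (simp add: dih_ratio_def dih_coef_def)

text \<open>If \<open>s n\<close> is nonzero then k divides n and \<open>\<omega> j ^ n\<close> is 1
  or -1. This compatibility of the ratio with conjugation is what makes the polynomials and their
  coefficients transform simply under the group.\<close>

lemma ratio_cnj_omega: "of_real (s n) * cnj (\<omega> j ^ n) = of_real (s n) * \<omega> j ^ n"
  by (cases "k dvd n") (simp_all add: cnj_omega_power ratio_zero del: complex_cnj_power)

lemma harm_refl: "\<phi> n (cnj z * \<omega> j) = \<omega> j ^ n * cnj (\<phi> n z)"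
proof (induction n)
  case (Suc n)
  let ?X = "z * \<phi> n z"
  have *: "cnj z * \<omega> j * \<phi> n (cnj z * \<omega> j) = \<omega> j ^ Suc n * cnj ?X"
    by (simp add: Suc)
  have **: "of_real (s (Suc n)) * cnj (\<omega> j ^ Suc n * cnj ?X) = of_real (s (Suc n)) * \<omega> j ^ Suc n * ?X"
    by (simp only: complex_cnj_mult mult.assoc[symmetric] ratio_cnj_omega complex_cnj_cnj)
  show ?case
    unfolding dih_harm.simps * ** by (simp add: algebra_simps add_divide_distrib)
qed simp

lemma harm_rot: "\<phi> n (z * \<omega> j) = \<omega> j ^ n * \<phi> n z"
proof (induction n)
  case (Suc n)
  let ?X = "z * \<phi> n z"
  have *: "z * \<omega> j * \<phi> n (z * \<omega> j) = \<omega> j ^ Suc n * ?X"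
    by (simp add: Suc)
  have **: "of_real (s (Suc n)) * cnj (\<omega> j ^ Suc n * ?X) = of_real (s (Suc n)) * \<omega> j ^ Suc n * cnj ?X"
    by (metis complex_cnj_mult mult.assoc ratio_cnj_omega)
  show ?case
    unfolding dih_harm.simps * ** by (simp add: algebra_simps add_divide_distrib)
qed simp

lemma hcoef_rot: "A n (w * \<omega> j) = cnj (\<omega> j ^ n) * A n w"
proof (induction n)
  case (Suc n)
  have **: "of_real (s n) * cnj (cnj (\<omega> j ^ n) * A n w) = of_real (s n) * cnj (\<omega> j ^ n) * cnj (A n w)"
    by (metis complex_cnj_cnj complex_cnj_mult mult.assoc ratio_cnj_omega)
  show ?case
    unfolding hcoef.simps Suc ** by (simp add: algebra_simps)
qed simp

lemma hcoef_refl: "A n (cnj w * \<omega> j) = cnj (\<omega> j ^ n) * cnj (A n w)"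
proof (induction n)
  case (Suc n)
  have **: "of_real (s n) * cnj (cnj (\<omega> j ^ n) * cnj (A n w)) = of_real (s n) * cnj (\<omega> j ^ n) * A n w"
    by (metis complex_cnj_cnj complex_cnj_mult mult.assoc ratio_cnj_omega)
  show ?case
    unfolding hcoef.simps Suc ** by (simp add: algebra_simps)
qed simp

lemma mult_hprev: "z * \<mu> n z = of_real (real n + \<gamma>) * \<phi> n z - of_real (c n) * cnj (\<phi> n z)"
proof (cases n)
  \<comment> \<open>In degree 0 both sides vanish, since \<open>c 0\<close> is gamma.\<close>
  case 0
  then show ?thesis by (simp add: hprev_def coef_0)
next
  case (Suc m)
  let ?X = "z * \<phi> m z" and ?g = "complex_of_real (real n + \<gamma>)" and ?s = "complex_of_real (s n)"
  let ?d = "?g * (1 - ?s\<^sup>2)"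
  have "complex_of_real ((real n + \<gamma>) * (1 - (s n)\<^sup>2)) \<noteq> 0"
    unfolding of_real_eq_0_iff using Suc by (intro harm_denominator_nonzero) simp
  then have d: "?d \<noteq> 0" by (simp only: of_real_mult of_real_diff of_real_1 of_real_power not_False_eq_True)
  have f: "\<phi> n z = (?X + ?s * cnj ?X) / ?d"
    unfolding Suc dih_harm.simps by (simp only: of_real_mult of_real_diff of_real_1 of_real_power)
  have c: "complex_of_real (c n) = ?s * ?g" by (subst coef_eq_ratio) simp
  have cf: "cnj (\<phi> n z) = (cnj ?X + ?s * ?X) / ?d" unfolding f by simp
  have "?g * \<phi> n z - of_real (c n) * cnj (\<phi> n z) = ?X"
    unfolding cf unfolding c f by (rule harm_inversion[OF d])
  then show ?thesis using Suc by (simp add: hprev_def)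
qed

text \<open>One factor 1 + |s| cancels between numerator and denominator, and g (1 - |s|) = g - |c
  n| is at least n because |c n| is at most gamma. Stated for arbitrary X so that it also bounds the
  derivative.\<close>

lemma norm_harm_step:
  assumes "n > 0"
  shows "norm ((X + of_real (s n) * cnj X) / of_real ((real n + \<gamma>) * (1 - (s n)\<^sup>2))) \<le> norm X / real n"
proof -
  let ?s = "s n" and ?g = "real n + \<gamma>"
  have g: "?g > 0" using gamma_pos by linarith
  have s1: "\<bar>?s\<bar> < 1" by (rule abs_ratio_less[OF assms])
  have sg: "?g * (1 - \<bar>?s\<bar>) \<ge> real n"
  proof -
    have "?g * \<bar>?s\<bar> = \<bar>c n\<bar>" using g by (subst coef_eq_ratio) (simp add: abs_mult)
    then show ?thesis using abs_coef_le[of n] by (simp add: right_diff_distrib)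
  qed
  have "norm (X + of_real ?s * cnj X) \<le> norm X + norm (of_real ?s * cnj X)" by (rule norm_triangle_ineq)
  also have "\<dots> = (1 + \<bar>?s\<bar>) * norm X" by (simp add: norm_mult algebra_simps)
  finally have 1: "norm (X + of_real ?s * cnj X) \<le> (1 + \<bar>?s\<bar>) * norm X" .
  have d: "\<bar>?g * (1 - ?s\<^sup>2)\<bar> = ?g * (1 - \<bar>?s\<bar>) * (1 + \<bar>?s\<bar>)"
  proof -
    have "1 - ?s\<^sup>2 = (1 - \<bar>?s\<bar>) * (1 + \<bar>?s\<bar>)" by (simp add: algebra_simps power2_eq_square)
    moreover have "\<dots> > 0" using s1 by simp
    ultimately show ?thesis using g by (metis abs_of_pos mult.assoc mult_pos_pos)
  qed
  have "norm (X + of_real ?s * cnj X) / \<bar>?g * (1 - ?s\<^sup>2)\<bar>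
      \<le> (1 + \<bar>?s\<bar>) * norm X / (?g * (1 - \<bar>?s\<bar>) * (1 + \<bar>?s\<bar>))"
    unfolding d using g s1 by (intro divide_right_mono 1) simp
  also have "\<dots> = norm X / (?g * (1 - \<bar>?s\<bar>))"
    using mult_divide_mult_cancel_left[of "1 + \<bar>?s\<bar>" "norm X" "?g * (1 - \<bar>?s\<bar>)"]
    by (simp only: mult.commute[of "1 + \<bar>?s\<bar>"])
  also have "\<dots> \<le> norm X / real n"
    using sg assms by (intro divide_left_mono) (auto intro: mult_pos_pos)
  finally show ?thesis unfolding norm_divide norm_of_real .
qed

lemma norm_harm_le: "norm (\<phi> n z) \<le> norm z ^ n / fact n"
proof (induction n)
  case (Suc n)
  have "norm (\<phi> (Suc n) z) \<le> norm (z * \<phi> n z) / real (Suc n)"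
    unfolding dih_harm.simps by (rule norm_harm_step) simp
  also have "\<dots> \<le> norm z * (norm z ^ n / fact n) / real (Suc n)"
    unfolding norm_mult using Suc by (intro divide_right_mono mult_left_mono) auto
  also have "\<dots> = norm z ^ Suc n / fact (Suc n)" by (simp add: mult_ac)
  finally show ?case .
qed simp

lemma norm_hcoef_le: "norm (A n w) \<le> norm w ^ n / 2"
proof (induction n)
  case (Suc n)
  have "norm (A n w + of_real (s n) * cnj (A n w)) \<le> norm (A n w) + \<bar>s n\<bar> * norm (A n w)"
    by (rule order_trans[OF norm_triangle_ineq]) (simp add: norm_mult)
  also have "\<dots> \<le> norm (A n w) + 1 * norm (A n w)"
    by (intro add_left_mono mult_right_mono abs_ratio_le_1) simp
  finally have "norm (A (Suc n) w) \<le> norm w / 2 * (2 * norm (A n w))"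
    unfolding hcoef.simps norm_mult by (intro mult_mono) (auto simp: norm_divide)
  also have "\<dots> \<le> norm w * (norm w ^ n / 2)" using mult_left_mono[OF Suc, of "norm w"] by simp
  finally show ?case by simp
qed simp

lemma abs_hterm_le: "\<bar>u n z w\<bar> \<le> (norm z * norm w) ^ n / fact n"
proof -
  have "\<bar>u n z w\<bar> \<le> 2 * (norm (A n w) * norm (\<phi> n z))"
    using abs_Re_le_cmod[of "A n w * \<phi> n z"] by (simp add: hterm_def norm_mult)
  also have "\<dots> \<le> 2 * (norm w ^ n / 2 * (norm z ^ n / fact n))"
    by (intro mult_left_mono mult_mono norm_hcoef_le norm_harm_le) auto
  finally show ?thesis by (simp add: power_mult_distrib mult_ac)
qed

end

section \<open>The Euler equation for the homogeneous parts of the kernel\<close>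

lemma bessel_coef_0 [simp]: "bessel_coef \<gamma> 0 n = 1"
  by (simp add: bessel_coef_def)

text \<open>This and the next lemma are the contiguity relations that match the coefficients after a
  Dunkl operator has lowered n, or lowered j and raised n.\<close>

lemma bessel_coef_Suc_right:
  assumes "\<gamma> > 0"
  shows "bessel_coef \<gamma> j (Suc n) * (real (Suc n) + \<gamma> + real j) = bessel_coef \<gamma> j n * (real (Suc n) + \<gamma>)"
proof -
  let ?x = "real n + \<gamma> + 1"
  have e: "pochhammer ?x j * (?x + real j) = ?x * pochhammer (?x + 1) j"
    by (metis pochhammer_Suc pochhammer_rec)
  have p: "pochhammer ?x j > 0" "pochhammer (?x + 1) j > 0"
    using assms by (auto intro!: pochhammer_pos)
  have s: "real (Suc n) + \<gamma> + 1 = ?x + 1" "real (Suc n) + \<gamma> = ?x" by simp_all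
  show ?thesis
    unfolding bessel_coef_def s using e p by (simp add: field_simps del: of_nat_Suc)
qed

lemma bessel_coef_Suc_left:
  assumes "\<gamma> > 0"
  shows "4 * real (Suc i) * bessel_coef \<gamma> (Suc i) n * (real (Suc n) + \<gamma>) = bessel_coef \<gamma> i (Suc n)"
proof -
  let ?x = "real n + \<gamma> + 1"
  have e: "pochhammer ?x (Suc i) = ?x * pochhammer (?x + 1) i"
    by (rule pochhammer_rec)
  have p: "pochhammer (?x + 1) i > 0" "?x > 0"
    using assms by (auto intro!: pochhammer_pos)
  have s: "real (Suc n) + \<gamma> + 1 = ?x + 1" "real (Suc n) + \<gamma> = ?x" by simp_all
  have cancel: "4 * S * (1 / (4 * Q * (S * F) * (x * P))) * x = 1 / (Q * F * P)"
    if "S \<noteq> 0" "Q \<noteq> 0" "F \<noteq> 0" "x \<noteq> 0" "P \<noteq> 0" for S Q F x P :: real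
    using that by (simp add: field_simps)
  show ?thesis
    unfolding bessel_coef_def s e fact_Suc power_Suc using p
    by (intro cancel) (auto simp del: of_nat_Suc)
qed

text \<open>A pair (j, n) with 2 j + n = M + 1 feeds (j, n - 1) and (j - 1, n + 1), both of total
  degree M; this regroups the sum by target pairs.\<close>

lemma sum_half_shift:
  fixes U V :: "nat \<Rightarrow> nat \<Rightarrow> 'a::comm_monoid_add"
  assumes "\<And>i. V i 0 = 0"
  shows "(\<Sum>j\<le>Suc M div 2. (if Suc M - 2 * j = 0 then 0 else U j (Suc M - 2 * j - 1)) +
            (if j = 0 then 0 else V (j - 1) (Suc M - 2 * j + 1)))
       = (\<Sum>j\<le>M div 2. U j (M - 2 * j) + V j (M - 2 * j))"
proof -
  have 1: "(\<Sum>j\<le>Suc M div 2. if Suc M - 2 * j = 0 then 0 else U j (Suc M - 2 * j - 1))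
       = (\<Sum>j\<le>M div 2. U j (M - 2 * j))"
  proof (rule sum.mono_neutral_cong_right)
    show "\<forall>i\<in>{..Suc M div 2} - {..M div 2}. (if Suc M - 2 * i = 0 then 0 else U i (Suc M - 2 * i - 1)) = 0"
      by auto
    show "\<And>x. x \<in> {..M div 2} \<Longrightarrow>
         (if Suc M - 2 * x = 0 then 0 else U x (Suc M - 2 * x - 1)) = U x (M - 2 * x)"
      by (auto simp: Suc_diff_le)
  qed auto
  have 2: "(\<Sum>j\<le>Suc M div 2. if j = 0 then 0 else V (j - 1) (Suc M - 2 * j + 1))
       = (\<Sum>i<Suc M div 2. V i (M - 2 * i))"
  proof -
    have "(\<Sum>j\<le>Suc M div 2. if j = 0 then 0 else V (j - 1) (Suc M - 2 * j + 1))
       = (\<Sum>i<Suc M div 2. V i (Suc M - 2 * Suc i + 1))"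
      by (simp add: sum.atMost_shift)
    also have "\<dots> = (\<Sum>i<Suc M div 2. V i (M - 2 * i))"
    proof (rule sum.cong[OF refl])
      fix i assume "i \<in> {..<Suc M div 2}"
      then have "Suc M - 2 * Suc i + 1 = M - 2 * i" by auto
      then show "V i (Suc M - 2 * Suc i + 1) = V i (M - 2 * i)" by simp
    qed
    finally show ?thesis .
  qed
  \<comment> \<open>For even M the right-hand sum has one more index, i = M / 2, where the second
    argument of V is 0.\<close>
  have 3: "(\<Sum>i<Suc M div 2. V i (M - 2 * i)) = (\<Sum>i\<le>M div 2. V i (M - 2 * i))"
  proof (rule sum.mono_neutral_left)
    show "\<forall>i\<in>{..M div 2} - {..<Suc M div 2}. V i (M - 2 * i) = 0"
    proof
      fix i assume "i \<in> {..M div 2} - {..<Suc M div 2}"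
      then have "M - 2 * i = 0" by auto
      then show "V i (M - 2 * i) = 0" using assms by simp
    qed
  qed auto
  show ?thesis unfolding sum.distrib 1 2 3 ..
qed

context dihedral
begin

lemma of_real_hterm:
  "complex_of_real (u n z w) = A n w * \<phi> n z + cnj (A n w) * cnj (\<phi> n z)"
  by (simp add: hterm_def complex_eq_iff)

text \<open>Differentiating (z . z)^j leaves a factor cnj z. The product is split as for classical
  harmonics, into |z|^2 times a part of degree n - 1 and a part of degree n + 1, by using
  \<open>mult_hprev\<close> in degree n and, conjugated, in degree n + 1.\<close>

lemma cnj_mult_hterm:
  "of_real (w \<bullet> w) * (cnj z * of_real (u n z w)) =
     of_real (w \<bullet> w) * of_real (z \<bullet> z) * (A n w * \<mu> n z) / of_real (real n + \<gamma>) +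
     2 * cnj w * cnj (A (Suc n) w) *
       (of_real (real (Suc n) + \<gamma>) * (cnj (\<phi> (Suc n) z) - of_real (s (Suc n)) * \<phi> (Suc n) z))"
proof -
  let ?g = "complex_of_real (real n + \<gamma>)" and ?s = "complex_of_real (s n)"
  let ?f = "\<phi> n z" and ?h = "\<mu> n z" and ?a = "A n w"
  have g: "?g \<noteq> 0" unfolding of_real_eq_0_iff using gamma_pos by linarith
  have c: "complex_of_real (c n) = ?s * ?g" by (subst coef_eq_ratio) simp
  have gen: "y * f = (x * y) * h / g + t * (y * f')" if "f = x * h / g + t * f'" for x y f f' g h t :: complex
    unfolding that by (simp add: algebra_simps)
  have "z * ?h = ?g * ?f - ?s * ?g * cnj ?f" using mult_hprev[of z n] unfolding c .
  then have "?f = z * ?h / ?g + ?s * cnj ?f" using g by (simp add: field_simps)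
  then have f: "cnj z * ?f = (z * cnj z) * ?h / ?g + ?s * (cnj z * cnj ?f)"
    by (rule gen)
  have c': "complex_of_real (c (Suc n)) = of_real (s (Suc n)) * of_real (real (Suc n) + \<gamma>)"
    by (subst coef_eq_ratio) simp
  have "cnj z * cnj ?f = cnj (z * \<mu> (Suc n) z)" by (simp add: hprev_def)
  also have "\<dots> = of_real (real (Suc n) + \<gamma>) * (cnj (\<phi> (Suc n) z) - of_real (s (Suc n)) * \<phi> (Suc n) z)"
    unfolding mult_hprev c' by (simp add: algebra_simps)
  finally have F: "of_real (real (Suc n) + \<gamma>) * (cnj (\<phi> (Suc n) z) - of_real (s (Suc n)) * \<phi> (Suc n) z)
      = cnj z * cnj ?f" by simp
  have W: "2 * cnj w * cnj (A (Suc n) w) = (w * cnj w) * (cnj ?a + ?s * ?a)"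
    by (simp add: hcoef.simps)
  have gen2: "r * (y * (a * p + b * p')) = r * (x * y) * (a * h) / g + r * (b + t * a) * (y * p')"
    if "y * p = (x * y) * h / g + t * (y * p')" for a b r x y p p' g h t :: complex
  proof -
    have "r * (y * (a * p + b * p')) = r * (a * (y * p) + b * (y * p'))" by (simp add: algebra_simps)
    then show ?thesis unfolding that by (simp add: algebra_simps)
  qed
  show ?thesis
    unfolding F W of_real_hterm of_real_inner_self by (rule gen2[OF f])
qed

text \<open>The Dunkl operator in direction \<open>\<xi>\<close> maps the \<open>(j, n)\<close>-summand of the kernel to
  the real part of \<open>\<xi> * gterm j n z w\<close>; the sum telescopes to \<open>cnj w\<close> times the kernel.\<close>
definition gterm :: "nat \<Rightarrow> nat \<Rightarrow> complex \<Rightarrow> complex \<Rightarrow> complex" where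
  "gterm j n z w = of_real (\<theta> j n) *
     (of_nat (2 * j) * of_real ((z \<bullet> z) ^ (j - 1) * (w \<bullet> w) ^ j) * (cnj z * of_real (u n z w)) +
      2 * of_real (((z \<bullet> z) * (w \<bullet> w)) ^ j) * (A n w * \<mu> n z))"

text \<open>Both pieces are indexed by the pair they land in: \<open>gterm_up j m\<close> comes from
  (j, m + 1), \<open>gterm_dn j m\<close> from (j + 1, m - 1).\<close>

definition gterm_up :: "nat \<Rightarrow> nat \<Rightarrow> complex \<Rightarrow> complex \<Rightarrow> complex" where
  "gterm_up j m z w = 2 * of_real (\<theta> j m * ((z \<bullet> z) * (w \<bullet> w)) ^ j) * (A (Suc m) w * \<phi> m z)"

definition gterm_dn :: "nat \<Rightarrow> nat \<Rightarrow> complex \<Rightarrow> complex \<Rightarrow> complex" where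
  "gterm_dn j m z w = of_real (\<theta> j m * ((z \<bullet> z) * (w \<bullet> w)) ^ j) *
     (cnj w * cnj (A m w) * (cnj (\<phi> m z) - of_real (s m) * \<phi> m z))"

lemma gterm_split:
  "gterm j n z w = (if n = 0 then 0 else gterm_up j (n - 1) z w) + (if j = 0 then 0 else gterm_dn (j - 1) (n + 1) z w)"
proof (cases j)
  case 0
  then show ?thesis by (cases n) (auto simp: gterm_def gterm_up_def hprev_def)
next
  case (Suc i)
  let ?q = "z \<bullet> z" and ?r = "w \<bullet> w" and ?h = "\<mu> n z"
  let ?D = "cnj (\<phi> (Suc n) z) - of_real (s (Suc n)) * \<phi> (Suc n) z"
  let ?P = "complex_of_real ((?q * ?r) ^ i)" and ?qr = "complex_of_real (?q * ?r)"
  have p: "complex_of_real (?q ^ (j - 1) * ?r ^ j) = ?P * of_real ?r"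
    by (simp add: Suc power_mult_distrib mult_ac)
  have p': "complex_of_real ((?q * ?r) ^ j) = ?P * ?qr" by (simp add: Suc)
  have 1: "gterm j n z w = of_real (\<theta> j n) * ?P *
     (of_nat (2 * j) * (of_real ?r * (cnj z * of_real (u n z w))) + 2 * ?qr * (A n w * ?h))"
    unfolding gterm_def p p' by (simp only: distrib_left mult_ac)
  \<comment> \<open>In the factor j / (n + gamma) + 1 the first part comes from the derivative of
    the radial power and the 1 from that of the harmonic part.\<close>
  have 2: "of_nat (2 * j) * (of_real ?r * (cnj z * of_real (u n z w))) + 2 * ?qr * (A n w * ?h)
     = 2 * ?qr * (A n w * ?h) * (of_nat j / of_real (real n + \<gamma>) + 1)
       + of_real (4 * real j * (real (Suc n) + \<gamma>)) * (cnj w * cnj (A (Suc n) w) * ?D)"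
    unfolding cnj_mult_hterm by (simp add: algebra_simps)
  have V: "of_real (\<theta> j n) * ?P * (of_real (4 * real j * (real (Suc n) + \<gamma>)) * (cnj w * cnj (A (Suc n) w) * ?D))
     = gterm_dn i (Suc n) z w"
  proof -
    have "\<theta> j n * (4 * real j * (real (Suc n) + \<gamma>)) = \<theta> i (Suc n)"
      using bessel_coef_Suc_left[OF gamma_pos, of i n] Suc by (simp only: mult_ac)
    then have e: "complex_of_real (\<theta> i (Suc n)) = of_real (\<theta> j n) * of_real (4 * real j * (real (Suc n) + \<gamma>))"
      by (metis of_real_mult)
    show ?thesis unfolding gterm_dn_def of_real_mult[of "\<theta> i (Suc n)"] e by (simp only: mult_ac)
  qed
  have U: "of_real (\<theta> j n) * ?P * (2 * ?qr * (A n w * ?h) * (of_nat j / of_real (real n + \<gamma>) + 1))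
      = (if n = 0 then 0 else gterm_up j (n - 1) z w)"
  proof (cases n)
    case 0
    then show ?thesis by (simp add: hprev_def)
  next
    case n: (Suc m)
    have "real n + \<gamma> \<noteq> 0" using gamma_pos by linarith
    then have "\<theta> j n * (real j / (real n + \<gamma>) + 1) = \<theta> j m"
      using bessel_coef_Suc_right[OF gamma_pos, of j m] n by (simp add: field_simps)
    then have "complex_of_real (\<theta> j m) = of_real (\<theta> j n * (real j / (real n + \<gamma>) + 1))" by simp
    then have e: "complex_of_real (\<theta> j m) = of_real (\<theta> j n) * (of_nat j / of_real (real n + \<gamma>) + 1)" by simp
    have m: "n - 1 = m" "Suc m = n" "?h = \<phi> m z" "(n = 0) = False" using n by (simp_all add: hprev_def)
    show ?thesis unfolding gterm_up_def m of_real_mult[of "\<theta> j m"] e p' if_False by (simp only: mult_ac)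
  qed
  have "gterm j n z w = (if n = 0 then 0 else gterm_up j (n - 1) z w) + gterm_dn i (Suc n) z w"
    unfolding 1 2 U[symmetric] V[symmetric] by (rule distrib_left)
  then show ?thesis using Suc by simp
qed

lemma gterm_up_plus_dn: "gterm_up i m z w + gterm_dn i m z w = cnj w * of_real (\<theta> i m * ((z \<bullet> z) * (w \<bullet> w)) ^ i * u m z w)"
proof -
  let ?a = "A m w" and ?f = "\<phi> m z"
  have "2 * A (Suc m) w = cnj w * (?a + of_real (s m) * cnj ?a)" by (simp add: hcoef.simps)
  then have "2 * (A (Suc m) w * ?f) + cnj w * cnj ?a * (cnj ?f - of_real (s m) * ?f) = cnj w * of_real (u m z w)"
    unfolding of_real_hterm mult.assoc[symmetric] by (simp add: algebra_simps)
  then have *: "2 * K * (A (Suc m) w * ?f) + K * (cnj w * cnj ?a * (cnj ?f - of_real (s m) * ?f)) =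
      cnj w * (K * of_real (u m z w))" for K
    unfolding mult.assoc[of 2] mult.left_commute[of 2] mult.left_commute[of "cnj w" K]
    by (metis (no_types) distrib_left)
  show ?thesis unfolding gterm_up_def gterm_dn_def of_real_mult[of _ "u m z w"] by (rule *)
qed

lemma sum_gterm:
  "(\<Sum>j\<le>Suc M div 2. gterm j (Suc M - 2 * j) z w) = cnj w * of_real (E M z w)"
proof -
  \<comment> \<open>The boundary value required by \<open>sum_half_shift\<close>: as
    \<open>s 0\<close> is 1, the difference in \<open>gterm_dn\<close> vanishes in degree 0.\<close>
  have "gterm_dn i 0 z w = 0" for i by (simp add: gterm_dn_def ratio_0)
  then have "(\<Sum>j\<le>Suc M div 2. gterm j (Suc M - 2 * j) z w) =
      (\<Sum>j\<le>M div 2. gterm_up j (M - 2 * j) z w + gterm_dn j (M - 2 * j) z w)"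
    unfolding gterm_split by (rule sum_half_shift)
  also have "\<dots> = cnj w * of_real (E M z w)"
    unfolding gterm_up_plus_dn hom_kernel_def by (simp only: of_real_sum sum_distrib_left)
  finally show ?thesis .
qed

lemma inner_refl_dih [simp]: "\<sigma> j z \<bullet> \<sigma> j z = z \<bullet> z"
  by (simp add: dot_square_norm refl_dih_cis norm_mult)

text \<open>By \<open>mult_hprev\<close>: the weights kappa sum to gamma, and the weighted sum of
  the reflected polynomials is \<open>c n\<close> times the conjugate polynomial.\<close>

lemma hterm_euler:
  "2 * Re (A n w * (z * \<mu> n z)) =
     real n * u n z w + (\<Sum>j<2*k. \<kappa> j * (u n z w - u n (\<sigma> j z) w))"
proof -
  have scale: "m * (2 * Re (a * (x * y))) = 2 * Re (a * (of_real m * x * y))" for m a x y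
    by (simp add: algebra_simps)
  have "(\<Sum>j<2*k. \<kappa> j * u n (\<sigma> j z) w) =
      2 * Re (A n w * ((\<Sum>j<2*k. of_real (\<kappa> j) * \<omega> j ^ n) * cnj (\<phi> n z)))"
    unfolding hterm_def refl_dih_cis harm_refl sum_distrib_left sum_distrib_right Re_sum
    by (rule sum.cong) (simp_all only: scale)
  then have 1: "(\<Sum>j<2*k. \<kappa> j * u n (\<sigma> j z) w) = 2 * Re (A n w * (of_real (c n) * cnj (\<phi> n z)))"
    unfolding coef_sum .
  have 2: "(\<Sum>j<2*k. \<kappa> j * u n z w) = \<gamma> * u n z w"
    by (simp add: sum_mult_dih flip: sum_distrib_right)
  have lin: "2 * Re (a * (of_real g * x - y)) = g * (2 * Re (a * x)) - 2 * Re (a * y)" for a x y g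
    by (simp add: algebra_simps)
  have "2 * Re (A n w * (z * \<mu> n z)) =
     (real n + \<gamma>) * u n z w - 2 * Re (A n w * (of_real (c n) * cnj (\<phi> n z)))"
    unfolding mult_hprev hterm_def by (rule lin)
  then show ?thesis
    unfolding right_diff_distrib sum_subtractf 1 2 distrib_right by linarith
qed

text \<open>The radial factor is reflection invariant, so it contributes only its degree 2 j to the
  Euler operator.\<close>

lemma Re_mult_gterm:
  "Re (z * gterm j n z w) = \<theta> j n * ((z \<bullet> z) * (w \<bullet> w)) ^ j *
     (real (2 * j + n) * u n z w + (\<Sum>i<2*k. \<kappa> i * (u n z w - u n (\<sigma> i z) w)))"
proof -
  let ?q = "z \<bullet> z" and ?r = "w \<bullet> w"
  have "z * gterm j n z w = of_real (\<theta> j n) * (of_nat (2 * j) * of_real (?q ^ (j - 1) * ?r ^ j) * (of_real ?q * of_real (u n z w))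
     + 2 * of_real ((?q * ?r) ^ j) * (A n w * (z * \<mu> n z)))"
    unfolding gterm_def of_real_inner_self[of z] by (simp only: distrib_left mult_ac)
  also have "of_nat (2 * j) * of_real (?q ^ (j - 1) * ?r ^ j) * (of_real ?q * of_real (u n z w))
      = complex_of_real (real (2 * j) * (?q * ?r) ^ j * u n z w)"
    by (cases j) (simp_all add: power_mult_distrib mult_ac)
  finally have *: "z * gterm j n z w = of_real (\<theta> j n) * (of_real (real (2 * j) * (?q * ?r) ^ j * u n z w) +
      2 * of_real ((?q * ?r) ^ j) * (A n w * (z * \<mu> n z)))" .
  have Re_lin: "Re (of_real t * (of_real a + 2 * of_real b * y)) = t * (a + b * (2 * Re y))" for t a b y
    by simp
  have "Re (z * gterm j n z w) = \<theta> j n * (real (2 * j) * (?q * ?r) ^ j * u n z w +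
      (?q * ?r) ^ j * (2 * Re (A n w * (z * \<mu> n z))))"
    unfolding * by (rule Re_lin)
  then show ?thesis unfolding hterm_euler by (simp add: algebra_simps)
qed

text \<open>For homogeneous parts the derivative along z is multiplication by the degree, and for xi
  = z the root quotient is 1. What remains is a linear system for the values on one finite orbit,
  without derivatives.\<close>

definition euler_seq :: "complex \<Rightarrow> (nat \<Rightarrow> complex \<Rightarrow> real) \<Rightarrow> bool" where
  "euler_seq w f \<longleftrightarrow> (\<forall>z. f 0 z = 1) \<and>
     (\<forall>N (z::complex). real (Suc N) * f (Suc N) z +
        (\<Sum>j<2*k. \<kappa> j * (f (Suc N) z - f (Suc N) (\<sigma> j z))) = (z \<bullet> w) * f N z)"

lemma euler_seq_kernel: "euler_seq w (\<lambda>N z. E N z w)"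
  unfolding euler_seq_def
proof (intro conjI allI)
  fix z show "E 0 z w = 1" by (simp add: hom_kernel_def hterm_def)
next
  fix N and z :: complex
  let ?K = "\<lambda>j n. \<theta> j n * ((z \<bullet> z) * (w \<bullet> w)) ^ j" and ?S = "{..Suc N div 2}"
  let ?n = "\<lambda>j. Suc N - 2 * j"
  have "(z \<bullet> w) * E N z w = Re (z * (cnj w * of_real (E N z w)))"
    by (simp add: inner_complex_def algebra_simps)
  also have "\<dots> = (\<Sum>j\<in>?S. Re (z * gterm j (?n j) z w))"
    by (simp only: sum_gterm[symmetric] sum_distrib_left Re_sum)
  also have "\<dots> = (\<Sum>j\<in>?S. ?K j (?n j) * (real (Suc N) * u (?n j) z w +
       (\<Sum>i<2*k. \<kappa> i * (u (?n j) z w - u (?n j) (\<sigma> i z) w))))"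
  proof (rule sum.cong[OF refl])
    fix j assume "j \<in> ?S"
    then have "2 * j + ?n j = Suc N" by auto
    then show "Re (z * gterm j (?n j) z w) = ?K j (?n j) * (real (Suc N) * u (?n j) z w +
       (\<Sum>i<2*k. \<kappa> i * (u (?n j) z w - u (?n j) (\<sigma> i z) w)))"
      unfolding Re_mult_gterm by simp
  qed
  also have "\<dots> = real (Suc N) * E (Suc N) z w +
      (\<Sum>i<2*k. \<kappa> i * (E (Suc N) z w - E (Suc N) (\<sigma> i z) w))"
  proof -
    have "(\<Sum>i<2*k. \<kappa> i * (E (Suc N) z w - E (Suc N) (\<sigma> i z) w)) =
      (\<Sum>i<2*k. \<Sum>j\<in>?S. ?K j (?n j) * (\<kappa> i * (u (?n j) z w - u (?n j) (\<sigma> i z) w)))"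
      unfolding hom_kernel_def by (simp add: sum_subtractf[symmetric] sum_distrib_left algebra_simps)
    also have "\<dots> = (\<Sum>j\<in>?S. ?K j (?n j) * (\<Sum>i<2*k. \<kappa> i * (u (?n j) z w - u (?n j) (\<sigma> i z) w)))"
      unfolding sum_distrib_left by (rule sum.swap)
    moreover have "real (Suc N) * E (Suc N) z w = (\<Sum>j\<in>?S. ?K j (?n j) * (real (Suc N) * u (?n j) z w))"
      unfolding hom_kernel_def sum_distrib_left by (rule sum.cong) (simp_all only: mult_ac)
    ultimately show ?thesis
      by (simp only: distrib_left sum.distrib)
  qed
  finally show "real (Suc N) * E (Suc N) z w +
      (\<Sum>i<2*k. \<kappa> i * (E (Suc N) z w - E (Suc N) (\<sigma> i z) w)) = (z \<bullet> w) * E N z w" by simp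
qed

section \<open>Uniqueness for the Euler equation in each degree\<close>

definition dih_orbit :: "complex \<Rightarrow> complex set" where
  "dih_orbit x = (\<lambda>\<xi>. x * \<xi>) ` {\<xi>. \<xi> ^ (2 * k) = 1} \<union> (\<lambda>\<xi>. cnj x * \<xi>) ` {\<xi>. \<xi> ^ (2 * k) = 1}"

lemma omega_power_2k: "\<omega> j ^ (2 * k) = 1"
  using omega_sq_power[of k j] by (simp add: mult_2 power_add)

lemma finite_dih_orbit: "finite (dih_orbit x)"
  unfolding dih_orbit_def using k_pos by (intro finite_UnI finite_imageI finite_roots_unity) simp_all

lemma dih_orbit_self: "x \<in> dih_orbit x"
  unfolding dih_orbit_def by (force intro: image_eqI[of _ _ 1])

text \<open>Describing the orbit by all roots of unity of order 2 k, rather than by indices j < 2 k,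
  gives closure under reflections without reduction of indices.\<close>

lemma dih_orbit_refl: "y \<in> dih_orbit x \<Longrightarrow> \<sigma> j y \<in> dih_orbit x"
proof -
  have c: "(cnj \<xi> * \<omega> j) ^ (2 * k) = 1" if "\<xi> ^ (2 * k) = 1" for \<xi>
    using that omega_power_2k[of j] by (simp only: power_mult_distrib complex_cnj_power[symmetric]) simp
  assume "y \<in> dih_orbit x"
  then show ?thesis
    unfolding dih_orbit_def refl_dih_cis
    using c by (auto simp: mult.assoc intro!: imageI)
qed

text \<open>Evaluate the equation at a maximum point of the finite orbit.\<close>
lemma euler_max_principle:
  assumes "a > 0" "\<And>x. a * d x + (\<Sum>j<2*k. \<kappa> j * (d x - d (\<sigma> j x))) = 0"
  shows "d x \<le> 0"
proof -
  let ?M = "Max (d ` dih_orbit x)"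
  have fin: "finite (d ` dih_orbit x)" "d ` dih_orbit x \<noteq> {}" using finite_dih_orbit dih_orbit_self by auto
  then have "?M \<in> d ` dih_orbit x" by (rule Max_in)
  then obtain y where y: "y \<in> dih_orbit x" "d y = ?M" by auto
  have "d (\<sigma> j y) \<le> d y" for j
    unfolding y(2) using fin dih_orbit_refl[OF y(1)] by (intro Max_ge) auto
  then have "(\<Sum>j<2*k. \<kappa> j * (d y - d (\<sigma> j y))) \<ge> 0"
    by (intro sum_nonneg mult_nonneg_nonneg mult_dih_nonneg) simp
  with assms(2)[of y] have "a * d y \<le> 0" by linarith
  then have "d y \<le> 0" using assms(1) by (simp add: mult_le_0_iff)
  moreover have "d x \<le> ?M" using fin dih_orbit_self by (intro Max_ge) auto
  ultimately show ?thesis using y(2) by simp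
qed

text \<open>Once degree N agrees, the difference in degree N + 1 solves the homogeneous equation
  with factor N + 1 > 0; the maximum principle applies to it and to its negative.\<close>

lemma euler_seq_unique:
  assumes "euler_seq w f" "euler_seq w g"
  shows "f N z = g N z"
proof (induction N arbitrary: z)
  case 0
  then show ?case using assms by (simp add: euler_seq_def)
next
  case (Suc N)
  define d where "d x = f (Suc N) x - g (Suc N) x" for x
  have f: "real (Suc N) * f (Suc N) z +
        (\<Sum>j<2*k. \<kappa> j * (f (Suc N) z - f (Suc N) (\<sigma> j z))) = (z \<bullet> w) * f N z" for z :: complex
    using assms(1) unfolding euler_seq_def by blast
  have g: "real (Suc N) * g (Suc N) z +
        (\<Sum>j<2*k. \<kappa> j * (g (Suc N) z - g (Suc N) (\<sigma> j z))) = (z \<bullet> w) * f N z" for z :: complex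
    using assms(2) Suc unfolding euler_seq_def by auto
  have e: "real (Suc N) * d x + (\<Sum>j<2*k. \<kappa> j * (d x - d (\<sigma> j x))) = 0" for x
  proof -
    have "(\<Sum>j<2*k. \<kappa> j * (d x - d (\<sigma> j x))) =
      (\<Sum>j<2*k. \<kappa> j * (f (Suc N) x - f (Suc N) (\<sigma> j x))) -
      (\<Sum>j<2*k. \<kappa> j * (g (Suc N) x - g (Suc N) (\<sigma> j x)))"
      unfolding d_def sum_subtractf[symmetric] by (simp add: algebra_simps)
    then show ?thesis using f[of x] g[of x] by (simp add: d_def right_diff_distrib del: of_nat_Suc)
  qed
  have "d z \<le> 0" by (rule euler_max_principle[OF _ e]) simp
  moreover have "- d z \<le> 0"
  proof (rule euler_max_principle[of "real (Suc N)" "\<lambda>x. - d x"])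
    fix x
    have "(\<Sum>j<2*k. \<kappa> j * (- d x - - d (\<sigma> j x))) =
        - (\<Sum>j<2*k. \<kappa> j * (d x - d (\<sigma> j x)))"
      unfolding sum_negf[symmetric] by (rule sum.cong) (simp_all add: algebra_simps)
    then show "real (Suc N) * - d x + (\<Sum>j<2*k. \<kappa> j * (- d x - - d (\<sigma> j x))) = 0"
      using e[of x] by (simp del: of_nat_Suc)
  qed simp
  ultimately show ?case by (simp add: d_def)
qed

end

section \<open>The Dunkl kernel\<close>

fun dharm :: "nat \<Rightarrow> real \<Rightarrow> real \<Rightarrow> nat \<Rightarrow> complex \<Rightarrow> complex \<Rightarrow> complex" where
  "dharm k \<alpha> \<beta> 0 z h = 0"
| "dharm k \<alpha> \<beta> (Suc n) z h =
     ((h * dih_harm k \<alpha> \<beta> n z + z * dharm k \<alpha> \<beta> n z h) +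
      of_real (dih_ratio k \<alpha> \<beta> (Suc n)) * cnj (h * dih_harm k \<alpha> \<beta> n z + z * dharm k \<alpha> \<beta> n z h)) /
     of_real ((real (Suc n) + real k * (\<alpha> + \<beta>)) * (1 - (dih_ratio k \<alpha> \<beta> (Suc n))\<^sup>2))"

declare dharm.simps(2) [simp del]

lemma has_derivative_cnj_comp:
  "(f has_derivative f') F \<Longrightarrow> ((\<lambda>x. cnj (f x)) has_derivative (\<lambda>h. cnj (f' h))) F"
  by (rule bounded_linear.has_derivative[OF bounded_linear_cnj])

lemma harm_has_derivative: "(dih_harm k \<alpha> \<beta> n has_derivative dharm k \<alpha> \<beta> n z) (at z)"
proof (induction n)
  case 0
  have "dih_harm k \<alpha> \<beta> 0 = (\<lambda>_. 1)" "dharm k \<alpha> \<beta> 0 z = (\<lambda>_. 0)" by auto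
  then show ?case by simp
next
  case (Suc n)
  let ?X = "\<lambda>z. z * dih_harm k \<alpha> \<beta> n z" and ?X' = "\<lambda>h. h * dih_harm k \<alpha> \<beta> n z + z * dharm k \<alpha> \<beta> n z h"
  have X: "(?X has_derivative ?X') (at z)"
    using Suc by (auto intro!: derivative_eq_intros)
  have cX: "((\<lambda>z. cnj (?X z)) has_derivative (\<lambda>h. cnj (?X' h))) (at z)"
    using X by (rule has_derivative_cnj_comp)
  have "((\<lambda>z. (?X z + of_real (dih_ratio k \<alpha> \<beta> (Suc n)) * cnj (?X z)) /
     of_real ((real (Suc n) + real k * (\<alpha> + \<beta>)) * (1 - (dih_ratio k \<alpha> \<beta> (Suc n))\<^sup>2))) has_derivative
    (\<lambda>h. (?X' h + of_real (dih_ratio k \<alpha> \<beta> (Suc n)) * cnj (?X' h)) /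
     of_real ((real (Suc n) + real k * (\<alpha> + \<beta>)) * (1 - (dih_ratio k \<alpha> \<beta> (Suc n))\<^sup>2)))) (at z)"
    unfolding divide_inverse
    by (intro has_derivative_mult_left has_derivative_add X has_derivative_mult_right cX)
  then show ?case
    unfolding dih_harm.simps(2)[abs_def] dharm.simps(2)[abs_def] .
qed

lemma continuous_on_harm [continuous_intros]:
  "continuous_on S f \<Longrightarrow> continuous_on S (\<lambda>x. dih_harm k \<alpha> \<beta> n (f x))"
proof -
  assume f: "continuous_on S f"
  have "continuous_on UNIV (dih_harm k \<alpha> \<beta> n)"
    using harm_has_derivative by (metis has_derivative_continuous continuous_at_imp_continuous_on)
  then show ?thesis by (rule continuous_on_compose2[OF _ f]) simp
qed

lemma continuous_on_dharm: "continuous_on UNIV (\<lambda>z. dharm k \<alpha> \<beta> n z h)"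
proof (induction n)
  case (Suc n)
  show ?case unfolding dharm.simps divide_inverse by (intro continuous_intros Suc)
qed simp

text \<open>The truncated exponent j - 1 is harmless at j = 0 because of the factor 2 j.\<close>

definition dhom_kernel :: "nat \<Rightarrow> real \<Rightarrow> real \<Rightarrow> nat \<Rightarrow> complex \<Rightarrow> complex \<Rightarrow> complex \<Rightarrow> real" where
  "dhom_kernel k \<alpha> \<beta> N z w h = (\<Sum>j\<le>N div 2. bessel_coef (real k * (\<alpha> + \<beta>)) j (N - 2 * j) *
      (real (2 * j) * ((z \<bullet> z) ^ (j - 1) * (w \<bullet> w) ^ j) * ((z \<bullet> h) * hterm k \<alpha> \<beta> (N - 2 * j) z w) +
       ((z \<bullet> z) * (w \<bullet> w)) ^ j * (2 * Re (hcoef k \<alpha> \<beta> (N - 2 * j) w * dharm k \<alpha> \<beta> (N - 2 * j) z h))))"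

lemma hterm_has_derivative:
  "((\<lambda>z. hterm k \<alpha> \<beta> n z w) has_derivative (\<lambda>h. 2 * Re (hcoef k \<alpha> \<beta> n w * dharm k \<alpha> \<beta> n z h))) (at z)"
  unfolding hterm_def
  by (intro has_derivative_mult_right bounded_linear.has_derivative[OF bounded_linear_Re] harm_has_derivative)

lemma inner_power_has_derivative:
  fixes z :: "'a::real_inner"
  shows "((\<lambda>z. ((z \<bullet> z) * r) ^ j) has_derivative (\<lambda>h. real (2 * j) * ((z \<bullet> z) ^ (j - 1) * r ^ j) * (z \<bullet> h))) (at z)"
proof -
  have "((\<lambda>z. (z \<bullet> z) ^ j * r ^ j) has_derivative (\<lambda>h. real (2 * j) * ((z \<bullet> z) ^ (j - 1) * r ^ j) * (z \<bullet> h))) (at z)"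
    by (auto intro!: derivative_eq_intros simp: inner_commute algebra_simps)
  then show ?thesis by (simp only: power_mult_distrib)
qed

lemma hom_kernel_has_derivative:
  "((\<lambda>z. hom_kernel k \<alpha> \<beta> N z w) has_derivative dhom_kernel k \<alpha> \<beta> N z w) (at z)"
proof -
  have "((\<lambda>z. K * ((z \<bullet> z) * (w \<bullet> w)) ^ j * hterm k \<alpha> \<beta> n z w) has_derivative (\<lambda>h.
     K * (real (2 * j) * ((z \<bullet> z) ^ (j - 1) * (w \<bullet> w) ^ j) * ((z \<bullet> h) * hterm k \<alpha> \<beta> n z w) +
       ((z \<bullet> z) * (w \<bullet> w)) ^ j * (2 * Re (hcoef k \<alpha> \<beta> n w * dharm k \<alpha> \<beta> n z h))))) (at z)" for K j n
    unfolding mult.assoc[of K]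
    by (rule has_derivative_eq_rhs[OF has_derivative_mult_right[OF has_derivative_mult[OF inner_power_has_derivative hterm_has_derivative]]])
       (simp add: algebra_simps fun_eq_iff)
  then show ?thesis
    unfolding hom_kernel_def dhom_kernel_def[abs_def] by (intro has_derivative_sum)
qed

lemma continuous_on_hterm [continuous_intros]:
  "continuous_on S f \<Longrightarrow> continuous_on S (\<lambda>x. hterm k \<alpha> \<beta> n (f x) w)"
  unfolding hterm_def by (intro continuous_intros)

lemma continuous_on_dhom_kernel: "continuous_on UNIV (\<lambda>z. dhom_kernel k \<alpha> \<beta> N z w h)"
  unfolding dhom_kernel_def by (intro continuous_intros continuous_on_dharm)

lemma root_dih_cis: "root_dih k j = \<i> * cis (real j * pi / (2 * real k))"
  by (simp add: root_dih_def cis_conv_exp)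

lemma norm_root_dih: "norm (root_dih k j) = 1"
  by (simp add: root_dih_cis norm_mult)

lemma root_dih_sq: "root_dih k j * root_dih k j = - cis (real j * pi / real k)"
proof -
  have "cis (real j * pi / (2 * real k)) * cis (real j * pi / (2 * real k)) = cis (real j * pi / real k)"
    unfolding cis_mult by (rule arg_cong[where f = cis]) (cases "k = 0"; simp add: field_simps)
  then show ?thesis by (simp add: root_dih_cis algebra_simps)
qed

text \<open>The root a has norm 1 and square -cis (j pi / k), so the Euclidean reflection in its
  orthogonal line is z -> cnj z * cis (j pi / k).\<close>

lemma minus_refl_dih: "z - refl_dih k j z = 2 * of_real (root_dih k j \<bullet> z) * root_dih k j"
proof -
  let ?a = "root_dih k j"
  have "2 * complex_of_real (?a \<bullet> z) = cnj ?a * z + ?a * cnj z"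
    by (simp add: complex_eq_iff inner_complex_def)
  then have "2 * of_real (?a \<bullet> z) * ?a = (cnj ?a * ?a) * z + (?a * ?a) * cnj z"
    by (simp add: algebra_simps)
  moreover have "cnj ?a * ?a = 1"
    using norm_root_dih[of k j] by (metis mult.commute complex_norm_square of_real_1 one_power2)
  ultimately show ?thesis by (simp add: root_dih_sq refl_dih_cis)
qed

section \<open>Convergence of the kernel series and of its gradient\<close>

lemma half_sum_bound:
  fixes a :: "nat \<Rightarrow> real"
  assumes "\<And>j. j \<le> N div 2 \<Longrightarrow> \<bar>a j\<bar> \<le> 2 ^ N / fact N * B" "B \<ge> 0"
  shows "\<bar>\<Sum>j\<le>N div 2. a j\<bar> \<le> 4 ^ N / fact N * B"
proof -
  have "\<bar>\<Sum>j\<le>N div 2. a j\<bar> \<le> (\<Sum>j\<le>N div 2. \<bar>a j\<bar>)" by (rule sum_abs)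
  also have "\<dots> \<le> of_nat (card {..N div 2}) * (2 ^ N / fact N * B)"
    using assms(1) by (intro sum_bounded_above) auto
  \<comment> \<open>Bounding the number of summands by 2^N is generous, but a geometric loss does no
    harm against the factorial.\<close>
  also have "\<dots> \<le> 2 ^ N * (2 ^ N / fact N * B)"
  proof (rule mult_right_mono)
    have "Suc (N div 2) \<le> Suc N" by simp
    also have "\<dots> \<le> 2 ^ N" using less_exp[of N] by (simp add: Suc_leI)
    finally show "of_nat (card {..N div 2}) \<le> (2::real) ^ N"
      by (metis card_atMost of_nat_le_iff of_nat_numeral of_nat_power)
  qed (use assms(2) in auto)
  also have "\<dots> = 4 ^ N / fact N * B"
    by (simp add: power_mult_distrib[symmetric] flip: mult.assoc)
  finally show ?thesis .
qed

lemma summable_exp_terms: "summable (\<lambda>n. x ^ n / fact n)" for x :: real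
  using summable_exp[of x] by (simp add: field_simps)

context dihedral
begin

abbreviation \<phi>' :: "nat \<Rightarrow> complex \<Rightarrow> complex \<Rightarrow> complex" where "\<phi>' \<equiv> dharm k \<alpha> \<beta>"

lemma fact_le_pochhammer: "fact (n + j) \<le> fact n * pochhammer (real n + \<gamma> + 1) j"
proof (induction j)
  case (Suc j)
  have "fact (n + Suc j) = fact (n + j) * (real (n + j) + 1)" by (simp add: algebra_simps)
  also have "\<dots> \<le> fact (n + j) * (real n + \<gamma> + 1 + real j)" using gamma_pos by (intro mult_left_mono) auto
  also have "\<dots> \<le> (fact n * pochhammer (real n + \<gamma> + 1) j) * (real n + \<gamma> + 1 + real j)"
    using Suc gamma_pos by (intro mult_right_mono) auto
  finally show ?case by (simp add: pochhammer_Suc mult.assoc)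
qed simp

lemma bessel_coef_nonneg: "\<theta> j n \<ge> 0"
  unfolding bessel_coef_def using gamma_pos by (intro divide_nonneg_nonneg mult_nonneg_nonneg pochhammer_nonneg) auto

text \<open>The Pochhammer symbol times n! dominates (n + j)!, and 1 / (j! (n + j)!) is a binomial
  coefficient over (2 j + n)!.\<close>

lemma bessel_coef_fact_le: "\<theta> j n / fact n \<le> 2 ^ (2 * j + n) / fact (2 * j + n)"
proof -
  have p: "pochhammer (real n + \<gamma> + 1) j > 0" using gamma_pos by (intro pochhammer_pos) simp
  have "\<theta> j n / fact n = 1 / (4 ^ j * (fact j * (fact n * pochhammer (real n + \<gamma> + 1) j)))"
    by (simp add: bessel_coef_def mult_ac)
  also have "\<dots> \<le> 1 / (1 * (fact j * fact (n + j)))"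
    using fact_le_pochhammer[of n j] p by (intro divide_left_mono mult_mono) auto
  also have "\<dots> = real ((2 * j + n) choose j) / fact (2 * j + n)"
    by (subst binomial_fact) (simp_all add: algebra_simps)
  also have "\<dots> \<le> 2 ^ (2 * j + n) / fact (2 * j + n)"
  proof (rule divide_right_mono)
    have "(2 * j + n) choose j \<le> 2 ^ (2 * j + n)"
      by (rule binomial_le_pow2)
    then show "real ((2 * j + n) choose j) \<le> 2 ^ (2 * j + n)"
      by (metis of_nat_le_iff of_nat_numeral of_nat_power)
  qed simp
  finally show ?thesis .
qed

lemma abs_hom_kernel_le: "\<bar>E N z w\<bar> \<le> 4 ^ N / fact N * (norm z * norm w) ^ N"
  unfolding hom_kernel_def
proof (rule half_sum_bound)
  fix j assume j: "j \<le> N div 2"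
  let ?n = "N - 2 * j"
  have N: "2 * j + ?n = N" using j by auto
  have q: "((z \<bullet> z) * (w \<bullet> w)) ^ j = (norm z * norm w) ^ (2 * j)"
    by (simp add: dot_square_norm power_mult power_mult_distrib)
  have "\<bar>\<theta> j ?n * ((z \<bullet> z) * (w \<bullet> w)) ^ j * u ?n z w\<bar> = \<theta> j ?n * (norm z * norm w) ^ (2 * j) * \<bar>u ?n z w\<bar>"
    unfolding q abs_mult using bessel_coef_nonneg by simp
  also have "\<dots> \<le> \<theta> j ?n * (norm z * norm w) ^ (2 * j) * ((norm z * norm w) ^ ?n / fact ?n)"
    using bessel_coef_nonneg by (intro mult_left_mono abs_hterm_le) simp
  also have "\<dots> = \<theta> j ?n / fact ?n * (norm z * norm w) ^ (2 * j + ?n)"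
    by (simp add: power_add)
  also have "\<dots> \<le> 2 ^ N / fact N * (norm z * norm w) ^ N"
    using bessel_coef_fact_le[of j ?n] unfolding N by (intro mult_right_mono) auto
  finally show "\<bar>\<theta> j ?n * ((z \<bullet> z) * (w \<bullet> w)) ^ j * u ?n z w\<bar> \<le> 2 ^ N / fact N * (norm z * norm w) ^ N" .
qed auto

lemma norm_dharm_le: "norm (\<phi>' n z h) \<le> real n * norm z ^ (n - 1) / fact n * norm h"
proof (induction n)
  case (Suc n)
  let ?X = "h * \<phi> n z + z * \<phi>' n z h"
  have "norm ?X \<le> norm h * norm (\<phi> n z) + norm z * norm (\<phi>' n z h)"
    by (rule order_trans[OF norm_triangle_ineq]) (simp add: norm_mult)
  also have "\<dots> \<le> norm h * (norm z ^ n / fact n) + norm z * (real n * norm z ^ (n - 1) / fact n * norm h)"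
    by (intro add_mono mult_left_mono norm_harm_le Suc) auto
  also have "norm z * (real n * norm z ^ (n - 1) / fact n * norm h) = real n * (norm z ^ n / fact n) * norm h"
    by (cases n) simp_all
  also have "norm h * (norm z ^ n / fact n) + real n * (norm z ^ n / fact n) * norm h =
      real (Suc n) * (norm z ^ n / fact n * norm h)" by (simp add: algebra_simps add_divide_distrib)
  finally have X: "norm ?X \<le> real (Suc n) * (norm z ^ n / fact n * norm h)" .
  have "norm (\<phi>' (Suc n) z h) \<le> norm ?X / real (Suc n)"
    unfolding dharm.simps by (rule norm_harm_step) simp
  also have "\<dots> \<le> real (Suc n) * (norm z ^ n / fact n * norm h) / real (Suc n)"
    by (intro divide_right_mono X) simp
  also have "\<dots> = real (Suc n) * norm z ^ (Suc n - 1) / fact (Suc n) * norm h"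
    by (simp add: field_simps del: of_nat_Suc)
  finally show ?case .
qed simp

text \<open>The factors 2 j and n produced by differentiation add up to the total degree
  \<open>Suc M\<close>, which afterwards cancels against the factorial.\<close>

lemma abs_dhom_kernel_le:
  "\<bar>dhom_kernel k \<alpha> \<beta> (Suc M) z w h\<bar> \<le>
     4 ^ Suc M / fact (Suc M) * (real (Suc M) * norm w ^ Suc M * norm z ^ M * norm h)"
  unfolding dhom_kernel_def
proof (rule half_sum_bound)
  let ?N = "Suc M"
  fix j assume j: "j \<le> ?N div 2"
  let ?n = "?N - 2 * j"
  have N: "2 * j + ?n = ?N" using j by auto
  have q: "z \<bullet> z = (norm z)\<^sup>2" "w \<bullet> w = (norm w)\<^sup>2" by (simp_all add: dot_square_norm)
  have 1: "\<bar>real (2 * j) * ((z \<bullet> z) ^ (j - 1) * (w \<bullet> w) ^ j) * ((z \<bullet> h) * u ?n z w)\<bar> \<le>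
     real (2 * j) * norm w ^ ?N * norm z ^ M / fact ?n * norm h"
  proof (cases j)
    case (Suc i)
    have pw: "(z \<bullet> z) ^ (j - 1) = norm z ^ (2 * i)" "(w \<bullet> w) ^ j = norm w ^ (2 * j)"
      by (simp_all only: q Suc diff_Suc_1 power_mult)
    have "\<bar>real (2 * j) * ((z \<bullet> z) ^ (j - 1) * (w \<bullet> w) ^ j) * ((z \<bullet> h) * u ?n z w)\<bar>
      = real (2 * j) * (norm z ^ (2 * i) * norm w ^ (2 * j)) * (\<bar>z \<bullet> h\<bar> * \<bar>u ?n z w\<bar>)"
      unfolding pw by (simp add: abs_mult)
    also have "\<dots> \<le> real (2 * j) * (norm z ^ (2 * i) * norm w ^ (2 * j)) * ((norm z * norm h) * ((norm z * norm w) ^ ?n / fact ?n))"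
      by (intro mult_left_mono mult_mono abs_hterm_le Cauchy_Schwarz_ineq2) auto
    also have "\<dots> = real (2 * j) * norm w ^ (2 * j + ?n) * norm z ^ (2 * i + 1 + ?n) / fact ?n * norm h"
      by (simp add: power_add power_mult_distrib mult_ac)
    also have "2 * i + 1 + ?n = M" using N Suc by simp
    finally show ?thesis unfolding N .
  qed simp
  have 2: "\<bar>((z \<bullet> z) * (w \<bullet> w)) ^ j * (2 * Re (A ?n w * \<phi>' ?n z h))\<bar> \<le>
     real ?n * norm w ^ ?N * norm z ^ M / fact ?n * norm h"
  proof -
    have R: "\<bar>Re (A ?n w * \<phi>' ?n z h)\<bar> \<le> norm (A ?n w) * norm (\<phi>' ?n z h)"
      using abs_Re_le_cmod by (metis norm_mult)
    have pw: "\<bar>((norm z)\<^sup>2 * (norm w)\<^sup>2) ^ j * (2 * r)\<bar> = norm z ^ (2 * j) * norm w ^ (2 * j) * (2 * \<bar>r\<bar>)" for r :: real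
      by (simp add: abs_mult power_mult power_mult_distrib)
    have "\<bar>((z \<bullet> z) * (w \<bullet> w)) ^ j * (2 * Re (A ?n w * \<phi>' ?n z h))\<bar> =
       norm z ^ (2 * j) * norm w ^ (2 * j) * (2 * \<bar>Re (A ?n w * \<phi>' ?n z h)\<bar>)"
      unfolding q by (rule pw)
    also have "\<dots> \<le> norm z ^ (2 * j) * norm w ^ (2 * j) * (2 * (norm (A ?n w) * norm (\<phi>' ?n z h)))"
      by (intro mult_left_mono R) simp_all
    also have "\<dots> \<le> norm z ^ (2 * j) * norm w ^ (2 * j) * (2 * (norm w ^ ?n / 2 * (real ?n * norm z ^ (?n - 1) / fact ?n * norm h)))"
      by (intro mult_left_mono mult_mono norm_hcoef_le norm_dharm_le) auto
    also have "\<dots> = norm w ^ (2 * j + ?n) * (norm z ^ (2 * j) * (real ?n * norm z ^ (?n - 1))) / fact ?n * norm h"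
      by (simp add: power_add mult_ac)
    also have "norm z ^ (2 * j) * (real ?n * norm z ^ (?n - 1)) = real ?n * norm z ^ M"
    proof (cases "?n = 0")
      case False
      then have "2 * j + (?n - 1) = M" using N by simp
      then show ?thesis by (metis mult.left_commute power_add)
    qed simp
    finally show ?thesis unfolding N by (simp add: mult_ac)
  qed
  have "\<bar>\<theta> j ?n * (real (2 * j) * ((z \<bullet> z) ^ (j - 1) * (w \<bullet> w) ^ j) * ((z \<bullet> h) * u ?n z w) +
       ((z \<bullet> z) * (w \<bullet> w)) ^ j * (2 * Re (A ?n w * \<phi>' ?n z h)))\<bar>
    \<le> \<theta> j ?n * (real (2 * j) * norm w ^ ?N * norm z ^ M / fact ?n * norm h + real ?n * norm w ^ ?N * norm z ^ M / fact ?n * norm h)"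
    unfolding abs_mult[of "\<theta> j ?n"] abs_of_nonneg[OF bessel_coef_nonneg]
    by (intro mult_left_mono bessel_coef_nonneg order_trans[OF abs_triangle_ineq] add_mono 1 2)
  also have "\<dots> = \<theta> j ?n / fact ?n * (real (2 * j + ?n) * norm w ^ ?N * norm z ^ M * norm h)"
    by (simp add: algebra_simps add_divide_distrib)
  also have "\<dots> \<le> 2 ^ ?N / fact ?N * (real ?N * norm w ^ ?N * norm z ^ M * norm h)"
    using bessel_coef_fact_le[of j ?n] unfolding N by (intro mult_right_mono) auto
  finally show "\<bar>\<theta> j ?n * (real (2 * j) * ((z \<bullet> z) ^ (j - 1) * (w \<bullet> w) ^ j) * ((z \<bullet> h) * u ?n z w) +
       ((z \<bullet> z) * (w \<bullet> w)) ^ j * (2 * Re (A ?n w * \<phi>' ?n z h)))\<bar>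
     \<le> 2 ^ ?N / fact ?N * (real ?N * norm w ^ ?N * norm z ^ M * norm h)" .
qed auto

definition grad_hom :: "nat \<Rightarrow> complex \<Rightarrow> complex \<Rightarrow> complex" where
  "grad_hom N w z = Complex (dhom_kernel k \<alpha> \<beta> N z w 1) (dhom_kernel k \<alpha> \<beta> N z w \<i>)"

lemma dhom_kernel_eq_inner: "dhom_kernel k \<alpha> \<beta> N z w h = grad_hom N w z \<bullet> h"
proof -
  let ?D = "dhom_kernel k \<alpha> \<beta> N z w"
  have lin: "linear ?D" using hom_kernel_has_derivative has_derivative_linear by blast
  have "h = Re h *\<^sub>R 1 + Im h *\<^sub>R \<i>" by (simp add: complex_eq_iff)
  then have "?D h = ?D (Re h *\<^sub>R 1 + Im h *\<^sub>R \<i>)" by simp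
  also have "\<dots> = Re h * ?D 1 + Im h * ?D \<i>"
    by (simp add: linear_add[OF lin] linear_cmul[OF lin] del: scaleR_conv_of_real)
  finally show ?thesis by (simp add: grad_hom_def inner_complex_def)
qed

lemma norm_grad_hom_le:
  assumes "norm z \<le> r"
  shows "norm (grad_hom (Suc M) w z) \<le> 8 * norm w * ((4 * norm w * r) ^ M / fact M)"
proof -
  have r: "norm w ^ Suc M * norm z ^ M \<le> norm w ^ Suc M * r ^ M"
    using assms by (intro mult_left_mono power_mono) auto
  have b: "\<bar>dhom_kernel k \<alpha> \<beta> (Suc M) z w h\<bar> \<le> 4 * norm w * ((4 * norm w * r) ^ M / fact M)"
    if "norm h = 1" for h
  proof -
    have "\<bar>dhom_kernel k \<alpha> \<beta> (Suc M) z w h\<bar> \<le> 4 ^ Suc M / fact (Suc M) * (real (Suc M) * norm w ^ Suc M * norm z ^ M * 1)"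
      using abs_dhom_kernel_le[of M z w h] that by simp
    also have "\<dots> = 4 ^ Suc M / fact M * (norm w ^ Suc M * norm z ^ M)"
      by (simp add: field_simps del: of_nat_Suc power_Suc)
    also have "\<dots> \<le> 4 ^ Suc M / fact M * (norm w ^ Suc M * r ^ M)"
      by (intro mult_left_mono r) simp
    finally show ?thesis by (simp add: power_mult_distrib mult_ac)
  qed
  have "norm (grad_hom (Suc M) w z) \<le> \<bar>Re (grad_hom (Suc M) w z)\<bar> + \<bar>Im (grad_hom (Suc M) w z)\<bar>"
    by (rule cmod_le)
  also have "\<dots> \<le> 4 * norm w * ((4 * norm w * r) ^ M / fact M) + 4 * norm w * ((4 * norm w * r) ^ M / fact M)"
    unfolding grad_hom_def complex.sel by (intro add_mono b) auto
  finally show ?thesis by simp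
qed

lemma grad_hom_0: "grad_hom 0 w z = 0"
  by (simp add: grad_hom_def dhom_kernel_def complex_eq_iff)

definition grad_bound :: "complex \<Rightarrow> real \<Rightarrow> nat \<Rightarrow> real" where
  "grad_bound w r N = (case N of 0 \<Rightarrow> 0 | Suc M \<Rightarrow> 8 * norm w * ((4 * norm w * r) ^ M / fact M))"

lemma summable_grad_bound: "summable (grad_bound w r)"
proof (subst summable_Suc_iff[symmetric])
  show "summable (\<lambda>n. grad_bound w r (Suc n))"
    unfolding grad_bound_def nat.case by (intro summable_mult summable_exp_terms)
qed

lemma norm_grad_hom_bound: "norm z \<le> r \<Longrightarrow> norm (grad_hom N w z) \<le> grad_bound w r N"
  using norm_grad_hom_le by (cases N) (simp_all only: grad_bound_def nat.case grad_hom_0 norm_zero order_refl)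

definition kernel_sum :: "complex \<Rightarrow> complex \<Rightarrow> real" where
  "kernel_sum w z = (\<Sum>N. E N z w)"

definition grad_sum :: "complex \<Rightarrow> complex \<Rightarrow> complex" where
  "grad_sum w z = (\<Sum>N. grad_hom N w z)"

lemma kernel_sums: "(\<lambda>N. E N z w) sums kernel_sum w z"
  unfolding kernel_sum_def
proof (rule summable_sums, rule summable_comparison_test')
  show "summable (\<lambda>N. (4 * (norm z * norm w)) ^ N / fact N)" by (rule summable_exp_terms)
  show "\<And>N. N \<ge> 0 \<Longrightarrow> norm (E N z w) \<le> (4 * (norm z * norm w)) ^ N / fact N"
    using abs_hom_kernel_le by (simp add: power_mult_distrib)
qed

lemma grad_sums: "(\<lambda>N. grad_hom N w z) sums grad_sum w z"
  unfolding grad_sum_def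
  by (rule summable_sums, rule summable_comparison_test'[OF summable_grad_bound[of w "norm z"]])
     (simp add: norm_grad_hom_bound)

lemma grad_uniform_limit:
  "uniform_limit (ball 0 r) (\<lambda>n z. \<Sum>i<n. grad_hom i w z) (grad_sum w) sequentially"
  unfolding grad_sum_def[abs_def]
  by (rule Weierstrass_m_test[OF norm_grad_hom_bound[of _ r] summable_grad_bound]) simp

lemma continuous_grad_hom: "continuous_on S (grad_hom N w)"
  unfolding grad_hom_def[abs_def] Complex_eq
  by (intro continuous_intros continuous_on_subset[OF continuous_on_dhom_kernel]) auto

lemma continuous_grad_sum: "continuous_on UNIV (grad_sum w)"
proof (rule continuous_at_imp_continuous_on, rule ballI)
  fix x :: complex
  let ?B = "ball (0::complex) (norm x + 1)"
  have "continuous_on ?B (grad_sum w)"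
    by (rule uniform_limit_theorem[OF _ grad_uniform_limit])
       (auto intro!: always_eventually continuous_intros continuous_grad_hom)
  then show "isCont (grad_sum w) x"
    by (simp add: continuous_on_eq_continuous_at)
qed

lemma kernel_sum_has_derivative: "(kernel_sum w has_derivative (\<lambda>h. grad_sum w x \<bullet> h)) (at x)"
proof -
  \<comment> \<open>The gradients converge uniformly on balls about 0; this one contains x in its
    interior.\<close>
  let ?B = "ball (0::complex) (norm x + 1)"
  have x: "x \<in> ?B" by simp
  have "\<exists>g. \<forall>x\<in>?B. (\<lambda>n. E n x w) sums g x \<and> (g has_derivative (\<lambda>h. grad_sum w x \<bullet> h)) (at x within ?B)"
  proof (rule has_derivative_series[OF _ _ _ x kernel_sums])
    show "convex ?B" by simp
    show "((\<lambda>z. E n z w) has_derivative (\<lambda>h. grad_hom n w z \<bullet> h)) (at z within ?B)" for n z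
      using hom_kernel_has_derivative[of k \<alpha> \<beta> n w z] unfolding dhom_kernel_eq_inner[abs_def]
      by (rule has_derivative_at_withinI)
    fix e :: real assume "e > 0"
    then have "\<forall>\<^sub>F n in sequentially. \<forall>x\<in>?B. dist (\<Sum>i<n. grad_hom i w x) (grad_sum w x) < e"
      using grad_uniform_limit[where r = "norm x + 1" and w = w] unfolding uniform_limit_iff by blast
    then show "\<forall>\<^sub>F n in sequentially. \<forall>x\<in>?B. \<forall>h. norm ((\<Sum>i<n. grad_hom i w x \<bullet> h) - grad_sum w x \<bullet> h) \<le> e * norm h"
    proof (rule eventually_mono, intro ballI allI)
      fix n z h assume *: "\<forall>x\<in>?B. dist (\<Sum>i<n. grad_hom i w x) (grad_sum w x) < e" and "z \<in> ?B"
      then have a: "norm ((\<Sum>i<n. grad_hom i w z) - grad_sum w z) \<le> e" by (auto simp: dist_norm intro: less_imp_le)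
      have b: "(\<Sum>i<n. grad_hom i w z \<bullet> h) - grad_sum w z \<bullet> h = ((\<Sum>i<n. grad_hom i w z) - grad_sum w z) \<bullet> h"
        by (simp add: inner_sum_left inner_diff_left)
      have c: "norm (((\<Sum>i<n. grad_hom i w z) - grad_sum w z) \<bullet> h) \<le> norm ((\<Sum>i<n. grad_hom i w z) - grad_sum w z) * norm h"
        unfolding real_norm_def by (rule Cauchy_Schwarz_ineq2)
      show "norm ((\<Sum>i<n. grad_hom i w z \<bullet> h) - grad_sum w z \<bullet> h) \<le> e * norm h"
        unfolding b by (rule order_trans[OF c mult_right_mono[OF a norm_ge_zero]])
    qed
  qed
  then obtain g where g: "\<And>z. z \<in> ?B \<Longrightarrow> (\<lambda>n. E n z w) sums g z"
     "(g has_derivative (\<lambda>h. grad_sum w x \<bullet> h)) (at x within ?B)" using x by blast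
  have eq: "g z = kernel_sum w z" if "z \<in> ?B" for z
    using g(1)[OF that] kernel_sums sums_unique2 by blast
  have "(kernel_sum w has_derivative (\<lambda>h. grad_sum w x \<bullet> h)) (at x within ?B)"
    by (rule has_derivative_transform[OF x _ g(2)]) (simp add: eq)
  then show ?thesis using x by (simp add: at_within_open[OF x])
qed

text \<open>The right side depends on xi but not on its conjugate: this states at once that the
  conjugate of T annihilates the polynomial and that T lowers its degree by one.\<close>

lemma harm_dunkl:
  assumes reg: "\<forall>j<2*k. \<rho> j \<bullet> z \<noteq> 0"
  shows "\<phi>' n z \<xi> + (\<Sum>j<2*k. of_real (\<kappa> j * (\<rho> j \<bullet> \<xi>) / (\<rho> j \<bullet> z)) *
       (\<phi> n z - \<phi> n (\<sigma> j z))) = \<xi> * \<mu> n z"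
proof (induction n)
  case 0
  then show ?case by (simp add: hprev_def)
next
  case (Suc n)
  define K where "K j = \<kappa> j * (\<rho> j \<bullet> \<xi>) / (\<rho> j \<bullet> z)" for j
  define S where "S f = (\<Sum>j<2*k. of_real (K j) * (f z - f (\<sigma> j z)))" for f :: "complex \<Rightarrow> complex"
  let ?X = "\<lambda>z. z * \<phi> n z" and ?dX = "\<xi> * \<phi> n z + z * \<phi>' n z \<xi>"
  let ?s = "complex_of_real (s (Suc n))" and ?g = "complex_of_real (real (Suc n) + \<gamma>)"
  let ?d = "complex_of_real ((real (Suc n) + \<gamma>) * (1 - (s (Suc n))\<^sup>2))"
  have IH: "\<phi>' n z \<xi> + S (\<phi> n) = \<xi> * \<mu> n z"
    using Suc unfolding S_def K_def .
  \<comment> \<open>Leibniz rule for differences: the factor z contributes z -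
    \<open>\<sigma> j z\<close>, a multiple of the root, so the quotient cancels and leaves xi - cnj
    xi * \<open>\<omega> j\<close>.\<close>
  have step: "of_real (K j) * (?X z - ?X (\<sigma> j z)) = z * (of_real (K j) * (\<phi> n z - \<phi> n (\<sigma> j z)))
      + of_real (\<kappa> j) * (\<xi> * \<omega> j ^ n - cnj \<xi> * \<omega> j ^ Suc n) * cnj (\<phi> n z)" if "j < 2 * k" for j
  proof -
    let ?a = "\<rho> j"
    have "of_real (K j) * (z - \<sigma> j z) = of_real (\<kappa> j) * (2 * of_real (?a \<bullet> \<xi>) * ?a)"
      unfolding minus_refl_dih[of z] K_def using reg that by simp
    also have "2 * of_real (?a \<bullet> \<xi>) * ?a = \<xi> - cnj \<xi> * \<omega> j"
      using minus_refl_dih[of \<xi> k j] by (simp add: refl_dih_cis)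
    finally have "of_real (K j) * (z - \<sigma> j z) = of_real (\<kappa> j) * (\<xi> - cnj \<xi> * \<omega> j)" .
    moreover have "\<phi> n (\<sigma> j z) = \<omega> j ^ n * cnj (\<phi> n z)" unfolding refl_dih_cis by (rule harm_refl)
    moreover have "K' * (x * p - x' * p') = x * (K' * (p - p')) + (K' * (x - x')) * p'" for K' x x' p p' :: complex
      by (simp add: algebra_simps)
    ultimately have "of_real (K j) * (?X z - ?X (\<sigma> j z)) = z * (of_real (K j) * (\<phi> n z - \<phi> n (\<sigma> j z)))
      + of_real (\<kappa> j) * (\<xi> - cnj \<xi> * \<omega> j) * (\<omega> j ^ n * cnj (\<phi> n z))"
      by (simp only:)
    then show ?thesis by (simp add: algebra_simps)
  qed
  have SX: "S ?X = z * S (\<phi> n) + (\<xi> * of_real (c n) - cnj \<xi> * of_real (c (Suc n))) * cnj (\<phi> n z)"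
  proof -
    have "S ?X = (\<Sum>j<2*k. z * (of_real (K j) * (\<phi> n z - \<phi> n (\<sigma> j z)))
      + of_real (\<kappa> j) * (\<xi> * \<omega> j ^ n - cnj \<xi> * \<omega> j ^ Suc n) * cnj (\<phi> n z))"
      unfolding S_def using step by (intro sum.cong) auto
    also have "\<dots> = z * S (\<phi> n) + (\<xi> * (\<Sum>j<2*k. of_real (\<kappa> j) * \<omega> j ^ n) -
        cnj \<xi> * (\<Sum>j<2*k. of_real (\<kappa> j) * \<omega> j ^ Suc n)) * cnj (\<phi> n z)"
      unfolding S_def sum.distrib sum_distrib_left sum_distrib_right sum_subtractf[symmetric]
      by (simp only: algebra_simps)
    finally show ?thesis unfolding coef_sum .
  qed
  have c: "complex_of_real (c (Suc n)) = ?s * ?g" by (subst coef_eq_ratio) simp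
  \<comment> \<open>The unwanted term with cnj xi is -s times the conjugate of the wanted one.
    Forming Y + s * cnj Y, as the recursion does, removes it and leaves the factor g (1 -
    s^2).\<close>
  have TX: "?dX + S ?X = ?g * (\<xi> * \<phi> n z) - ?s * ?g * cnj (\<xi> * \<phi> n z)"
  proof -
    have "?dX + S ?X = \<xi> * \<phi> n z + z * (\<phi>' n z \<xi> + S (\<phi> n)) +
        (\<xi> * of_real (c n) - cnj \<xi> * of_real (c (Suc n))) * cnj (\<phi> n z)"
      unfolding SX by (simp add: algebra_simps)
    also have "z * (\<phi>' n z \<xi> + S (\<phi> n)) = \<xi> * (of_real (real n + \<gamma>) * \<phi> n z - of_real (c n) * cnj (\<phi> n z))"
      unfolding IH mult_hprev[symmetric] by simp
    finally show ?thesis unfolding c by (simp add: algebra_simps)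
  qed
  \<comment> \<open>S has real coefficients and therefore commutes with conjugation.\<close>
  have S\<phi>: "S (\<phi> (Suc n)) = (S ?X + ?s * cnj (S ?X)) / ?d"
  proof -
    have "S (\<phi> (Suc n)) = (\<Sum>j<2*k. (of_real (K j) * (?X z - ?X (\<sigma> j z)) +
        ?s * cnj (of_real (K j) * (?X z - ?X (\<sigma> j z)))) / ?d)"
      unfolding S_def dih_harm.simps by (rule sum.cong) (simp_all add: field_simps diff_divide_distrib add_divide_distrib)
    then show ?thesis
      unfolding S_def by (simp add: sum_divide_distrib sum.distrib sum_distrib_left cnj_sum add_divide_distrib)
  qed
  have "\<phi>' (Suc n) z \<xi> + S (\<phi> (Suc n)) = ((?dX + S ?X) + ?s * cnj (?dX + S ?X)) / ?d"
    unfolding S\<phi> dharm.simps by (simp add: add_divide_distrib distrib_left)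
  also have "\<dots> = \<xi> * \<phi> n z"
  proof -
    have d: "?d = ?g * (1 - ?s\<^sup>2)" by simp
    have "?d \<noteq> 0" unfolding of_real_eq_0_iff by (rule harm_denominator_nonzero) simp
    then have d0: "?g * (1 - ?s\<^sup>2) \<noteq> 0" unfolding d .
    have gen: "((g * x - t * g * y) + t * (g * y - t * g * x)) / (g * (1 - t\<^sup>2)) = x"
      if "g * (1 - t\<^sup>2) \<noteq> 0" for g t x y :: complex
    proof -
      have "(g * x - t * g * y) + t * (g * y - t * g * x) = (g * (1 - t\<^sup>2)) * x"
        by (simp add: algebra_simps power2_eq_square)
      then show ?thesis using that by simp
    qed
    have "cnj (?g * (\<xi> * \<phi> n z) - ?s * ?g * cnj (\<xi> * \<phi> n z)) = ?g * cnj (\<xi> * \<phi> n z) - ?s * ?g * (\<xi> * \<phi> n z)"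
      by simp
    then show ?thesis unfolding TX d using gen[OF d0] by (simp only:)
  qed
  finally show ?case unfolding S_def K_def hprev_def nat.case .
qed

lemma hterm_dunkl:
  assumes reg: "\<forall>j<2*k. \<rho> j \<bullet> z \<noteq> 0"
  shows "2 * Re (A n w * \<phi>' n z \<xi>) + (\<Sum>j<2*k. \<kappa> j * (\<rho> j \<bullet> \<xi>) *
     (u n z w - u n (\<sigma> j z) w) / (\<rho> j \<bullet> z)) = 2 * Re (A n w * (\<xi> * \<mu> n z))"
proof -
  have lin: "a * b * (2 * Re (p * x) - 2 * Re (p * y)) / d = 2 * Re (p * (of_real (a * b / d) * (x - y)))"
    for a b d :: real and p x y :: complex
    by (simp add: algebra_simps diff_divide_distrib add_divide_distrib)
  have "(\<Sum>j<2*k. \<kappa> j * (\<rho> j \<bullet> \<xi>) *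
     (u n z w - u n (\<sigma> j z) w) / (\<rho> j \<bullet> z)) =
     2 * Re (A n w * (\<Sum>j<2*k. of_real (\<kappa> j * (\<rho> j \<bullet> \<xi>) / (\<rho> j \<bullet> z)) *
       (\<phi> n z - \<phi> n (\<sigma> j z))))"
    unfolding hterm_def lin by (simp only: sum_distrib_left Re_sum)
  then show ?thesis unfolding harm_dunkl[OF reg, symmetric] by (simp only: distrib_left plus_complex.sel)
qed

lemma hom_kernel_dunkl:
  assumes reg: "\<forall>j<2*k. \<rho> j \<bullet> z \<noteq> 0"
  shows "grad_hom (Suc M) w z \<bullet> \<xi> + (\<Sum>j<2*k. \<kappa> j * (\<rho> j \<bullet> \<xi>) *
     (E (Suc M) z w - E (Suc M) (\<sigma> j z) w) / (\<rho> j \<bullet> z)) = (\<xi> \<bullet> w) * E M z w"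
proof -
  let ?S = "{..Suc M div 2}" and ?n = "\<lambda>j. Suc M - 2 * j"
  let ?q = "z \<bullet> z" and ?r = "w \<bullet> w"
  let ?F = "\<lambda>j. real (2 * j) * (?q ^ (j - 1) * ?r ^ j) * ((z \<bullet> \<xi>) * u (?n j) z w)"
  let ?D = "\<lambda>n i. \<kappa> i * (\<rho> i \<bullet> \<xi>) * (u n z w - u n (\<sigma> i z) w) / (\<rho> i \<bullet> z)"
  have "(\<xi> \<bullet> w) * E M z w = Re (\<xi> * (cnj w * of_real (E M z w)))"
    by (simp add: inner_complex_def algebra_simps)
  also have "\<dots> = (\<Sum>j\<in>?S. Re (\<xi> * gterm j (?n j) z w))"
    by (simp only: sum_gterm[symmetric] sum_distrib_left Re_sum)
  also have "\<dots> = (\<Sum>j\<in>?S. \<theta> j (?n j) * (?F j + (?q * ?r) ^ j * (2 * Re (A (?n j) w * \<phi>' (?n j) z \<xi>))) +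
       \<theta> j (?n j) * (?q * ?r) ^ j * (\<Sum>i<2*k. ?D (?n j) i))"
  proof (rule sum.cong[OF refl])
    fix j
    have lin: "Re (x * (of_real t * (of_nat m * of_real a * (cnj y * of_real b) + 2 * of_real d * (p * h)))) =
        t * (real m * a * ((y \<bullet> x) * b) + d * (2 * Re (p * (x * h))))" for x y p h :: complex and t a b d and m :: nat
      by (simp add: inner_complex_def algebra_simps)
    have "Re (\<xi> * gterm j (?n j) z w) = \<theta> j (?n j) * (?F j + (?q * ?r) ^ j * (2 * Re (A (?n j) w * (\<xi> * \<mu> (?n j) z))))"
      unfolding gterm_def by (rule lin)
    then show "Re (\<xi> * gterm j (?n j) z w) = \<theta> j (?n j) * (?F j + (?q * ?r) ^ j * (2 * Re (A (?n j) w * \<phi>' (?n j) z \<xi>))) +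
       \<theta> j (?n j) * (?q * ?r) ^ j * (\<Sum>i<2*k. ?D (?n j) i)"
      unfolding hterm_dunkl[OF reg, symmetric] by (simp only: distrib_left mult.assoc add.assoc)
  qed
  also have "\<dots> = dhom_kernel k \<alpha> \<beta> (Suc M) z w \<xi> + (\<Sum>i<2*k. \<Sum>j\<in>?S. \<theta> j (?n j) * (?q * ?r) ^ j * ?D (?n j) i)"
    unfolding sum.distrib dhom_kernel_def sum_distrib_left
    by (rule arg_cong2[where f = "(+)"], rule refl, rule sum.swap)
  also have "(\<Sum>i<2*k. \<Sum>j\<in>?S. \<theta> j (?n j) * (?q * ?r) ^ j * ?D (?n j) i) =
     (\<Sum>i<2*k. \<kappa> i * (\<rho> i \<bullet> \<xi>) * (E (Suc M) z w - E (Suc M) (\<sigma> i z) w) / (\<rho> i \<bullet> z))"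
  proof (rule sum.cong[OF refl])
    fix i
    have lin: "t * (m * b * (x - y) / d) = m * b * (t * x - t * y) / d" for t m b x y d :: real
      by (simp add: algebra_simps)
    show "(\<Sum>j\<in>?S. \<theta> j (?n j) * (?q * ?r) ^ j * ?D (?n j) i) =
       \<kappa> i * (\<rho> i \<bullet> \<xi>) * (E (Suc M) z w - E (Suc M) (\<sigma> i z) w) / (\<rho> i \<bullet> z)"
      unfolding lin hom_kernel_def inner_refl_dih sum_subtractf[symmetric] sum_distrib_left sum_divide_distrib ..
  qed
  finally show ?thesis unfolding dhom_kernel_eq_inner by simp
qed

lemma kernel_sum_dunkl_eigen: "dunkl_eigen k \<alpha> \<beta> w (kernel_sum w)"
  unfolding dunkl_eigen_def
proof (intro exI[of _ "grad_sum w"] conjI allI impI)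
  show "continuous_on UNIV (grad_sum w)" by (rule continuous_grad_sum)
  show "(kernel_sum w has_derivative (\<bullet>) (grad_sum w x)) (at x)" for x
    using kernel_sum_has_derivative[of w x] .
  fix x \<xi> assume reg: "\<forall>j<2*k. \<rho> j \<bullet> x \<noteq> 0"
  let ?T = "\<lambda>N. grad_hom N w x \<bullet> \<xi> + (\<Sum>j<2*k. \<kappa> j * (\<rho> j \<bullet> \<xi>) *
     (E N x w - E N (\<sigma> j x) w) / (\<rho> j \<bullet> x))"
  have "?T sums (grad_sum w x \<bullet> \<xi> + (\<Sum>j<2*k. \<kappa> j * (\<rho> j \<bullet> \<xi>) *
     (kernel_sum w x - kernel_sum w (\<sigma> j x)) / (\<rho> j \<bullet> x)))"
    by (intro sums_add sums_sum sums_divide sums_mult sums_diff kernel_sums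
        bounded_linear.sums[OF bounded_linear_inner_left] grad_sums)
  moreover have "?T sums ((\<xi> \<bullet> w) * kernel_sum w x)"
  proof -
    \<comment> \<open>The constant part is annihilated, so part n + 1 of the series is matched with
      part n of the eigenvalue side.\<close>
    have "E 0 z w = 1" for z by (simp add: hom_kernel_def hterm_def)
    then have 0: "?T 0 = 0" by (simp add: grad_hom_0)
    have "(\<lambda>n. ?T (Suc n)) sums ((\<xi> \<bullet> w) * kernel_sum w x)"
      unfolding hom_kernel_dunkl[OF reg] by (intro sums_mult kernel_sums)
    then have "?T sums ((\<xi> \<bullet> w) * kernel_sum w x + ?T 0)" by (rule sums_Suc[of ?T])
    then show ?thesis unfolding 0 by simp
  qed
  ultimately show "grad_sum w x \<bullet> \<xi> + (\<Sum>j<2*k. \<kappa> j * (\<rho> j \<bullet> \<xi>) *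
     (kernel_sum w x - kernel_sum w (\<sigma> j x)) / (\<rho> j \<bullet> x)) = (\<xi> \<bullet> w) * kernel_sum w x"
    by (rule sums_unique2)
qed

lemma kernel_sum_0: "kernel_sum w 0 = 1"
proof -
  have "E N 0 w = 0" if "N \<ge> 1" for N
    using abs_hom_kernel_le[of N 0 w] that by (auto simp: power_0_left)
  then have "(\<lambda>N. E N 0 w) sums (\<Sum>N\<in>{0}. E N 0 w)"
    by (intro sums_finite) auto
  moreover have "E 0 0 w = 1" by (simp add: hom_kernel_def hterm_def)
  ultimately show ?thesis using kernel_sums sums_unique2 by fastforce
qed

section \<open>Uniqueness of the eigenfunction\<close>

lemma eigen_euler:
  assumes "continuous_on UNIV g" "continuous_on UNIV f"
    and "\<And>x. (\<forall>j<2*k. \<rho> j \<bullet> x \<noteq> 0) \<Longrightarrow> (\<And>\<xi>. g x \<bullet> \<xi> +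
                 (\<Sum>j<2*k. \<kappa> j * (\<rho> j \<bullet> \<xi>) *
                     (f x - f (\<sigma> j x)) / (\<rho> j \<bullet> x))
                 = (\<xi> \<bullet> y) * f x)"
  shows "g x \<bullet> x + (\<Sum>j<2*k. \<kappa> j * (f x - f (\<sigma> j x))) = (x \<bullet> y) * f x"
proof -
  define e where "e x = g x \<bullet> x + (\<Sum>j<2*k. \<kappa> j * (f x - f (\<sigma> j x))) - (x \<bullet> y) * f x" for x
  have "continuous_on UNIV (\<lambda>x. f (\<sigma> j x))" for j
    by (rule continuous_on_compose2[OF assms(2)]) (auto simp: refl_dih_def intro!: continuous_intros)
  then have "continuous_on UNIV e"
    unfolding e_def using assms(1,2) by (intro continuous_intros)
  \<comment> \<open>For xi = x the equation has no singular quotient and is continuous in x. It can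
    fail only on an open subset of finitely many lines; such a set is negligible and hence
    empty.\<close>
  then have op: "open {x. e x \<noteq> 0}" by (intro open_Collect_neq continuous_intros)
  have "{x. e x \<noteq> 0} \<subseteq> (\<Union>j<2*k. {x. \<rho> j \<bullet> x = 0})"
  proof (rule ccontr)
    assume "\<not> {x. e x \<noteq> 0} \<subseteq> (\<Union>j<2*k. {x. \<rho> j \<bullet> x = 0})"
    then obtain x where x: "e x \<noteq> 0" "\<forall>j<2*k. \<rho> j \<bullet> x \<noteq> 0" by auto
    have "(\<Sum>j<2*k. \<kappa> j * (\<rho> j \<bullet> x) * (f x - f (\<sigma> j x)) / (\<rho> j \<bullet> x)) =
       (\<Sum>j<2*k. \<kappa> j * (f x - f (\<sigma> j x)))"
      using x(2) by (intro sum.cong) auto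
    then have "e x = 0" using assms(3)[OF x(2), of x] by (simp add: e_def)
    then show False using x(1) by simp
  qed
  moreover have "negligible (\<Union>j<2*k. {x. \<rho> j \<bullet> x = 0})"
  proof (rule negligible_Union)
    fix t assume "t \<in> (\<lambda>j. {x. \<rho> j \<bullet> x = 0}) ` {..<2 * k}"
    then obtain j where "t = {x. \<rho> j \<bullet> x = 0}" by auto
    moreover have "\<rho> j \<noteq> 0" using norm_root_dih[of k j] by auto
    ultimately show "negligible t" by (simp add: negligible_hyperplane)
  qed simp
  ultimately have "negligible {x. e x \<noteq> 0}" using negligible_subset by blast
  then have "{x. e x \<noteq> 0} = {}" using open_not_negligible[OF op] by blast
  then show ?thesis by (auto simp: e_def)
qed

text \<open>A sum over the 4 k group elements, not over the points of the orbit: points with a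
  stabiliser are counted with multiplicity, and invariance is a mere reindexing.\<close>

definition orbit_sum :: "(complex \<Rightarrow> real) \<Rightarrow> complex \<Rightarrow> real" where
  "orbit_sum q x = (\<Sum>\<xi> | \<xi> ^ (2 * k) = 1. q (x * \<xi>) + q (cnj x * \<xi>))"

lemma orbit_sum_refl: "orbit_sum (\<lambda>x. q (\<sigma> j x)) x = orbit_sum q x"
proof -
  let ?U = "{\<xi>::complex. \<xi> ^ (2 * k) = 1}"
  have c: "(cnj \<xi> * \<omega> j) ^ (2 * k) = 1" if "\<xi> ^ (2 * k) = 1" for \<xi>
    using that omega_power_2k[of j] by (simp only: power_mult_distrib complex_cnj_power[symmetric]) simp
  have i: "cnj (cnj \<xi> * \<omega> j) * \<omega> j = \<xi>" for \<xi>
    by (simp add: cis_cnj cis_mult mult.assoc)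
  have sw: "(\<Sum>\<xi>\<in>?U. q (cnj x * (cnj \<xi> * \<omega> j))) = (\<Sum>\<xi>\<in>?U. q (cnj x * \<xi>))" for q :: "complex \<Rightarrow> real" and x
    by (rule sum.reindex_bij_witness[where i = "\<lambda>\<xi>. cnj \<xi> * \<omega> j" and j = "\<lambda>\<xi>. cnj \<xi> * \<omega> j"])
       (auto simp only: i c mem_Collect_eq)
  have "orbit_sum (\<lambda>x. q (\<sigma> j x)) x =
     (\<Sum>\<xi>\<in>?U. q (cnj x * (cnj \<xi> * \<omega> j))) + (\<Sum>\<xi>\<in>?U. q (cnj (cnj x) * (cnj \<xi> * \<omega> j)))"
    unfolding orbit_sum_def sum.distrib by (simp add: refl_dih_cis mult.assoc)
  also have "\<dots> = orbit_sum q x" unfolding sw orbit_sum_def sum.distrib by simp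
  finally show ?thesis .
qed

lemma orbit_sum_add: "orbit_sum (\<lambda>z. q z + r z) x = orbit_sum q x + orbit_sum r x"
  by (simp add: orbit_sum_def sum.distrib)

lemma orbit_sum_diff: "orbit_sum (\<lambda>z. q z - r z) x = orbit_sum q x - orbit_sum r x"
  by (simp add: orbit_sum_def sum.distrib sum_subtractf)

lemma orbit_sum_cmult: "orbit_sum (\<lambda>z. a * q z) x = a * orbit_sum q x"
  by (simp add: orbit_sum_def sum_distrib_left distrib_left)

lemma orbit_sum_sum: "orbit_sum (\<lambda>z. \<Sum>j\<in>J. q j z) x = (\<Sum>j\<in>J. orbit_sum (q j) x)"
  unfolding orbit_sum_def sum.distrib[symmetric] by (rule sum.swap)

lemma orbit_sum_mono: "(\<And>y. norm y = norm x \<Longrightarrow> q y \<le> r y) \<Longrightarrow> orbit_sum q x \<le> orbit_sum r x"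
proof -
  assume *: "\<And>y. norm y = norm x \<Longrightarrow> q y \<le> r y"
  have "norm \<xi> = 1" if "\<xi> ^ (2 * k) = 1" for \<xi> :: complex
    using that k_pos by (metis norm_one norm_power power_eq_1_iff norm_ge_zero mult_eq_0_iff not_gr_zero zero_neq_numeral)
  then show ?thesis unfolding orbit_sum_def by (intro sum_mono add_mono *) (auto simp: norm_mult)
qed

lemma eigen_zero:
  assumes df: "\<And>x. (f has_derivative (\<lambda>h. g x \<bullet> h)) (at x)"
    and eq: "\<And>x. g x \<bullet> x + (\<Sum>j<2*k. \<kappa> j * (f x - f (\<sigma> j x))) = (x \<bullet> y) * f x"
    and f0: "f 0 = 0"
  shows "f x = 0"
proof -
  let ?U = "{\<xi>::complex. \<xi> ^ (2 * k) = 1}"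
  have finU: "finite ?U" using k_pos by (intro finite_roots_unity) simp
  \<comment> \<open>On the orbit of t x, Cauchy-Schwarz gives 2 (z . y) <= t C; the factor t cancels
    below.\<close>
  define C where "C = 2 * norm x * norm y"
  define F where "F t = orbit_sum (\<lambda>z. (f z)\<^sup>2) (of_real t * x)" for t :: real
  define F' where "F' t = (\<Sum>\<xi>\<in>?U. 2 * f (of_real t * x * \<xi>) * (g (of_real t * x * \<xi>) \<bullet> (x * \<xi>)) +
      2 * f (cnj (of_real t * x) * \<xi>) * (g (cnj (of_real t * x) * \<xi>) \<bullet> (cnj x * \<xi>)))" for t :: real
  have ray: "((\<lambda>t. (f (of_real t * p))\<^sup>2) has_real_derivative 2 * f (of_real t * p) * (g (of_real t * p) \<bullet> p)) (at t)"
    for p :: complex and t :: real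
  proof -
    have "((\<lambda>t. of_real t * p) has_derivative (\<lambda>h. of_real h * p)) (at t)"
      by (auto intro!: derivative_eq_intros)
    then have "((\<lambda>t. f (of_real t * p)) has_derivative (\<lambda>h. g (of_real t * p) \<bullet> (of_real h * p))) (at t)"
      by (rule has_derivative_compose) (rule df)
    moreover have "(\<lambda>h. g (of_real t * p) \<bullet> (of_real h * p)) = (*) (g (of_real t * p) \<bullet> p)"
      by (simp add: fun_eq_iff inner_mult_right flip: scaleR_conv_of_real)
    ultimately have "((\<lambda>t. f (of_real t * p)) has_real_derivative (g (of_real t * p) \<bullet> p)) (at t)"
      by (simp add: has_field_derivative_def)
    then show ?thesis by (auto intro!: derivative_eq_intros simp: power2_eq_square)
  qed
  have dF: "(F has_real_derivative F' t) (at t)" for t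
    unfolding F_def[abs_def] F'_def orbit_sum_def complex_cnj_mult complex_cnj_complex_of_real
    by (intro DERIV_sum DERIV_add) (simp_all only: mult.assoc[of "of_real _"] ray)
  have F'_le: "F' t \<le> C * F t" if t: "t > 0" for t
  proof -
    let ?z = "of_real t * x"
    have scale: "of_real t * x * \<xi> = t *\<^sub>R (x * \<xi>)" "cnj (of_real t * x) * \<xi> = t *\<^sub>R (cnj x * \<xi>)" for \<xi>
      by (simp_all add: scaleR_conv_of_real mult.assoc)
    have "t * F' t = orbit_sum (\<lambda>z. 2 * f z * (g z \<bullet> z)) ?z"
      unfolding F'_def orbit_sum_def sum_distrib_left scale
      by (rule sum.cong) (simp_all add: algebra_simps)
    also have "\<dots> \<le> orbit_sum (\<lambda>z. t * C * (f z)\<^sup>2 + (\<Sum>j<2*k. \<kappa> j * ((f (\<sigma> j z))\<^sup>2 - (f z)\<^sup>2))) ?z"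
    proof (rule orbit_sum_mono)
      fix z :: complex assume z: "norm z = norm ?z"
      have "2 * f z * (g z \<bullet> z) = 2 * (z \<bullet> y) * (f z)\<^sup>2 + (\<Sum>j<2*k. \<kappa> j * (2 * f z * (f (\<sigma> j z) - f z)))"
      proof -
        have "g z \<bullet> z = (z \<bullet> y) * f z - (\<Sum>j<2*k. \<kappa> j * (f z - f (\<sigma> j z)))"
          using eq[of z] by linarith
        moreover have "(\<Sum>j<2*k. \<kappa> j * (2 * f z * (f (\<sigma> j z) - f z))) =
            - (2 * f z * (\<Sum>j<2*k. \<kappa> j * (f z - f (\<sigma> j z))))"
          unfolding sum_distrib_left sum_negf[symmetric] by (rule sum.cong) (simp_all add: algebra_simps)
        moreover have "2 * a * (b * a - S) = 2 * b * a\<^sup>2 + - (2 * a * S)" for a b S :: real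
          by (simp add: right_diff_distrib power2_eq_square mult_ac)
        ultimately show ?thesis by (simp only:)
      qed
      moreover have "2 * (z \<bullet> y) * (f z)\<^sup>2 \<le> t * C * (f z)\<^sup>2"
      proof (rule mult_right_mono)
        have "z \<bullet> y \<le> norm z * norm y" by (rule norm_cauchy_schwarz)
        also have "\<dots> = t * norm x * norm y" using z t by (simp add: norm_mult)
        finally show "2 * (z \<bullet> y) \<le> t * C" by (simp add: C_def)
      qed simp
      \<comment> \<open>From (f (sigma z) - f z)^2 >= 0. The bound is a difference of squares, whose
        orbit sum vanishes by invariance, so the reflection terms cannot make F grow.\<close>
      moreover have "\<kappa> j * (2 * f z * (f (\<sigma> j z) - f z)) \<le> \<kappa> j * ((f (\<sigma> j z))\<^sup>2 - (f z)\<^sup>2)" for j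
      proof (rule mult_left_mono[OF _ mult_dih_nonneg])
        have "0 \<le> (f (\<sigma> j z) - f z)\<^sup>2" by simp
        then show "2 * f z * (f (\<sigma> j z) - f z) \<le> (f (\<sigma> j z))\<^sup>2 - (f z)\<^sup>2"
          by (simp add: power2_eq_square algebra_simps)
      qed
      ultimately show "2 * f z * (g z \<bullet> z) \<le> t * C * (f z)\<^sup>2 + (\<Sum>j<2*k. \<kappa> j * ((f (\<sigma> j z))\<^sup>2 - (f z)\<^sup>2))"
        by (simp add: add_mono sum_mono)
    qed
    also have "\<dots> = t * C * F t + (\<Sum>j<2*k. \<kappa> j * (orbit_sum (\<lambda>z. (f (\<sigma> j z))\<^sup>2) ?z - F t))"
      unfolding F_def orbit_sum_add orbit_sum_sum orbit_sum_cmult orbit_sum_diff ..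
    also have "\<dots> = t * (C * F t)"
      unfolding orbit_sum_refl[of "\<lambda>z. (f z)\<^sup>2"] F_def by simp
    finally show ?thesis using t by simp
  qed
  \<comment> \<open>Integrating factor for F' <= C F: P does not increase and starts at 0.\<close>
  define P where "P t = exp (- C * t) * F t" for t
  have dP: "(P has_real_derivative exp (- C * t) * (F' t - C * F t)) (at t)" for t
    unfolding P_def using dF[of t] by (auto intro!: derivative_eq_intros simp: algebra_simps)
  have "P 0 \<ge> P 1"
  \<comment> \<open>The open-interval version, since the differential inequality was obtained after
    multiplication by t and division needs t > 0.\<close>
  proof (rule DERIV_nonpos_imp_decreasing_open[where f = P and a = 0 and b = 1])
    fix t :: real assume "0 < t" "t < 1"
    then have "exp (- C * t) * (F' t - C * F t) \<le> 0" using F'_le[of t] by (simp add: mult_le_0_iff)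
    then show "\<exists>y. (P has_real_derivative y) (at t) \<and> y \<le> 0" using dP by blast
  next
    show "continuous_on {0..1} P" using dP by (meson DERIV_isCont continuous_at_imp_continuous_on)
  qed simp
  moreover have "P 0 = 0" by (simp add: P_def F_def orbit_sum_def f0)
  ultimately have "F 1 \<le> 0" by (simp add: P_def mult_le_0_iff)
  moreover have "(f x)\<^sup>2 \<le> F 1"
  proof -
    have "(f (x * 1))\<^sup>2 + (f (cnj x * 1))\<^sup>2 \<le> (\<Sum>\<xi>\<in>?U. (f (x * \<xi>))\<^sup>2 + (f (cnj x * \<xi>))\<^sup>2)"
      by (rule member_le_sum[where i = 1 and f = "\<lambda>\<xi>. (f (x * \<xi>))\<^sup>2 + (f (cnj x * \<xi>))\<^sup>2"]) (use finU in auto)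
    then show ?thesis by (simp add: F_def orbit_sum_def) (smt (verit) zero_le_power2)
  qed
  ultimately have "(f x)\<^sup>2 \<le> 0" by linarith
  then show ?thesis by simp
qed

lemma dunkl_eigen_euler:
  assumes "dunkl_eigen k \<alpha> \<beta> y f"
  shows "\<exists>g. (\<forall>x. (f has_derivative (\<lambda>h. g x \<bullet> h)) (at x)) \<and>
    (\<forall>x. g x \<bullet> x + (\<Sum>j<2*k. \<kappa> j * (f x - f (\<sigma> j x))) = (x \<bullet> y) * f x)"
proof -
  from assms obtain g where g: "continuous_on UNIV g" "\<forall>x. (f has_derivative (\<lambda>h. g x \<bullet> h)) (at x)"
    "\<forall>x. (\<forall>j<2*k. \<rho> j \<bullet> x \<noteq> 0) \<longrightarrow>
           (\<forall>\<xi>. g x \<bullet> \<xi> +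
                 (\<Sum>j<2*k. \<kappa> j * (\<rho> j \<bullet> \<xi>) *
                     (f x - f (\<sigma> j x)) / (\<rho> j \<bullet> x))
                 = (\<xi> \<bullet> y) * f x)" unfolding dunkl_eigen_def by blast
  have c: "continuous_on UNIV f"
    using g(2) by (meson has_derivative_continuous continuous_at_imp_continuous_on)
  have "g x \<bullet> x + (\<Sum>j<2*k. \<kappa> j * (f x - f (\<sigma> j x))) = (x \<bullet> y) * f x" for x
    by (rule eigen_euler[OF g(1) c]) (use g(3) in blast)
  then show ?thesis using g(2) by blast
qed

lemma dunkl_eigen_unique:
  assumes "dunkl_eigen k \<alpha> \<beta> y f1" "dunkl_eigen k \<alpha> \<beta> y f2" "f1 0 = f2 0"
  shows "f1 x = f2 x"
proof -
  obtain g1 where g1: "\<forall>x. (f1 has_derivative (\<lambda>h. g1 x \<bullet> h)) (at x)"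
    "\<forall>x. g1 x \<bullet> x + (\<Sum>j<2*k. \<kappa> j * (f1 x - f1 (\<sigma> j x))) = (x \<bullet> y) * f1 x"
    using dunkl_eigen_euler[OF assms(1)] by blast
  obtain g2 where g2: "\<forall>x. (f2 has_derivative (\<lambda>h. g2 x \<bullet> h)) (at x)"
    "\<forall>x. g2 x \<bullet> x + (\<Sum>j<2*k. \<kappa> j * (f2 x - f2 (\<sigma> j x))) = (x \<bullet> y) * f2 x"
    using dunkl_eigen_euler[OF assms(2)] by blast
  have "f1 x - f2 x = 0"
  proof (rule eigen_zero[where f = "\<lambda>x. f1 x - f2 x" and g = "\<lambda>x. g1 x - g2 x" and y = y])
    show "((\<lambda>x. f1 x - f2 x) has_derivative (\<lambda>h. (g1 x - g2 x) \<bullet> h)) (at x)" for x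
      unfolding inner_diff_left using g1(1) g2(1) by (intro has_derivative_diff) auto
    fix x
    have "(\<Sum>j<2*k. \<kappa> j * ((f1 x - f2 x) - (f1 (\<sigma> j x) - f2 (\<sigma> j x)))) =
       (\<Sum>j<2*k. \<kappa> j * (f1 x - f1 (\<sigma> j x))) - (\<Sum>j<2*k. \<kappa> j * (f2 x - f2 (\<sigma> j x)))"
      unfolding sum_subtractf[symmetric] by (rule sum.cong) (simp_all add: algebra_simps)
    then show "(g1 x - g2 x) \<bullet> x + (\<Sum>j<2*k. \<kappa> j * ((f1 x - f2 x) - (f1 (\<sigma> j x) - f2 (\<sigma> j x))))
       = (x \<bullet> y) * (f1 x - f2 x)"
      using g1(2)[rule_format, of x] g2(2)[rule_format, of x] by (simp add: inner_diff_left right_diff_distrib)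
  qed (simp add: assms(3))
  then show ?thesis by simp
qed

lemma dunkl_kernel_eq: "dunkl_kernel k \<alpha> \<beta> z w = kernel_sum w z"
proof -
  have "(THE f. dunkl_eigen k \<alpha> \<beta> w f \<and> f 0 = 1) = kernel_sum w"
  proof (rule the_equality)
    show "dunkl_eigen k \<alpha> \<beta> w (kernel_sum w) \<and> kernel_sum w 0 = 1"
      using kernel_sum_dunkl_eigen kernel_sum_0 by blast
    show "\<And>f. dunkl_eigen k \<alpha> \<beta> w f \<and> f 0 = 1 \<Longrightarrow> f = kernel_sum w"
      using dunkl_eigen_unique[OF _ kernel_sum_dunkl_eigen] kernel_sum_0 by (metis ext)
  qed
  then show ?thesis by (simp add: dunkl_kernel_def)
qed

end

section \<open>Reduction to the case k = 1\<close>

text \<open>The k - 1 steps from degree k m up to k m + k - 1 divide by n + gamma and give the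
  Pochhammer symbol; the step into degree k (m + 1) has k times the denominator of the corresponding
  step for k = 1.\<close>

fun wcoef :: "nat \<Rightarrow> real \<Rightarrow> nat \<Rightarrow> real" where
  "wcoef k a 0 = 1"
| "wcoef k a (Suc m) = wcoef k a m / (pochhammer (real (k * m) + 1 + real k * a) (k - 1) * real k)"

text \<open>The power of 2 / 2^k comes from \<open>hcoef\<close>: k steps produce (cnj w / 2)^k
  where one step for k = 1 at w^k produces cnj (w^k) / 2.\<close>

definition tweight :: "nat \<Rightarrow> real \<Rightarrow> nat \<Rightarrow> real" where
  "tweight k a m = wcoef k a m * (2 / 2 ^ k) ^ m"

definition havg :: "nat \<Rightarrow> real \<Rightarrow> real \<Rightarrow> nat \<Rightarrow> complex \<Rightarrow> complex \<Rightarrow> real" where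
  "havg k \<alpha> \<beta> n z w = (if 2 * k dvd n then 2 * Re (hcoef k \<alpha> \<beta> n w) * Re (dih_harm k \<alpha> \<beta> n z) else 0)"

definition hom_bessel :: "nat \<Rightarrow> real \<Rightarrow> real \<Rightarrow> nat \<Rightarrow> complex \<Rightarrow> complex \<Rightarrow> real" where
  "hom_bessel k \<alpha> \<beta> N z w = (\<Sum>j\<le>N div 2. bessel_coef (real k * (\<alpha> + \<beta>)) j (N - 2 * j) *
      ((z \<bullet> z) * (w \<bullet> w)) ^ j * havg k \<alpha> \<beta> (N - 2 * j) z w)"

context dihedral
begin

lemma ratio_mult: "s (k * m) = dih_ratio 1 \<alpha> \<beta> m"
proof -
  have 1: "c (k * m) = real k * (\<alpha> + (-1) ^ m * \<beta>)" using k_pos by (simp add: dih_coef_def)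
  have 2: "real (k * m) + \<gamma> = real k * (real m + real 1 * (\<alpha> + \<beta>))" by (simp add: distrib_left)
  have 3: "dih_coef 1 \<alpha> \<beta> m = \<alpha> + (-1) ^ m * \<beta>" by (simp add: dih_coef_def)
  show ?thesis unfolding dih_ratio_def 1 2 3 using k_pos by (intro mult_divide_mult_cancel_left) simp
qed

text \<open>Strictly between multiples of k the ratio is 0, and a step of the recursion is just
  multiplication by z / (n + gamma).\<close>

lemma harm_block:
  "r < k \<Longrightarrow> \<phi> (k * m + r) z * of_real (pochhammer (real (k * m) + 1 + \<gamma>) r) = z ^ r * \<phi> (k * m) z"
proof (induction r)
  case (Suc r)
  have "\<not> k dvd (k * m + Suc r)"
    using Suc.prems by (metis dvd_add_right_iff dvd_triv_left nat_dvd_not_less zero_less_Suc)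
  then have s0: "s (Suc (k * m + r)) = 0" using ratio_zero by simp
  let ?g = "real (k * m) + 1 + \<gamma> + real r"
  have g: "?g \<noteq> 0" using gamma_pos by (smt (verit) of_nat_0_le_iff)
  have "\<phi> (k * m + Suc r) z = z * \<phi> (k * m + r) z / of_real ?g"
    unfolding add_Suc_right dih_harm.simps s0 by (simp add: algebra_simps)
  then have "\<phi> (k * m + Suc r) z * of_real (pochhammer (real (k * m) + 1 + \<gamma>) (Suc r)) =
     z * \<phi> (k * m + r) z / of_real ?g * (of_real (pochhammer (real (k * m) + 1 + \<gamma>) r) * of_real ?g)"
    by (simp only: pochhammer_Suc of_real_mult)
  also have "\<dots> = z * (\<phi> (k * m + r) z * of_real (pochhammer (real (k * m) + 1 + \<gamma>) r))"
  proof -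
    have "x / G * (P * G) = x * P" if "G \<noteq> 0" for x P G :: complex using that by simp
    moreover have "complex_of_real ?g \<noteq> 0" unfolding of_real_eq_0_iff by (rule g)
    ultimately show ?thesis by (metis (no_types, lifting) mult.assoc)
  qed
  also have "\<dots> = z ^ Suc r * \<phi> (k * m) z" using Suc by simp
  finally show ?case .
qed simp

lemma harm_mult: "\<phi> (k * m) z = of_real (wcoef k (\<alpha> + \<beta>) m) * dih_harm 1 \<alpha> \<beta> m (z ^ k)"
proof (induction m)
  case (Suc m)
  obtain r where r: "k = Suc r" using k_pos by (cases k) auto
  let ?P = "pochhammer (real (k * m) + 1 + \<gamma>) r" and ?W = "wcoef k (\<alpha> + \<beta>) m"
  let ?X = "z * \<phi> (k * m + r) z" and ?Y = "z ^ k * dih_harm 1 \<alpha> \<beta> m (z ^ k)"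
  let ?s = "dih_ratio 1 \<alpha> \<beta> (Suc m)"
  have P: "?P > 0" using gamma_pos by (intro pochhammer_pos) (smt (verit) of_nat_0_le_iff)
  have idx: "k * Suc m = Suc (k * m + r)" using r by simp
  have s: "s (Suc (k * m + r)) = ?s" unfolding idx[symmetric] by (rule ratio_mult)
  have "?X * of_real ?P = z * (z ^ r * \<phi> (k * m) z)"
    using harm_block[of r m z] r by (metis lessI mult.assoc)
  also have "\<dots> = of_real ?W * ?Y" unfolding Suc using r by (simp add: mult_ac)
  finally have X: "?X = of_real (?W / ?P) * ?Y" using P by (simp add: field_simps)
  have g: "real (Suc (k * m + r)) + \<gamma> = real k * (real (Suc m) + real 1 * (\<alpha> + \<beta>))"
    unfolding idx[symmetric] by (simp add: algebra_simps)
  have lin: "(of_real w * y + of_real t * cnj (of_real w * y)) / of_real (K * G * D) =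
      of_real (w / K) * ((y + of_real t * cnj y) / of_real (G * D))" for w t K G D :: real and y
    by (simp add: distrib_left mult_ac add_divide_distrib)
  have "\<phi> (k * Suc m) z = (of_real (?W / ?P) * ?Y + of_real ?s * cnj (of_real (?W / ?P) * ?Y)) /
      of_real (real k * (real (Suc m) + real 1 * (\<alpha> + \<beta>)) * (1 - ?s\<^sup>2))"
    unfolding idx dih_harm.simps s X g ..
  also have "\<dots> = of_real (?W / ?P / real k) * dih_harm 1 \<alpha> \<beta> (Suc m) (z ^ k)"
    unfolding lin dih_harm.simps ..
  finally show ?case using r by (simp add: mult_ac)
qed simp

text \<open>The step to degree n + 1 uses \<open>s n\<close>, in contrast to
  \<open>dih_harm\<close>, where it uses \<open>s (Suc n)\<close>; so the mixing with the conjugate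
  happens in the first step of a block instead of the last.\<close>

lemma hcoef_block:
  "r < k \<Longrightarrow> A (k * m + Suc r) w = (cnj w / 2) ^ Suc r * (A (k * m) w + of_real (s (k * m)) * cnj (A (k * m) w))"
proof (induction r)
  case 0
  then show ?case by (simp add: hcoef.simps)
next
  case (Suc r)
  have "\<not> k dvd (k * m + Suc r)"
    using Suc.prems by (metis dvd_add_right_iff dvd_triv_left nat_dvd_not_less zero_less_Suc)
  then have s0: "s (k * m + Suc r) = 0" by (rule ratio_zero)
  have "A (k * m + Suc (Suc r)) w = cnj w / 2 * A (k * m + Suc r) w"
    unfolding add_Suc_right[of _ "Suc r"] hcoef.simps(2)[of _ _ _ "k * m + Suc r"] s0 by simp
  then show ?case using Suc by (simp only: power_Suc mult.assoc)
qed

lemma hcoef_mult: "A (k * m) w = of_real ((2 / 2 ^ k) ^ m) * hcoef 1 \<alpha> \<beta> m (w ^ k)"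
proof (induction m)
  case (Suc m)
  obtain r where r: "k = Suc r" using k_pos by (cases k) auto
  let ?V = "(2 / 2 ^ k) ^ m :: real" and ?B = "hcoef 1 \<alpha> \<beta> m (w ^ k)" and ?s = "dih_ratio 1 \<alpha> \<beta> m"
  have "A (k * Suc m) w = (cnj w / 2) ^ k * (A (k * m) w + of_real ?s * cnj (A (k * m) w))"
    using hcoef_block[of r m w] r ratio_mult[of m] by (simp add: add.commute)
  also have "\<dots> = of_real (?V * (2 / 2 ^ k)) * (cnj (w ^ k) / 2 * (?B + of_real ?s * cnj ?B))"
    unfolding Suc by (simp add: power_divide distrib_left mult_ac)
  finally show ?case by (simp add: hcoef.simps mult_ac)
qed simp

lemma hterm_mult: "u (k * m) z w = tweight k (\<alpha> + \<beta>) m * hterm 1 \<alpha> \<beta> m (z ^ k) (w ^ k)"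
proof -
  have lin: "2 * Re (of_real a * x * (of_real b * y)) = b * a * (2 * Re (x * y))" for a b x y
    by (simp add: algebra_simps)
  show ?thesis unfolding hterm_def harm_mult hcoef_mult tweight_def by (rule lin)
qed

lemma havg_mult:
  "havg k \<alpha> \<beta> n z w = (if k dvd n then tweight k (\<alpha> + \<beta>) (n div k) * havg 1 \<alpha> \<beta> (n div k) (z ^ k) (w ^ k) else 0)"
proof (cases "k dvd n")
  case True
  then obtain m where m: "n = k * m" by blast
  have "2 * k dvd n \<longleftrightarrow> 2 dvd m" using m k_pos by (simp add: mult.commute)
  then show ?thesis
    using m k_pos unfolding havg_def by (simp add: harm_mult hcoef_mult tweight_def)
next
  case False
  then have "\<not> 2 * k dvd n" using dvd_mult_right by blast
  then show ?thesis using False by (simp add: havg_def)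
qed

section \<open>Averages over the group and over rotations\<close>

lemma sum_omega_power: "(\<Sum>j<2*k. \<omega> j ^ n) = (if 2 * k dvd n then of_nat (2 * k) else 0)"
proof -
  have "\<omega> j ^ n = cis (2 * pi * real n / real (2 * k)) ^ j" for j
    unfolding Complex.DeMoivre by (rule arg_cong[where f = cis]) (simp add: field_simps)
  then show ?thesis using sum_cis_powers[of "2 * k" n] k_pos by simp
qed

text \<open>A reflection conjugates the coefficient, so pairing it with a rotation doubles the real
  part; the remaining sum over rotations keeps the degrees divisible by 2 k.\<close>

lemma hterm_avg:
  "(1 / (4 * real k)) * (\<Sum>j<2*k. u n z (rot_dih k j w) + u n z (\<sigma> j w)) = havg k \<alpha> \<beta> n z w"
proof -
  let ?S = "\<Sum>j<2*k. \<omega> j ^ n"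
  have lin: "2 * Re (cnj x * a * p) + 2 * Re (cnj x * cnj a * p) = Re (4 * Re a * (cnj x * p))" for x a p
    by (simp add: algebra_simps)
  have "(\<Sum>j<2*k. u n z (rot_dih k j w) + u n z (\<sigma> j w)) = Re (4 * Re (A n w) * (cnj ?S * \<phi> n z))"
    unfolding hterm_def refl_dih_cis hcoef_refl unfolding rot_dih_cis hcoef_rot lin
    by (simp only: Re_sum[symmetric] sum_distrib_left[symmetric] sum_distrib_right[symmetric] cnj_sum[symmetric])
  then show ?thesis
    unfolding sum_omega_power havg_def using k_pos by simp
qed

lemma inner_rot_dih: "rot_dih k j w \<bullet> rot_dih k j w = w \<bullet> w"
  by (simp add: dot_square_norm rot_dih_cis norm_mult)

lemma hom_kernel_avg:
  "(1 / (4 * real k)) * (\<Sum>j<2*k. E N z (rot_dih k j w) + E N z (\<sigma> j w)) = hom_bessel k \<alpha> \<beta> N z w"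
proof -
  let ?K = "\<lambda>i. \<theta> i (N - 2 * i) * ((z \<bullet> z) * (w \<bullet> w)) ^ i"
  have "(\<Sum>j<2*k. E N z (rot_dih k j w) + E N z (\<sigma> j w)) =
     (\<Sum>j<2*k. \<Sum>i\<le>N div 2. ?K i * (u (N - 2 * i) z (rot_dih k j w) + u (N - 2 * i) z (\<sigma> j w)))"
    unfolding hom_kernel_def inner_rot_dih inner_refl_dih by (simp only: sum.distrib distrib_left)
  also have "\<dots> = (\<Sum>i\<le>N div 2. ?K i * (\<Sum>j<2*k. u (N - 2 * i) z (rot_dih k j w) + u (N - 2 * i) z (\<sigma> j w)))"
    unfolding sum_distrib_left by (rule sum.swap)
  finally show ?thesis
    unfolding hom_bessel_def hterm_avg[symmetric] by (simp only: sum_distrib_left mult_ac)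
qed

lemma gen_bessel_sums: "(\<lambda>N. hom_bessel k \<alpha> \<beta> N z w) sums gen_bessel k \<alpha> \<beta> z w"
  unfolding hom_kernel_avg[symmetric] gen_bessel_def dunkl_kernel_eq
  by (intro sums_mult sums_sum sums_add kernel_sums)

lemma sum_omega_even_power: "(\<Sum>i<k. \<omega> (2 * i) ^ n) = (if k dvd n then of_nat k else 0)"
proof -
  have "\<omega> (2 * i) ^ n = cis (2 * pi * real n / real k) ^ i" for i
    unfolding Complex.DeMoivre by (rule arg_cong[where f = cis]) (simp add: field_simps)
  then show ?thesis using sum_cis_powers[OF k_pos, of n] by simp
qed

lemma hterm_rot_avg: "(\<Sum>i<k. u n (z * \<omega> (2 * i)) w) = (if k dvd n then real k * u n z w else 0)"
proof -
  have "(\<Sum>i<k. u n (z * \<omega> (2 * i)) w) = 2 * Re (A n w * ((\<Sum>i<k. \<omega> (2 * i) ^ n) * \<phi> n z))"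
    unfolding hterm_def harm_rot by (simp only: sum_distrib_left sum_distrib_right Re_sum)
  moreover have "2 * Re (a * (of_nat k * p)) = real k * (2 * Re (a * p))" for a p
    by (simp add: algebra_simps)
  ultimately show ?thesis unfolding sum_omega_even_power hterm_def by (cases "k dvd n") simp_all
qed

lemma hom_kernel_rot_avg:
  "(\<Sum>i<k. E N (z * \<omega> (2 * i)) w) = real k * (\<Sum>j\<le>N div 2. \<theta> j (N - 2 * j) * ((z \<bullet> z) * (w \<bullet> w)) ^ j *
     (if k dvd (N - 2 * j) then u (N - 2 * j) z w else 0))"
proof -
  have n: "(z * \<omega> i) \<bullet> (z * \<omega> i) = z \<bullet> z" for i by (simp add: dot_square_norm norm_mult)
  have "(\<Sum>i<k. E N (z * \<omega> (2 * i)) w) = (\<Sum>j\<le>N div 2. \<theta> j (N - 2 * j) * ((z \<bullet> z) * (w \<bullet> w)) ^ j *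
      (\<Sum>i<k. u (N - 2 * j) (z * \<omega> (2 * i)) w))"
    unfolding hom_kernel_def n sum_distrib_left by (rule sum.swap)
  also have "\<dots> = (\<Sum>j\<le>N div 2. \<theta> j (N - 2 * j) * ((z \<bullet> z) * (w \<bullet> w)) ^ j *
      (real k * (if k dvd (N - 2 * j) then u (N - 2 * j) z w else 0)))"
    unfolding hterm_rot_avg by (rule sum.cong) auto
  finally show ?thesis by (simp only: sum_distrib_left mult_ac)
qed

end

section \<open>Explicit kernels for k = 1\<close>

text \<open>Taylor coefficients of the rank-one Dunkl kernel.\<close>
fun rcoef :: "real \<Rightarrow> nat \<Rightarrow> real" where
  "rcoef \<alpha> 0 = 1"
| "rcoef \<alpha> (Suc i) = rcoef \<alpha> i / (real (Suc i) + (if even i then 2 * \<alpha> else 0))"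

lemma rcoef_Suc:
  assumes "\<alpha> \<ge> 0"
  shows "(real (Suc i) + \<alpha> * (1 - (-1) ^ Suc i)) * rcoef \<alpha> (Suc i) = rcoef \<alpha> i"
proof -
  have "real (Suc i) + (if even i then 2 * \<alpha> else 0) > 0" using assms by auto
  moreover have "\<alpha> * (1 - (-1) ^ Suc i) = (if even i then 2 * \<alpha> else 0)" by auto
  ultimately show ?thesis by simp
qed

text \<open>For k = 1 the group is generated by the sign changes of the coordinates. The reflection
  j = 0 changes the sign of Im and has weight alpha, j = 1 that of Re with weight beta; therefore
  beta goes with X and alpha with Y.\<close>

definition prod_kernel :: "real \<Rightarrow> real \<Rightarrow> nat \<Rightarrow> real \<Rightarrow> real \<Rightarrow> real" where
  "prod_kernel \<alpha> \<beta> N X Y = (\<Sum>i\<le>N. (rcoef \<beta> i * X ^ i) * (rcoef \<alpha> (N - i) * Y ^ (N - i)))"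

lemma prod_kernel_euler:
  assumes "\<alpha> \<ge> 0" "\<beta> \<ge> 0"
  shows "real (Suc M) * prod_kernel \<alpha> \<beta> (Suc M) X Y + \<alpha> * (prod_kernel \<alpha> \<beta> (Suc M) X Y - prod_kernel \<alpha> \<beta> (Suc M) X (-Y)) +
     \<beta> * (prod_kernel \<alpha> \<beta> (Suc M) X Y - prod_kernel \<alpha> \<beta> (Suc M) (-X) Y) = (X + Y) * prod_kernel \<alpha> \<beta> M X Y"
proof -
  let ?N = "Suc M"
  let ?b = "\<lambda>i. rcoef \<beta> i * X ^ i" and ?a = "\<lambda>i. rcoef \<alpha> i * Y ^ i"
  have "real ?N * prod_kernel \<alpha> \<beta> ?N X Y + \<alpha> * (prod_kernel \<alpha> \<beta> ?N X Y - prod_kernel \<alpha> \<beta> ?N X (-Y)) +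
     \<beta> * (prod_kernel \<alpha> \<beta> ?N X Y - prod_kernel \<alpha> \<beta> ?N (-X) Y) =
     (\<Sum>i\<le>?N. ((real i + \<beta> * (1 - (-1) ^ i)) * ?b i) * ?a (?N - i) + ?b i * ((real (?N - i) + \<alpha> * (1 - (-1) ^ (?N - i))) * ?a (?N - i)))"
    unfolding prod_kernel_def sum_distrib_left sum_subtractf[symmetric] sum.distrib[symmetric]
  proof (rule sum.cong[OF refl])
    fix i assume "i \<in> {..?N}"
    then have N: "real ?N = real i + real (?N - i)" by (simp add: of_nat_diff)
    have m: "(-Y) ^ (?N - i) = (-1) ^ (?N - i) * Y ^ (?N - i)" "(-X) ^ i = (-1) ^ i * X ^ i"
      by (simp_all add: power_minus[of Y] power_minus[of X])
    show "real ?N * (?b i * ?a (?N - i)) + \<alpha> * (?b i * ?a (?N - i) - ?b i * (rcoef \<alpha> (?N - i) * (-Y) ^ (?N - i))) +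
       \<beta> * (?b i * ?a (?N - i) - rcoef \<beta> i * (-X) ^ i * ?a (?N - i)) =
      ((real i + \<beta> * (1 - (-1) ^ i)) * ?b i) * ?a (?N - i) + ?b i * ((real (?N - i) + \<alpha> * (1 - (-1) ^ (?N - i))) * ?a (?N - i))"
      unfolding N m by (simp add: algebra_simps del: of_nat_diff)
  qed
  also have "\<dots> = (\<Sum>i\<le>?N. ((real i + \<beta> * (1 - (-1) ^ i)) * ?b i) * ?a (?N - i)) +
      (\<Sum>i\<le>?N. ?b i * ((real (?N - i) + \<alpha> * (1 - (-1) ^ (?N - i))) * ?a (?N - i)))"
    by (rule sum.distrib)
  also have "(\<Sum>i\<le>?N. ((real i + \<beta> * (1 - (-1) ^ i)) * ?b i) * ?a (?N - i)) = X * prod_kernel \<alpha> \<beta> M X Y"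
  proof -
    have st: "((real (Suc i) + \<beta> * (1 - (-1) ^ Suc i)) * ?b (Suc i)) = X * ?b i" for i
      using rcoef_Suc[OF assms(2), of i] by (metis (no_types, lifting) mult.assoc mult.left_commute power_Suc)
    show ?thesis unfolding sum.atMost_Suc_shift st
      by (simp add: prod_kernel_def sum_distrib_left mult_ac)
  qed
  also have "(\<Sum>i\<le>?N. ?b i * ((real (?N - i) + \<alpha> * (1 - (-1) ^ (?N - i))) * ?a (?N - i))) = Y * prod_kernel \<alpha> \<beta> M X Y"
  proof -
    have st: "((real (Suc i) + \<alpha> * (1 - (-1) ^ Suc i)) * ?a (Suc i)) = Y * ?a i" for i
      using rcoef_Suc[OF assms(1), of i] by (metis (no_types, lifting) mult.assoc mult.left_commute power_Suc)
    have "(\<Sum>i\<le>?N. ?b i * ((real (?N - i) + \<alpha> * (1 - (-1) ^ (?N - i))) * ?a (?N - i))) =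
       (\<Sum>i\<le>M. ?b i * ((real (Suc (M - i)) + \<alpha> * (1 - (-1) ^ Suc (M - i))) * ?a (Suc (M - i))))"
      unfolding sum.atMost_Suc by (simp add: Suc_diff_le)
    then show ?thesis unfolding st
      by (simp add: prod_kernel_def sum_distrib_left mult_ac)
  qed
  finally show ?thesis by (simp add: algebra_simps)
qed

lemma lessThan_2_sum: "(\<Sum>j<2 * (1::nat). f j) = f 0 + (f 1 :: real)"
  by (simp add: numeral_2_eq_2)

lemma refl_dih_1: "refl_dih 1 0 z = cnj z" "refl_dih 1 1 z = - cnj z"
  by (simp_all add: refl_dih_cis)

lemma rot_dih_1: "rot_dih 1 0 z = z" "rot_dih 1 1 z = - z"
  by (simp_all add: rot_dih_cis)

lemma hom_kernel_1:
  assumes "\<alpha> \<ge> 0" "\<beta> \<ge> 0" "\<alpha> + \<beta> > 0"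
  shows "hom_kernel 1 \<alpha> \<beta> N z w = prod_kernel \<alpha> \<beta> N (Re z * Re w) (Im z * Im w)"
proof -
  interpret dihedral 1 \<alpha> \<beta> using assms by unfold_locales auto
  have "euler_seq w (\<lambda>N z. prod_kernel \<alpha> \<beta> N (Re z * Re w) (Im z * Im w))"
    unfolding euler_seq_def lessThan_2_sum refl_dih_1
    using prod_kernel_euler[OF assms(1,2)]
    by (simp add: prod_kernel_def[of _ _ 0] mult_dih_def inner_complex_def algebra_simps)
  then show ?thesis using euler_seq_unique[OF euler_seq_kernel] by blast
qed

text \<open>The only reflection of nonzero weight is conjugation, which fixes Re z; the difference
  terms vanish and the Taylor terms of exp (Re z) solve what is left.\<close>

lemma hom_kernel_1_real:
  assumes "a > 0"
  shows "hom_kernel 1 a 0 N z 1 = Re z ^ N / fact N"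
proof -
  interpret dihedral 1 a 0 using assms by unfold_locales auto
  have "real (Suc N) * (x ^ Suc N / fact (Suc N)) = x * (x ^ N / fact N)" for N and x :: real
    by (simp add: divide_simps del: of_nat_Suc)
  then have "euler_seq 1 (\<lambda>N z. Re z ^ N / fact N)"
    unfolding euler_seq_def lessThan_2_sum refl_dih_1
    by (simp add: mult_dih_def inner_complex_def del: power_Suc fact_Suc of_nat_Suc)
  then show ?thesis using euler_seq_unique[OF euler_seq_kernel] by blast
qed

text \<open>Averaging over the four sign changes of (X, Y) keeps the terms even in both
  variables.\<close>

lemma hom_bessel_1:
  assumes "\<alpha> \<ge> 0" "\<beta> \<ge> 0" "\<alpha> + \<beta> > 0"
  shows "hom_bessel 1 \<alpha> \<beta> N z w = (\<Sum>i\<le>N. ((if even i then rcoef \<beta> i else 0) * (Re z * Re w) ^ i) *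
     ((if even (N - i) then rcoef \<alpha> (N - i) else 0) * (Im z * Im w) ^ (N - i)))"
proof -
  interpret dihedral 1 \<alpha> \<beta> using assms by unfold_locales auto
  let ?X = "Re z * Re w" and ?Y = "Im z * Im w"
  let ?p = "prod_kernel \<alpha> \<beta> N"
  have "hom_bessel 1 \<alpha> \<beta> N z w = (1 / 4) * (?p ?X ?Y + ?p ?X (- ?Y) + (?p (- ?X) (- ?Y) + ?p (- ?X) ?Y))"
    unfolding hom_kernel_avg[symmetric] lessThan_2_sum rot_dih_1 refl_dih_1 hom_kernel_1[OF assms] by simp
  also have "\<dots> = (\<Sum>i\<le>N. ((if even i then rcoef \<beta> i else 0) * ?X ^ i) *
     ((if even (N - i) then rcoef \<alpha> (N - i) else 0) * ?Y ^ (N - i)))"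
    unfolding prod_kernel_def sum.distrib[symmetric] sum_distrib_left
    by (rule sum.cong) (auto simp: power_minus[of ?X] power_minus[of ?Y] algebra_simps)
  finally show ?thesis .
qed

section \<open>The kernel with multiplicity (a, 0) at w = 1\<close>

text \<open>The power series of \<open>(1 - x X) powr (- a)\<close>.\<close>
definition gfps :: "real \<Rightarrow> real \<Rightarrow> real fps" where
  "gfps a x = Abs_fps (\<lambda>n. pochhammer a n / fact n * x ^ n)"

definition geo :: "real \<Rightarrow> real fps" where
  "geo x = Abs_fps (\<lambda>n. x ^ n)"

lemma geo_mult: "(1 - fps_const x * fps_X) * geo x = 1"
proof (rule fps_ext)
  fix n show "fps_nth ((1 - fps_const x * fps_X) * geo x) n = fps_nth 1 n"
    by (cases n) (simp_all add: geo_def left_diff_distrib mult.assoc)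
qed

lemma fps_nth_0_prod: "fps_nth (\<Prod>i\<in>I. f i) 0 = (\<Prod>i\<in>I. fps_nth (f i :: real fps) 0)"
  by (induction I rule: infinite_finite_induct) simp_all

lemma geo_nth_step: "fps_nth (P * geo x) (Suc n) = fps_nth P (Suc n) + x * fps_nth (P * geo x) n"
proof -
  have "P * geo x - fps_const x * (fps_X * (P * geo x)) = P * ((1 - fps_const x * fps_X) * geo x)"
    by (simp add: algebra_simps)
  then have "P * geo x - fps_const x * (fps_X * (P * geo x)) = P" by (simp add: geo_mult)
  then have "fps_nth (P * geo x - fps_const x * (fps_X * (P * geo x))) (Suc n) = fps_nth P (Suc n)" by simp
  then show ?thesis by simp
qed

text \<open>Logarithmic derivative of F = (1 - x X)^(-a): X F' / F = a x X / (1 - x X).\<close>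

lemma gfps_deriv: "fps_X * fps_deriv (gfps a x) = fps_const a * (geo x - 1) * gfps a x"
proof -
  let ?F = "gfps a x" and ?q = "1 - fps_const x * fps_X"
  have 1: "?q * fps_deriv ?F = fps_const (a * x) * ?F"
  proof (rule fps_ext)
    fix n
    have e: "real (Suc n) * (pochhammer a (Suc n) / fact (Suc n) * x ^ Suc n) = (a + real n) * x * (pochhammer a n / fact n * x ^ n)" for n
      by (simp add: pochhammer_Suc divide_simps del: of_nat_Suc)
    show "fps_nth (?q * fps_deriv ?F) n = fps_nth (fps_const (a * x) * ?F) n"
    proof (cases n)
      case 0
      then show ?thesis using e[of 0] by (simp add: gfps_def left_diff_distrib mult.assoc)
    next
      case (Suc m)
      have "fps_nth (?q * fps_deriv ?F) n = real (Suc n) * fps_nth ?F (Suc n) - x * (real n * fps_nth ?F n)"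
        unfolding left_diff_distrib using Suc by (simp add: mult.assoc)
      also have "\<dots> = (a + real n) * x * fps_nth ?F n - x * (real n * fps_nth ?F n)"
        using e[of n] by (simp only: gfps_def fps_nth_Abs_fps)
      also have "\<dots> = a * x * fps_nth ?F n" by (simp add: algebra_simps)
      finally show ?thesis by simp
    qed
  qed
  have g: "fps_const x * fps_X * geo x = geo x - 1"
    using geo_mult[of x] by (simp add: algebra_simps)
  have "fps_X * fps_deriv ?F = fps_X * (((?q * geo x)) * fps_deriv ?F)" by (simp add: geo_mult)
  also have "\<dots> = fps_X * geo x * (?q * fps_deriv ?F)" by (simp only: mult_ac)
  also have "\<dots> = fps_const a * (fps_const x * fps_X * geo x) * ?F"
    unfolding 1 fps_const_mult[symmetric] by (simp only: mult_ac)
  finally show ?thesis unfolding g .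
qed

lemma gfps_prod_deriv:
  "finite I \<Longrightarrow> fps_X * fps_deriv (\<Prod>i\<in>I. gfps a (x i)) =
     (\<Prod>i\<in>I. gfps a (x i)) * (\<Sum>i\<in>I. fps_const a * (geo (x i) - 1))"
proof (induction I rule: finite_induct)
  case (insert i I)
  let ?P = "\<Prod>i\<in>I. gfps a (x i)" and ?F = "gfps a (x i)"
  have "fps_X * fps_deriv (?F * ?P) = ?F * (fps_X * fps_deriv ?P) + (fps_X * fps_deriv ?F) * ?P"
    by (simp add: algebra_simps)
  then show ?case using insert by (simp add: gfps_deriv algebra_simps)
qed simp

text \<open>Coefficient N of the logarithmic derivative of the product, with the constants -a moved
  to the left.\<close>

lemma gfps_prod_nth:
  assumes "finite I"
  shows "(real N + real (card I) * a) * fps_nth (\<Prod>i\<in>I. gfps a (x i)) N =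
     a * (\<Sum>i\<in>I. fps_nth ((\<Prod>i\<in>I. gfps a (x i)) * geo (x i)) N)"
proof -
  let ?P = "\<Prod>i\<in>I. gfps a (x i)"
  have "real N * fps_nth ?P N = fps_nth (fps_X * fps_deriv ?P) N"
    by (cases N) simp_all
  also have "\<dots> = fps_nth (\<Sum>i\<in>I. fps_const a * (?P * geo (x i)) - fps_const a * ?P) N"
    unfolding gfps_prod_deriv[OF assms] by (simp add: sum_distrib_left algebra_simps)
  also have "\<dots> = a * (\<Sum>i\<in>I. fps_nth (?P * geo (x i)) N) - real (card I) * a * fps_nth ?P N"
    by (simp add: fps_sum_nth sum_subtractf sum_distrib_left)
  finally show ?thesis by (simp add: algebra_simps)
qed

text \<open>The product of (1 - Re (z xi) X)^(-a) over the k-th roots of unity. Coefficient N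
  divided by the Pochhammer symbol (k a)_N is the Dirichlet mean of (sum_j t_j x_j)^N / N!, the x_j
  being the numbers Re (z xi).\<close>

definition root_prod :: "nat \<Rightarrow> real \<Rightarrow> complex \<Rightarrow> real fps" where
  "root_prod k a z = (\<Prod>\<xi> | \<xi> ^ k = 1. gfps a (Re (z * \<xi>)))"

lemma roots_of_unity_bij: "k > 0 \<Longrightarrow> bij_betw (\<lambda>i. cis (2 * pi * real i / real k)) {..<k} {\<xi>. \<xi> ^ k = 1}"
  by (rule Complex.bij_betw_roots_unity)

lemma cis_root_power: "k > 0 \<Longrightarrow> cis (2 * pi * real i / real k) ^ k = 1"
  unfolding Complex.DeMoivre by (rule cis_eq_1_nat) simp

lemma root_cnj: "\<xi> ^ k = 1 \<Longrightarrow> k > 0 \<Longrightarrow> cnj \<xi> * \<xi> = (1::complex)"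
proof -
  assume "\<xi> ^ k = 1" "k > 0"
  then have "norm \<xi> = 1" by (metis norm_one norm_power power_eq_1_iff norm_ge_zero not_gr_zero)
  then show ?thesis by (metis complex_norm_square mult.commute of_real_1 one_power2)
qed

lemma root_prod_rot:
  assumes "k > 0" "\<eta> ^ k = 1"
  shows "root_prod k a (z * \<eta>) = root_prod k a z"
  unfolding root_prod_def
proof (rule prod.reindex_bij_witness[where i = "\<lambda>\<xi>. cnj \<eta> * \<xi>" and j = "\<lambda>\<xi>. \<eta> * \<xi>"])
  fix \<xi> :: complex assume "\<xi> \<in> {\<xi>. \<xi> ^ k = 1}"
  then show "cnj \<eta> * (\<eta> * \<xi>) = \<xi>" "\<eta> * (cnj \<eta> * \<xi>) = \<xi>" "cnj \<eta> * \<xi> \<in> {\<xi>. \<xi> ^ k = 1}" "\<eta> * \<xi> \<in> {\<xi>. \<xi> ^ k = 1}"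
    using root_cnj[OF assms(2,1)] assms(2)
    by (simp_all add: mult.assoc[symmetric] power_mult_distrib mult.commute[of \<eta> "cnj \<eta>"] flip: complex_cnj_power)
qed (simp add: mult.assoc)

lemma root_prod_cnj: "root_prod k a (cnj z) = root_prod k a z"
  unfolding root_prod_def
proof (rule prod.reindex_bij_witness[where i = cnj and j = cnj])
  fix \<xi> :: complex assume "\<xi> \<in> {\<xi>. \<xi> ^ k = 1}"
  then show "cnj \<xi> \<in> {\<xi>. \<xi> ^ k = 1}" by (metis complex_cnj_one complex_cnj_power mem_Collect_eq)
  then show "cnj \<xi> \<in> {\<xi>. \<xi> ^ k = 1}" .
qed simp_all

lemma sum_geo_refl:
  fixes f :: "real \<Rightarrow> real"
  assumes "k > 0"
  shows "(\<Sum>i<k. f (Re (cnj z * cis (2 * pi * real i / real k)))) = (\<Sum>\<xi> | \<xi> ^ k = 1. f (Re (z * \<xi>)))"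
proof -
  have "(\<Sum>i<k. f (Re (cnj z * cis (2 * pi * real i / real k)))) = (\<Sum>\<xi> | \<xi> ^ k = 1. f (Re (cnj z * \<xi>)))"
    by (rule sum.reindex_bij_betw[OF roots_of_unity_bij[OF assms]])
  also have "\<dots> = (\<Sum>\<xi> | \<xi> ^ k = 1. f (Re (z * \<xi>)))"
  proof (rule sum.reindex_bij_witness[where i = cnj and j = cnj])
    fix \<xi> :: complex assume "\<xi> \<in> {\<xi>. \<xi> ^ k = 1}"
    then show "cnj \<xi> \<in> {\<xi>. \<xi> ^ k = 1}" by (metis complex_cnj_one complex_cnj_power mem_Collect_eq)
    then show "cnj \<xi> \<in> {\<xi>. \<xi> ^ k = 1}" .
  qed simp_all
  finally show ?thesis .
qed

lemma root_prod_nth: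
  assumes "k > 0"
  shows "(real N + real k * a) * fps_nth (root_prod k a z) N =
     a * (\<Sum>\<xi> | \<xi> ^ k = 1. fps_nth (root_prod k a z * geo (Re (z * \<xi>))) N)"
proof -
  have "finite {\<xi>::complex. \<xi> ^ k = 1}" using assms by (intro finite_roots_unity) simp
  moreover have "card {\<xi>::complex. \<xi> ^ k = 1} = k" by (rule card_roots_unity_eq) (use assms in simp)
  ultimately show ?thesis unfolding root_prod_def using gfps_prod_nth by metis
qed

text \<open>The factor \<open>geo\<close> raises the exponent at xi = 1 from a to a + 1. So the
  candidate is a Dirichlet mean with parameters (a + 1, a, ..., a), whose sum k a + 1 explains the
  denominator.\<close>

lemma hom_kernel_root_prod:
  assumes k: "k > 0" and a: "a > 0"
  shows "hom_kernel k a 0 N z 1 = fps_nth (root_prod k a z * geo (Re z)) N / pochhammer (real k * a + 1) N"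
proof -
  interpret dihedral k a 0 using assms by unfold_locales auto
  define f where "f N z = fps_nth (root_prod k a z * geo (Re z)) N / pochhammer (real k * a + 1) N" for N z
  let ?\<eta> = "\<lambda>i. cis (2 * pi * real i / real k)"
  have refl: "refl_dih k (2 * i) z = cnj z * ?\<eta> i" for i z
    unfolding refl_dih_cis by (simp add: mult_ac)
  have P: "root_prod k a (cnj z * ?\<eta> i) = root_prod k a z" for i z
    using root_prod_rot[OF k cis_root_power[OF k]] root_prod_cnj by metis
  have "euler_seq 1 f"
    unfolding euler_seq_def
  proof (intro conjI allI)
    fix z show "f 0 z = 1"
      by (simp add: f_def root_prod_def geo_def gfps_def fps_nth_0_prod)
  next
    fix M and z :: complex
    let ?N = "Suc M" and ?P = "root_prod k a z" and ?x = "Re z"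
    let ?Q = "pochhammer (real k * a + 1) ?N"
    have Q: "?Q = pochhammer (real k * a + 1) M * (real ?N + real k * a)"
      by (simp add: pochhammer_Suc algebra_simps)
    have pos: "pochhammer (real k * a + 1) M > 0" "real ?N + real k * a > 0"
      using k a by (intro pochhammer_pos add_pos_pos mult_pos_pos; simp)+
    \<comment> \<open>Only even j have nonzero weight. They leave \<open>root_prod\<close> unchanged
      and move Re z through all Re (z xi).\<close>
    have "(\<Sum>j<2*k. mult_dih a 0 j * (f ?N z - f ?N (refl_dih k j z))) = (\<Sum>i<k. a * (f ?N z - f ?N (cnj z * ?\<eta> i)))"
      unfolding sum_lessThan_double by (simp add: mult_dih_def refl)
    also have "\<dots> = real k * a * f ?N z - a * (\<Sum>i<k. f ?N (cnj z * ?\<eta> i))"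
      by (simp add: sum_subtractf right_diff_distrib sum_distrib_left)
    also have "(\<Sum>i<k. f ?N (cnj z * ?\<eta> i)) = (\<Sum>\<xi> | \<xi> ^ k = 1. fps_nth (?P * geo (Re (z * \<xi>))) ?N / ?Q)"
      unfolding f_def P by (rule sum_geo_refl[OF k, where f = "\<lambda>x. fps_nth (?P * geo x) ?N / ?Q"])
    \<comment> \<open>The reflected values sum to the coefficient of the bare product, so the Euler
      equation reduces to the one-step recursion \<open>geo_nth_step\<close>.\<close>
    also have "a * \<dots> = (real ?N + real k * a) * fps_nth ?P ?N / ?Q"
      unfolding root_prod_nth[OF k] sum_divide_distrib[symmetric] by simp
    finally have "real ?N * f ?N z + (\<Sum>j<2*k. mult_dih a 0 j * (f ?N z - f ?N (refl_dih k j z))) =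
        (real ?N + real k * a) * (fps_nth (?P * geo ?x) ?N - fps_nth ?P ?N) / ?Q"
      by (simp add: f_def algebra_simps add_divide_distrib diff_divide_distrib)
    also have "\<dots> = (real ?N + real k * a) * (?x * fps_nth (?P * geo ?x) M) / ?Q"
      unfolding geo_nth_step by simp
    also have "\<dots> = ?x * f M z"
    proof -
      have "G * (x * F) / (P * G) = x * (F / P)" if "G > 0" for x F P G :: real using that by simp
      then show ?thesis unfolding Q f_def using pos(2) by blast
    qed
    finally show "real ?N * f ?N z + (\<Sum>j<2*k. mult_dih a 0 j * (f ?N z - f ?N (refl_dih k j z))) = (z \<bullet> 1) * f M z"
      by (simp add: inner_complex_def)
  qed
  then have "hom_kernel k a 0 N z 1 = f N z" using euler_seq_unique[OF euler_seq_kernel] by blast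
  then show ?thesis by (simp add: f_def)
qed

text \<open>The rotation average of that kernel at a point, as a function of the squared modulus q
  and the k-th power c of the point. In this form no choice of a k-th root is involved.\<close>

definition dir_avg :: "nat \<Rightarrow> real \<Rightarrow> nat \<Rightarrow> real \<Rightarrow> complex \<Rightarrow> real" where
  "dir_avg k a N q c = (\<Sum>j\<le>N div 2. bessel_coef (real k * a) j (N - 2 * j) * q ^ j *
     (if k dvd (N - 2 * j) then tweight k a ((N - 2 * j) div k) * hterm 1 a 0 ((N - 2 * j) div k) c 1 else 0))"

lemma dir_avg_eq_sum:
  assumes k: "k > 0" and a: "a > 0"
  shows "real k * dir_avg k a N (\<zeta> \<bullet> \<zeta>) (\<zeta> ^ k) =
    (\<Sum>i<k. hom_kernel k a 0 N (\<zeta> * cis (real (2 * i) * pi / real k)) 1)"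
proof -
  interpret dihedral k a 0 using assms by unfold_locales auto
  show ?thesis
    unfolding hom_kernel_rot_avg dir_avg_def
  proof (intro arg_cong[where f = "\<lambda>x. real k * x"] sum.cong refl)
    fix j
    have "hterm k a 0 n \<zeta> 1 = tweight k a (n div k) * hterm 1 a 0 (n div k) (\<zeta> ^ k) 1" if "k dvd n" for n
      using that hterm_mult[of "n div k" \<zeta> 1] by simp
    then show "bessel_coef (real k * a) j (N - 2 * j) * (\<zeta> \<bullet> \<zeta>) ^ j *
         (if k dvd N - 2 * j then tweight k a ((N - 2 * j) div k) * hterm 1 a 0 ((N - 2 * j) div k) (\<zeta> ^ k) 1 else 0) =
         bessel_coef (real k * (a + 0)) j (N - 2 * j) * (\<zeta> \<bullet> \<zeta> * ((1::complex) \<bullet> 1)) ^ j *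
         (if k dvd N - 2 * j then hterm k a 0 (N - 2 * j) \<zeta> 1 else 0)"
      by (simp add: inner_complex_def)
  qed
qed

text \<open>Averaging over rotations sums the \<open>geo\<close> factors over all roots, and
  \<open>root_prod_nth\<close> turns that sum into the bare product: the Dirichlet parameters become
  symmetric.\<close>

lemma dir_avg_eq_root_prod:
  assumes k: "k > 0" and a: "a > 0"
  shows "dir_avg k a N (\<zeta> \<bullet> \<zeta>) (\<zeta> ^ k) = fps_nth (root_prod k a \<zeta>) N / pochhammer (real k * a) N"
proof -
  interpret dihedral k a 0 using assms by unfold_locales auto
  let ?\<eta> = "\<lambda>i. cis (2 * pi * real i / real k)"
  have om: "\<omega> (2 * i) = ?\<eta> i" for i by (simp add: mult_ac)
  have pos: "pochhammer (real k * a + 1) N > 0" "pochhammer (real k * a) N > 0"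
    using k a by (auto intro!: pochhammer_pos add_pos_pos)
  \<comment> \<open>Both sides are the Pochhammer symbol (k a)_(N + 1), split off at either
    end.\<close>
  have P: "pochhammer (real k * a) N * (real k * a + real N) = real k * a * pochhammer (real k * a + 1) N"
    by (metis pochhammer_Suc pochhammer_rec)
  have "real k * dir_avg k a N (\<zeta> \<bullet> \<zeta>) (\<zeta> ^ k) = (\<Sum>i<k. hom_kernel k a 0 N (\<zeta> * \<omega> (2 * i)) 1)"
    by (rule dir_avg_eq_sum[OF k a])
  also have "\<dots> = (\<Sum>i<k. fps_nth (root_prod k a \<zeta> * geo (Re (\<zeta> * ?\<eta> i))) N / pochhammer (real k * a + 1) N)"
    unfolding hom_kernel_root_prod[OF k a] om root_prod_rot[OF k cis_root_power[OF k]] ..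
  also have "\<dots> = (\<Sum>\<xi> | \<xi> ^ k = 1. fps_nth (root_prod k a \<zeta> * geo (Re (\<zeta> * \<xi>))) N / pochhammer (real k * a + 1) N)"
    by (rule sum.reindex_bij_betw[OF roots_of_unity_bij[OF k]])
  finally have "a * (real k * dir_avg k a N (\<zeta> \<bullet> \<zeta>) (\<zeta> ^ k)) = (real N + real k * a) * fps_nth (root_prod k a \<zeta>) N / pochhammer (real k * a + 1) N"
    unfolding root_prod_nth[OF k] sum_divide_distrib[symmetric] by simp
  then have "real k * a * dir_avg k a N (\<zeta> \<bullet> \<zeta>) (\<zeta> ^ k) * pochhammer (real k * a + 1) N = (real k * a + real N) * fps_nth (root_prod k a \<zeta>) N"
    using pos by (simp add: field_simps)
  then have "(pochhammer (real k * a) N * dir_avg k a N (\<zeta> \<bullet> \<zeta>) (\<zeta> ^ k)) * (real k * a + real N) = fps_nth (root_prod k a \<zeta>) N * (real k * a + real N)"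
    using P by (metis mult.assoc mult.commute)
  moreover have "real k * a + real N \<noteq> 0" using k a by (simp add: add_pos_nonneg less_imp_neq[symmetric])
  ultimately have "pochhammer (real k * a) N * dir_avg k a N (\<zeta> \<bullet> \<zeta>) (\<zeta> ^ k) = fps_nth (root_prod k a \<zeta>) N"
    by (metis mult_right_cancel)
  then show ?thesis using pos by (simp add: field_simps)
qed

section \<open>Moments of the measures\<close>

lemma nn_integral_Beta:
  fixes a b :: real assumes "a > 0" "b > 0"
  shows "(\<integral>\<^sup>+x. ennreal (indicator {0..1} x * (x powr (a - 1) * (1 - x) powr (b - 1))) \<partial>lborel) = ennreal (Beta a b)"
  using nn_integral_has_integral_lebesgue[OF _ has_integral_Beta_real[OF assms]] by simp

lemma Beta_real_pos: "a > 0 \<Longrightarrow> b > 0 \<Longrightarrow> Beta a b > (0::real)"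
  by (simp add: Beta_def)

lemma nn_integral_half_moment:
  fixes \<alpha> :: real assumes "\<alpha> > 0"
  shows "(\<integral>\<^sup>+u. ennreal (indicator {0..1} u * (u ^ (2 * i) * (1 - u\<^sup>2) powr (\<alpha> - 1))) \<partial>lborel) = ennreal (Beta (real i + 1 / 2) \<alpha> / 2)"
proof -
  let ?f = "\<lambda>x. x powr (real i + 1 / 2 - 1) * (1 - x) powr (\<alpha> - 1) :: real"
  let ?h = "\<lambda>u. indicator {0..1} u * (u ^ (2 * i) * (1 - u\<^sup>2) powr (\<alpha> - 1)) :: real"
  have "ennreal (Beta (real i + 1 / 2) \<alpha>) = (\<integral>\<^sup>+x. ennreal (indicator {0..1} x * ?f x) \<partial>lborel)"
    by (rule nn_integral_Beta[symmetric]) (use assms in auto)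
  also have "\<dots> = (\<integral>\<^sup>+x. ?f x * indicator {0\<^sup>2..1\<^sup>2} x \<partial>lborel)"
    by (simp add: mult.commute)
  also have "\<dots> = (\<integral>\<^sup>+x. ?f (x\<^sup>2) * (2 * x) * indicator {0..1} x \<partial>lborel)"
    by (rule nn_integral_substitution[where g = "\<lambda>x. x\<^sup>2" and g' = "\<lambda>x. 2 * x" and a = 0 and b = 1])
       (auto simp: set_borel_measurable_def intro!: derivative_eq_intros continuous_intros)
  also have "\<dots> = (\<integral>\<^sup>+u. 2 * ennreal (?h u) \<partial>lborel)"
  proof (rule nn_integral_cong_AE)
    \<comment> \<open>At u = 0 the integrands differ for i = 0: 0 powr is 0, whereas 0 ^ 0 is
      1.\<close>
    have "AE u in lborel. u \<noteq> (0::real)" by (rule AE_lborel_singleton)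
    then show "AE u in lborel. ennreal (?f (u\<^sup>2) * (2 * u) * indicator {0..1} u) = 2 * ennreal (?h u)"
    proof eventually_elim
      fix u :: real assume u: "u \<noteq> 0"
      show "ennreal (?f (u\<^sup>2) * (2 * u) * indicator {0..1} u) = 2 * ennreal (?h u)"
      proof (cases "u \<in> {0..1}")
        case True
        then have "u > 0" using u by auto
        then have "(u\<^sup>2) powr (real i + 1 / 2 - 1) * u = u powr (2 * (real i + 1 / 2 - 1)) * u powr 1"
          by (simp add: powr_powr flip: powr_numeral)
        also have "\<dots> = u ^ (2 * i)"
          using \<open>u > 0\<close> by (subst powr_add[symmetric]) (simp add: powr_realpow[symmetric] algebra_simps)
        finally have e: "(u\<^sup>2) powr (real i + 1 / 2 - 1) * u = u ^ (2 * i)" .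
        have "?f (u\<^sup>2) * (2 * u) = 2 * (((u\<^sup>2) powr (real i + 1 / 2 - 1) * u) * (1 - u\<^sup>2) powr (\<alpha> - 1))" by simp
        then have "?f (u\<^sup>2) * (2 * u) * indicator {0..1} u = 2 * ?h u" unfolding e using True by simp
        then show ?thesis by (simp only: ennreal_mult'[of 2] ennreal_numeral zero_le_numeral)
      qed simp
    qed
  qed
  also have "\<dots> = 2 * (\<integral>\<^sup>+u. ennreal (?h u) \<partial>lborel)" by (rule nn_integral_cmult) simp
  finally have "2 * (\<integral>\<^sup>+u. ennreal (?h u) \<partial>lborel) = 2 * ennreal (Beta (real i + 1 / 2) \<alpha> / 2)"
    using Beta_real_pos[of "real i + 1/2" \<alpha>] assms
    by (simp add: ennreal_mult'[symmetric] flip: ennreal_numeral)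
  then show ?thesis by (simp add: ennreal_mult_cancel_left)
qed

lemma nn_integral_even_moment:
  fixes \<alpha> :: real assumes "\<alpha> > 0"
  shows "(\<integral>\<^sup>+u. ennreal (indicator {-1..1} u * (u ^ (2 * i) * (1 - u\<^sup>2) powr (\<alpha> - 1))) \<partial>lborel) = ennreal (Beta (real i + 1 / 2) \<alpha>)"
proof -
  let ?h = "\<lambda>u. indicator {0..1} u * (u ^ (2 * i) * (1 - u\<^sup>2) powr (\<alpha> - 1)) :: real"
  have m: "(\<lambda>u. ennreal (?h u)) \<in> borel_measurable borel" by measurable
  have "(\<integral>\<^sup>+u. ennreal (indicator {-1..1} u * (u ^ (2 * i) * (1 - u\<^sup>2) powr (\<alpha> - 1))) \<partial>lborel) =
     (\<integral>\<^sup>+u. ennreal (?h u) + ennreal (?h (0 + (-1) * u)) \<partial>lborel)"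
  proof (rule nn_integral_cong_AE)
    have "AE u in lborel. u \<noteq> (0::real)" by (rule AE_lborel_singleton)
    then show "AE u in lborel. ennreal (indicator {-1..1} u * (u ^ (2 * i) * (1 - u\<^sup>2) powr (\<alpha> - 1))) =
       ennreal (?h u) + ennreal (?h (0 + (-1) * u))"
      by eventually_elim (auto simp: indicator_def)
  qed
  also have "\<dots> = (\<integral>\<^sup>+u. ennreal (?h u) \<partial>lborel) + (\<integral>\<^sup>+u. ennreal (?h (0 + (-1) * u)) \<partial>lborel)"
    by (rule nn_integral_add) measurable
  also have "(\<integral>\<^sup>+u. ennreal (?h (0 + (-1) * u)) \<partial>lborel) = (\<integral>\<^sup>+u. ennreal (?h u) \<partial>lborel)"
    using nn_integral_real_affine[OF m, of "-1" 0] by simp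
  also have "(\<integral>\<^sup>+u. ennreal (?h u) \<partial>lborel) + (\<integral>\<^sup>+u. ennreal (?h u) \<partial>lborel) = ennreal (Beta (real i + 1 / 2) \<alpha>)"
    unfolding nn_integral_half_moment[OF assms] using Beta_real_pos[of "real i + 1/2" \<alpha>] assms
    by (simp flip: ennreal_plus)
  finally show ?thesis .
qed

text \<open>Raising the first argument x of Beta by one multiplies it by x / (x + alpha), which is
  the quotient of consecutive even terms n! * \<open>rcoef\<close> n. The constant normalises the
  case i = 0 to 1.\<close>

lemma rcoef_even_Beta:
  assumes "\<alpha> > 0"
  shows "Gamma (\<alpha> + 1/2) / (sqrt pi * Gamma \<alpha>) * Beta (real i + 1 / 2) \<alpha> = fact (2 * i) * rcoef \<alpha> (2 * i)"
proof (induction i)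
  case 0
  have "Gamma \<alpha> > 0" "Gamma (\<alpha> + 1/2) > 0" using assms by auto
  then show ?case by (simp add: Beta_def Gamma_one_half_real add.commute field_simps)
next
  case (Suc i)
  let ?x = "real i + 1 / 2" and ?K = "Gamma (\<alpha> + 1/2) / (sqrt pi * Gamma \<alpha>)"
  have x: "?x \<notin> \<int>\<^sub>\<le>\<^sub>0" by (auto elim!: nonpos_Ints_cases)
  have "Beta (real (Suc i) + 1 / 2) \<alpha> = Beta (?x + 1) \<alpha>" by (simp add: algebra_simps)
  also have "\<dots> = ?x / (?x + \<alpha>) * Beta ?x \<alpha>"
    using Beta_plus1_left[OF x, of \<alpha>] assms by (simp add: field_simps)
  finally have "?K * Beta (real (Suc i) + 1 / 2) \<alpha> = ?x / (?x + \<alpha>) * (fact (2 * i) * rcoef \<alpha> (2 * i))"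
    using Suc by (metis mult.left_commute)
  also have "?x / (?x + \<alpha>) = (2 * real i + 1) / (2 * real i + 1 + 2 * \<alpha>)"
    using assms by (simp add: divide_simps) (simp add: algebra_simps)
  also have "\<dots> * (fact (2 * i) * rcoef \<alpha> (2 * i)) = fact (2 * Suc i) * rcoef \<alpha> (2 * Suc i)"
  proof -
    have r: "rcoef \<alpha> (2 * Suc i) = rcoef \<alpha> (2 * i) / (2 * real i + 1 + 2 * \<alpha>) / (2 * real i + 2)"
      by (simp add: algebra_simps)
    have f: "fact (2 * Suc i) = (2 * real i + 2) * ((2 * real i + 1) * fact (2 * i))"
      by (simp add: algebra_simps)
    have "2 * real i + 2 \<noteq> 0" "2 * real i + 1 + 2 * \<alpha> \<noteq> 0" using assms by linarith+
    then show ?thesis unfolding r f by (simp add: divide_simps)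
  qed
  finally show ?case .
qed

lemma sets_nu_meas [simp, measurable_cong]: "sets (nu_meas \<alpha>) = sets borel"
  by (simp add: nu_meas_def)

lemma space_nu_meas [simp]: "space (nu_meas \<alpha>) = UNIV"
  by (simp add: nu_meas_def)

lemma nu_density_measurable [measurable]:
  "(\<lambda>u. ennreal (indicator {-1..1} u * (Gamma (\<alpha> + 1/2) / (sqrt pi * Gamma \<alpha>)) * (1 - u\<^sup>2) powr (\<alpha> - 1))) \<in> borel_measurable borel"
  by measurable

lemma AE_nu_meas: "AE u in nu_meas \<alpha>. u \<in> {-1..1}"
  unfolding nu_meas_def by (subst AE_density) (auto intro!: AE_I2 simp: indicator_def)

lemma nu_const_nonneg: "\<alpha> > 0 \<Longrightarrow> Gamma (\<alpha> + 1/2) / (sqrt pi * Gamma \<alpha>) \<ge> (0::real)"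
  by (auto intro!: divide_nonneg_nonneg mult_nonneg_nonneg less_imp_le[OF Gamma_real_pos])

lemma nn_integral_nu_even:
  assumes "\<alpha> > 0"
  shows "(\<integral>\<^sup>+u. ennreal (u ^ (2 * i)) \<partial>nu_meas \<alpha>) = ennreal (fact (2 * i) * rcoef \<alpha> (2 * i))"
proof -
  let ?K = "Gamma (\<alpha> + 1/2) / (sqrt pi * Gamma \<alpha>)"
  have K: "?K \<ge> 0" by (rule nu_const_nonneg[OF assms])
  have shuffle: "ennreal (e * K * p) * ennreal x = ennreal K * ennreal (e * (x * p))"
    if "K \<ge> 0" "e \<ge> 0" "p \<ge> 0" "x \<ge> 0" for K e p x :: real
    using that by (simp add: ennreal_mult[symmetric] mult_ac)
  have "(\<integral>\<^sup>+u. ennreal (u ^ (2 * i)) \<partial>nu_meas \<alpha>) =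
     (\<integral>\<^sup>+u. ennreal (indicator {-1..1} u * ?K * (1 - u\<^sup>2) powr (\<alpha> - 1)) * ennreal (u ^ (2 * i)) \<partial>lborel)"
    unfolding nu_meas_def by (rule nn_integral_density) measurable
  also have "\<dots> = (\<integral>\<^sup>+u. ennreal ?K * ennreal (indicator {-1..1} u * (u ^ (2 * i) * (1 - u\<^sup>2) powr (\<alpha> - 1))) \<partial>lborel)"
    by (intro nn_integral_cong shuffle K) auto
  also have "\<dots> = ennreal ?K * ennreal (Beta (real i + 1 / 2) \<alpha>)"
    unfolding nn_integral_even_moment[OF assms, symmetric] by (rule nn_integral_cmult) measurable
  also have "\<dots> = ennreal (fact (2 * i) * rcoef \<alpha> (2 * i))"
    unfolding rcoef_even_Beta[OF assms, symmetric] using K by (rule ennreal_mult'[symmetric])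
  finally show ?thesis .
qed

lemma nu_meas_even:
  assumes "\<alpha> > 0"
  shows "has_bochner_integral (nu_meas \<alpha>) (\<lambda>u. u ^ (2 * i)) (fact (2 * i) * rcoef \<alpha> (2 * i))"
proof (rule has_bochner_integral_nn_integral)
  show "0 \<le> fact (2 * i) * rcoef \<alpha> (2 * i)"
    unfolding rcoef_even_Beta[OF assms, symmetric]
    using Beta_real_pos[of "real i + 1/2" \<alpha>] assms nu_const_nonneg[OF assms] by (intro mult_nonneg_nonneg) auto
  show "(\<integral>\<^sup>+u. ennreal (u ^ (2 * i)) \<partial>nu_meas \<alpha>) = ennreal (fact (2 * i) * rcoef \<alpha> (2 * i))"
    by (rule nn_integral_nu_even[OF assms])
qed auto

lemma finite_measure_nu_meas: "\<alpha> > 0 \<Longrightarrow> finite_measure (nu_meas \<alpha>)"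
proof (rule finite_measureI)
  assume "\<alpha> > 0"
  then have "(\<integral>\<^sup>+u. 1 \<partial>nu_meas \<alpha>) = 1" using nn_integral_nu_even[of \<alpha> 0] by simp
  then show "emeasure (nu_meas \<alpha>) (space (nu_meas \<alpha>)) \<noteq> \<infinity>" by simp
qed

lemma nu_meas_moment:
  assumes "\<alpha> > 0"
  shows "(\<integral>u. u ^ n \<partial>nu_meas \<alpha>) = (if even n then fact n * rcoef \<alpha> n else 0)"
proof (cases "even n")
  case True
  then show ?thesis using nu_meas_even[OF assms, of "n div 2"] by (simp add: has_bochner_integral_iff)
next
  case False
  let ?D = "\<lambda>u. indicator {-1..1} u * (Gamma (\<alpha> + 1/2) / (sqrt pi * Gamma \<alpha>)) * (1 - u\<^sup>2) powr (\<alpha> - 1)"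
  have D: "?D u \<ge> 0" for u
    using nu_const_nonneg[OF assms] by (intro mult_nonneg_nonneg) auto
  have "(\<integral>u. u ^ n \<partial>nu_meas \<alpha>) = (\<integral>u. ?D u *\<^sub>R u ^ n \<partial>lborel)"
    unfolding nu_meas_def using D by (intro integral_density AE_I2) measurable
  also have "\<dots> = (\<integral>u. ?D (0 + (-1) * u) *\<^sub>R (0 + (-1) * u) ^ n \<partial>lborel)"
    by (subst lborel_integral_real_affine[where c = "-1" and t = 0]) simp_all
  also have "\<dots> = (\<integral>u. - (?D u *\<^sub>R u ^ n) \<partial>lborel)"
    using False by (intro Bochner_Integration.integral_cong) (auto simp: indicator_def)
  also have "\<dots> = - (\<integral>u. u ^ n \<partial>nu_meas \<alpha>)"
    unfolding nu_meas_def using D by (subst integral_density) (auto simp del: times_divide_eq_right times_divide_eq_left)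
  finally show ?thesis using False by simp
qed

section \<open>The Dirichlet distribution\<close>

lemma nn_integral_Beta_scaled:
  fixes a b T :: real assumes "a > 0" "b > 0" "T > 0"
  shows "(\<integral>\<^sup>+x. ennreal (if 0 < x \<and> x < T then x powr (a - 1) * (T - x) powr (b - 1) else 0) \<partial>lborel)
     = ennreal (T powr (a + b - 1) * Beta a b)"
proof -
  let ?f = "\<lambda>x. ennreal (if 0 < x \<and> x < T then x powr (a - 1) * (T - x) powr (b - 1) else 0)"
  let ?g = "\<lambda>x. indicator {0..1} x * (x powr (a - 1) * (1 - x) powr (b - 1)) :: real"
  have m: "?f \<in> borel_measurable borel" by measurable
  have "(\<integral>\<^sup>+x. ?f x \<partial>lborel) = ennreal \<bar>T\<bar> * (\<integral>\<^sup>+x. ?f (0 + T * x) \<partial>lborel)"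
    by (rule nn_integral_real_affine[OF m]) (use assms in simp)
  also have "(\<lambda>x. ?f (0 + T * x)) = (\<lambda>x. ennreal (T powr (a + b - 2)) * ennreal (?g x))"
  proof
    fix x :: real
    show "?f (0 + T * x) = ennreal (T powr (a + b - 2)) * ennreal (?g x)"
    proof (cases "0 < x \<and> x < 1")
      case True
      have "T - T * x = T * (1 - x)" by (simp add: algebra_simps)
      then have "(T * x) powr (a - 1) * (T - T * x) powr (b - 1) = (T powr (a - 1) * T powr (b - 1)) * (x powr (a - 1) * (1 - x) powr (b - 1))"
        using True assms by (simp add: powr_mult)
      also have "T powr (a - 1) * T powr (b - 1) = T powr (a + b - 2)"
        by (simp add: powr_add[symmetric])
      finally show ?thesis using True assms by (simp add: ennreal_mult)
    next
      case False
      have "?f (0 + T * x) = 0" using False assms by (auto simp: zero_less_mult_iff)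
      moreover have "?g x = 0" using False by (auto simp: indicator_def)
      ultimately show ?thesis by simp
    qed
  qed
  also have "(\<integral>\<^sup>+x. ennreal (T powr (a + b - 2)) * ennreal (?g x) \<partial>lborel) = ennreal (T powr (a + b - 2)) * ennreal (Beta a b)"
    unfolding nn_integral_Beta[OF assms(1,2), symmetric] by (rule nn_integral_cmult) measurable
  also have "ennreal \<bar>T\<bar> * (ennreal (T powr (a + b - 2)) * ennreal (Beta a b)) = ennreal (T powr (a + b - 1) * Beta a b)"
  proof -
    have "T * T powr (a + b - 2) = T powr (a + b - 1)" using assms(3) by (simp add: powr_mult_base)
    then show ?thesis using assms Beta_real_pos[OF assms(1,2)]
      by (simp add: ennreal_mult'[symmetric] mult.assoc[symmetric])
  qed
  finally show ?thesis .
qed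

lemma borel_measurable_simplex_density:
  assumes "finite I"
  shows "(\<lambda>t. ennreal (if (\<forall>j\<in>I. 0 < t j) \<and> sum t I < T
     then (\<Prod>j\<in>I. t j powr (b j - 1)) * (T - sum t I) powr (c - 1) else 0)) \<in> borel_measurable (PiM I (\<lambda>_. lborel :: real measure))"
  using assms by measurable

text \<open>The size T is general for the induction: fixing one coordinate y leaves a simplex of
  size T - y, and the outer integral over y is a scaled Beta integral. The parameter c belongs to
  the slack T - sum t, which becomes t_0.\<close>

lemma dirichlet_nn_integral:
  fixes b :: "'i \<Rightarrow> real"
  assumes "finite I" "\<And>j. j \<in> I \<Longrightarrow> b j > 0" "c > 0" "T > 0"
  shows "(\<integral>\<^sup>+t. ennreal (if (\<forall>j\<in>I. 0 < t j) \<and> sum t I < T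
     then (\<Prod>j\<in>I. t j powr (b j - 1)) * (T - sum t I) powr (c - 1) else 0) \<partial>PiM I (\<lambda>_. lborel))
    = ennreal (T powr (sum b I + c - 1) * ((\<Prod>j\<in>I. Gamma (b j)) * Gamma c / Gamma (sum b I + c)))"
  using assms
proof (induction I arbitrary: T rule: finite_induct)
  case empty
  have "Gamma c \<noteq> 0" using empty Gamma_real_pos by (metis less_irrefl)
  then show ?case using empty by (simp add: PiM_empty nn_integral_count_space_finite)
next
  case (insert i I)
  interpret product_sigma_finite "\<lambda>_::'i. lborel :: real measure" ..
  let ?d = "\<lambda>I T t. if (\<forall>j\<in>I. 0 < t j) \<and> sum t I < T
     then (\<Prod>j\<in>I. t j powr (b j - 1)) * (T - sum t I) powr (c - 1) else (0::real)"
  let ?B = "sum b I + c"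
  let ?K = "(\<Prod>j\<in>I. Gamma (b j)) * Gamma c / Gamma ?B"
  have B: "?B > 0" using insert by (intro add_nonneg_pos sum_nonneg) (auto intro: less_imp_le)
  have bi: "b i > 0" using insert by simp
  have K: "?K \<ge> 0"
    using insert B by (intro divide_nonneg_nonneg mult_nonneg_nonneg prod_nonneg) (auto intro: less_imp_le Gamma_real_pos)
  have split: "?d (insert i I) T (x(i := y)) = (if 0 < y then y powr (b i - 1) else 0) * ?d I (T - y) x" for x y
  proof -
    have e: "(\<forall>j\<in>I. 0 < (x(i := y)) j) = (\<forall>j\<in>I. 0 < x j)" "sum (x(i := y)) I = sum x I"
      "(\<Prod>j\<in>I. (x(i := y)) j powr (b j - 1)) = (\<Prod>j\<in>I. x j powr (b j - 1))"
      using insert(2) by (auto intro!: sum.cong prod.cong)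
    show ?thesis using insert(1,2) e by (auto simp: algebra_simps)
  qed
  have "(\<integral>\<^sup>+t. ennreal (?d (insert i I) T t) \<partial>PiM (insert i I) (\<lambda>_. lborel)) =
    (\<integral>\<^sup>+y. \<integral>\<^sup>+x. ennreal (?d (insert i I) T (x(i := y))) \<partial>PiM I (\<lambda>_. lborel) \<partial>lborel)"
    using insert(1,2) by (intro product_nn_integral_insert_rev borel_measurable_simplex_density) auto
  also have "\<dots> = (\<integral>\<^sup>+y. ennreal ?K * ennreal (if 0 < y \<and> y < T then y powr (b i - 1) * (T - y) powr (?B - 1) else 0) \<partial>lborel)"
  proof (rule nn_integral_cong)
    fix y :: real
    let ?w = "if 0 < y then y powr (b i - 1) else 0"
    have "(\<integral>\<^sup>+x. ennreal (?d (insert i I) T (x(i := y))) \<partial>PiM I (\<lambda>_. lborel)) =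
       (\<integral>\<^sup>+x. ennreal ?w * ennreal (?d I (T - y) x) \<partial>PiM I (\<lambda>_. lborel))"
      unfolding split by (intro nn_integral_cong ennreal_mult) (auto intro!: mult_nonneg_nonneg prod_nonneg)
    also have "\<dots> = ennreal ?w * (\<integral>\<^sup>+x. ennreal (?d I (T - y) x) \<partial>PiM I (\<lambda>_. lborel))"
      by (rule nn_integral_cmult) (rule borel_measurable_simplex_density[OF insert(1)])
    also have "\<dots> = ennreal ?K * ennreal (if 0 < y \<and> y < T then y powr (b i - 1) * (T - y) powr (?B - 1) else 0)"
    proof (cases "0 < y \<and> y < T")
      case True
      then have "(\<integral>\<^sup>+x. ennreal (?d I (T - y) x) \<partial>PiM I (\<lambda>_. lborel)) = ennreal ((T - y) powr (?B - 1) * ?K)"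
        using insert by (intro insert.IH) auto
      then show ?thesis using True K by (simp add: ennreal_mult[symmetric] mult_ac del: times_divide_eq_right times_divide_eq_left)
    next
      case False
      show ?thesis
      proof (cases "0 < y")
        case True
        \<comment> \<open>Here y >= T, and the remaining simplex is empty.\<close>
        then have "?d I (T - y) x = 0" for x
          using False sum_nonneg[of I x] by (auto intro: less_imp_le) (smt (verit) less_imp_le sum_nonneg)
        then have "(\<integral>\<^sup>+x. ennreal (?d I (T - y) x) \<partial>PiM I (\<lambda>_. lborel)) = 0" by simp
        then show ?thesis by (simp only: False if_False mult_zero_right ennreal_0)
      qed simp
    qed
    finally show "(\<integral>\<^sup>+x. ennreal (?d (insert i I) T (x(i := y))) \<partial>PiM I (\<lambda>_. lborel)) =
       ennreal ?K * ennreal (if 0 < y \<and> y < T then y powr (b i - 1) * (T - y) powr (?B - 1) else 0)" .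
  qed
  also have "\<dots> = ennreal ?K * ennreal (T powr (b i + ?B - 1) * Beta (b i) ?B)"
    unfolding nn_integral_Beta_scaled[OF bi B \<open>T > 0\<close>, symmetric] by (rule nn_integral_cmult) measurable
  also have "\<dots> = ennreal (?K * (T powr (b i + ?B - 1) * Beta (b i) ?B))"
    using K by (rule ennreal_mult'[symmetric])
  also have "?K * (T powr (b i + ?B - 1) * Beta (b i) ?B) = T powr (sum b (insert i I) + c - 1) *
      ((\<Prod>j\<in>insert i I. Gamma (b j)) * Gamma c / Gamma (sum b (insert i I) + c))"
  proof -
    have G: "Gamma ?B \<noteq> 0" using Gamma_real_pos[OF B] by simp
    have s: "sum b (insert i I) + c = b i + ?B" "(\<Prod>j\<in>insert i I. Gamma (b j)) = Gamma (b i) * (\<Prod>j\<in>I. Gamma (b j))"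
      using insert(1,2) by simp_all
    have "P * c' / g * (t * (x * g / y)) = t * (x * P * c' / y)" if "g \<noteq> 0" for P c' g t x y :: real
      using that by simp
    then show ?thesis unfolding s Beta_def using G by blast
  qed
  finally show ?case .
qed

text \<open>Density of the symmetric Dirichlet distribution in the coordinates t_1, ..., t_(k-1).
  Its constant, which makes the total mass 1, is the prefactor of the theorem without the
  1/2.\<close>

definition dir_dens :: "nat \<Rightarrow> real \<Rightarrow> (nat \<Rightarrow> real) \<Rightarrow> real" where
  "dir_dens k a t = Gamma (real k * a) / Gamma a ^ k *
     (indicator (simplex_T k) t * (\<Prod>j<k. ext_t k t j powr (a - 1)))"

definition dir_meas :: "nat \<Rightarrow> real \<Rightarrow> (nat \<Rightarrow> real) measure" where
  "dir_meas k a = density (PiM {1..<k} (\<lambda>_. lborel)) (\<lambda>t. ennreal (dir_dens k a t))"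

lemma indicator_simplex_T:
  "indicator (simplex_T k) t = (if (\<forall>j\<in>{1..<k}. 0 < t j) \<and> sum t {1..<k} < 1 then 1 else (0::real))"
  by (simp add: simplex_T_def indicator_def)

lemma measurable_ext_t: "j < k \<Longrightarrow> (\<lambda>t. ext_t k t j) \<in> borel_measurable (PiM {1..<k} (\<lambda>_. lborel :: real measure))"
proof (cases "j = 0")
  case True
  then show ?thesis unfolding ext_t_def by simp measurable
next
  case False
  assume "j < k"
  then have "j \<in> {1..<k}" using False by auto
  then have "(\<lambda>t. t j) \<in> measurable (PiM {1..<k} (\<lambda>_. lborel :: real measure)) lborel"
    by (rule measurable_component_singleton)
  then show ?thesis using False by (simp add: ext_t_def)
qed

lemma measurable_dir_dens [measurable]: "dir_dens k a \<in> borel_measurable (PiM {1..<k} (\<lambda>_. lborel :: real measure))"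
  unfolding dir_dens_def indicator_simplex_T
proof (intro borel_measurable_times borel_measurable_const borel_measurable_prod)
  fix j assume "j \<in> {..<k}"
  then have [measurable]: "(\<lambda>t. ext_t k t j) \<in> borel_measurable (PiM {1..<k} (\<lambda>_. lborel :: real measure))"
    by (intro measurable_ext_t) simp
  show "(\<lambda>t. ext_t k t j powr (a - 1)) \<in> borel_measurable (PiM {1..<k} (\<lambda>_. lborel :: real measure))"
    by measurable
qed measurable

lemma dir_dens_nonneg: "k > 0 \<Longrightarrow> a > 0 \<Longrightarrow> dir_dens k a t \<ge> 0"
  unfolding dir_dens_def
  by (intro mult_nonneg_nonneg divide_nonneg_nonneg zero_le_power prod_nonneg less_imp_le[OF Gamma_real_pos]) auto

lemma sets_dir_meas [simp, measurable_cong]: "sets (dir_meas k a) = sets (PiM {1..<k} (\<lambda>_. lborel :: real measure))"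
  by (simp add: dir_meas_def)

lemma AE_dir_meas: "AE t in dir_meas k a. t \<in> simplex_T k"
  unfolding dir_meas_def by (subst AE_density) (measurable, auto intro!: AE_I2 simp: dir_dens_def indicator_def)

lemma lessThan_insert_0: "(k::nat) > 0 \<Longrightarrow> {..<k} = insert 0 {1..<k}"
  by auto

lemma prod_ext_t: "k > 0 \<Longrightarrow> (\<Prod>j<k. f j (ext_t k t j)) = f 0 (1 - sum t {1..<k}) * (\<Prod>j\<in>{1..<k}. f j (t j))"
  by (simp add: lessThan_insert_0 ext_t_def)

lemma sum_lessThan_0: "(k::nat) > 0 \<Longrightarrow> (\<Sum>j<k. f j) = f 0 + (\<Sum>j\<in>{1..<k}. f j)"
  by (simp add: lessThan_insert_0)

lemma prod_lessThan_0: "(k::nat) > 0 \<Longrightarrow> (\<Prod>j<k. f j) = f 0 * (\<Prod>j\<in>{1..<k}. f j)"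
  by (simp add: lessThan_insert_0)

lemma sum_ext_t: "k > 0 \<Longrightarrow> (\<Sum>j<k. ext_t k t j) = 1"
  by (simp add: sum_lessThan_0 ext_t_def)

lemma simplex_ext_t_pos: "t \<in> simplex_T k \<Longrightarrow> j < k \<Longrightarrow> ext_t k t j > 0"
  by (auto simp: simplex_T_def ext_t_def)

text \<open>Multiplying the density by powers only shifts its parameters from a to a + n j, so the
  moment is a quotient of two normalising constants.\<close>

lemma dirichlet_moment:
  assumes k: "k > 0" and a: "a > 0"
  shows "has_bochner_integral (dir_meas k a) (\<lambda>t. \<Prod>j<k. ext_t k t j ^ n j)
     ((\<Prod>j<k. pochhammer a (n j)) / pochhammer (real k * a) (\<Sum>j<k. n j))"
proof (rule has_bochner_integral_nn_integral)
  let ?I = "{1..<k}"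
  let ?C = "Gamma (real k * a) / Gamma a ^ k"
  let ?b = "\<lambda>j. a + real (n j)"
  let ?d = "\<lambda>t. if (\<forall>j\<in>?I. 0 < t j) \<and> sum t ?I < 1
     then (\<Prod>j\<in>?I. t j powr (?b j - 1)) * (1 - sum t ?I) powr (?b 0 - 1) else (0::real)"
  have ka: "real k * a > 0" using k a by simp
  have C: "?C \<ge> 0" using Gamma_real_pos[OF ka] Gamma_real_pos[OF a] by simp
  show "(\<lambda>t. \<Prod>j<k. ext_t k t j ^ n j) \<in> borel_measurable (dir_meas k a)"
    unfolding dir_meas_def measurable_cong_sets[OF sets_density refl]
    by (intro borel_measurable_prod borel_measurable_power measurable_ext_t) auto
  show "AE t in dir_meas k a. 0 \<le> (\<Prod>j<k. ext_t k t j ^ n j)"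
    using AE_dir_meas
    by eventually_elim (auto intro!: prod_nonneg zero_le_power less_imp_le[OF simplex_ext_t_pos])
  show "0 \<le> (\<Prod>j<k. pochhammer a (n j)) / pochhammer (real k * a) (\<Sum>j<k. n j)"
    using a ka by (intro divide_nonneg_nonneg prod_nonneg pochhammer_nonneg) auto
  have "(\<integral>\<^sup>+t. ennreal (\<Prod>j<k. ext_t k t j ^ n j) \<partial>dir_meas k a) =
     (\<integral>\<^sup>+t. ennreal (dir_dens k a t) * ennreal (\<Prod>j<k. ext_t k t j ^ n j) \<partial>PiM ?I (\<lambda>_. lborel))"
    unfolding dir_meas_def
    by (intro nn_integral_density measurable_compose[OF _ measurable_ennreal] measurable_dir_dens
        borel_measurable_prod borel_measurable_power measurable_ext_t) auto
  also have "\<dots> = (\<integral>\<^sup>+t. ennreal ?C * ennreal (?d t) \<partial>PiM ?I (\<lambda>_. lborel))"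
  proof (rule nn_integral_cong)
    fix t :: "nat \<Rightarrow> real"
    show "ennreal (dir_dens k a t) * ennreal (\<Prod>j<k. ext_t k t j ^ n j) = ennreal ?C * ennreal (?d t)"
    proof (cases "t \<in> simplex_T k")
      case True
      then have pos: "\<And>j. j < k \<Longrightarrow> ext_t k t j > 0" by (rule simplex_ext_t_pos)
      have "(\<Prod>j<k. ext_t k t j powr (a - 1)) * (\<Prod>j<k. ext_t k t j ^ n j) = (\<Prod>j<k. ext_t k t j powr (?b j - 1))"
        unfolding prod.distrib[symmetric]
      proof (rule prod.cong[OF refl])
        fix j assume "j \<in> {..<k}"
        then have p: "ext_t k t j > 0" using pos by simp
        then have "ext_t k t j powr (a - 1) * ext_t k t j ^ n j = ext_t k t j powr (a - 1) * ext_t k t j powr real (n j)"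
          by (simp add: powr_realpow)
        also have "\<dots> = ext_t k t j powr (?b j - 1)" by (simp add: powr_add[symmetric] algebra_simps)
        finally show "ext_t k t j powr (a - 1) * ext_t k t j ^ n j = ext_t k t j powr (?b j - 1)" .
      qed
      also have "\<dots> = ?d t"
        unfolding prod_ext_t[OF k, where f = "\<lambda>j x. x powr (?b j - 1)"] using True by (simp add: simplex_T_def)
      finally have e: "(\<Prod>j<k. ext_t k t j powr (a - 1)) * (\<Prod>j<k. ext_t k t j ^ n j) = ?d t" .
      have "ennreal (dir_dens k a t) * ennreal (\<Prod>j<k. ext_t k t j ^ n j) = ennreal (dir_dens k a t * (\<Prod>j<k. ext_t k t j ^ n j))"
        by (rule ennreal_mult'[symmetric]) (rule dir_dens_nonneg[OF k a])
      also have "dir_dens k a t * (\<Prod>j<k. ext_t k t j ^ n j) = ?C * ?d t"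
        unfolding dir_dens_def e[symmetric] using True by simp
      finally show ?thesis using C by (simp only: ennreal_mult')
    next
      case False
      then have "?d t = 0" "dir_dens k a t = 0" by (auto simp: simplex_T_def dir_dens_def)
      then show ?thesis by (simp only: ennreal_0 mult_zero_left mult_zero_right)
    qed
  qed
  also have "\<dots> = ennreal ?C * (\<integral>\<^sup>+t. ennreal (?d t) \<partial>PiM ?I (\<lambda>_. lborel))"
    by (rule nn_integral_cmult) (rule borel_measurable_simplex_density, simp)
  also have "(\<integral>\<^sup>+t. ennreal (?d t) \<partial>PiM ?I (\<lambda>_. lborel)) = ennreal (1 powr (sum ?b ?I + ?b 0 - 1) *
      ((\<Prod>j\<in>?I. Gamma (?b j)) * Gamma (?b 0) / Gamma (sum ?b ?I + ?b 0)))"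
    by (rule dirichlet_nn_integral) (use a in auto)
  also have "1 powr (sum ?b ?I + ?b 0 - 1) * ((\<Prod>j\<in>?I. Gamma (?b j)) * Gamma (?b 0) / Gamma (sum ?b ?I + ?b 0))
     = (\<Prod>j<k. Gamma (?b j)) / Gamma (real k * a + real (\<Sum>j<k. n j))"
  proof -
    have s: "sum ?b ?I + ?b 0 = (\<Sum>j<k. ?b j)" unfolding sum_lessThan_0[OF k] by simp
    have "(\<Sum>j<k. ?b j) = real k * a + real (\<Sum>j<k. n j)" by (simp add: sum.distrib)
    then show ?thesis unfolding s prod_lessThan_0[OF k] by (simp add: mult.commute)
  qed
  also have "ennreal ?C * ennreal ((\<Prod>j<k. Gamma (?b j)) / Gamma (real k * a + real (\<Sum>j<k. n j))) =
      ennreal (?C * ((\<Prod>j<k. Gamma (?b j)) / Gamma (real k * a + real (\<Sum>j<k. n j))))"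
    using C by (rule ennreal_mult'[symmetric])
  also have "?C * ((\<Prod>j<k. Gamma (?b j)) / Gamma (real k * a + real (\<Sum>j<k. n j))) =
     (\<Prod>j<k. pochhammer a (n j)) / pochhammer (real k * a) (\<Sum>j<k. n j)"
  proof -
    have ni: "a \<notin> \<int>\<^sub>\<le>\<^sub>0" "real k * a \<notin> \<int>\<^sub>\<le>\<^sub>0" using a ka by (auto elim!: nonpos_Ints_cases)
    have G: "Gamma a \<noteq> 0" "Gamma (real k * a) \<noteq> 0" using Gamma_real_pos[OF a] Gamma_real_pos[OF ka] by auto
    have p: "(\<Prod>j<k. pochhammer a (n j)) = (\<Prod>j<k. Gamma (?b j)) / Gamma a ^ k"
      unfolding pochhammer_Gamma[OF ni(1)] by (simp add: prod_dividef)
    show ?thesis unfolding p pochhammer_Gamma[OF ni(2)] using G by (simp add: divide_simps)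
  qed
  finally show "(\<integral>\<^sup>+t. ennreal (\<Prod>j<k. ext_t k t j ^ n j) \<partial>dir_meas k a) =
     ennreal ((\<Prod>j<k. pochhammer a (n j)) / pochhammer (real k * a) (\<Sum>j<k. n j))" .
qed

lemma prod_fun_upd:
  fixes f :: "'i \<Rightarrow> nat \<Rightarrow> real"
  assumes "finite S" "i \<in> S" "f i (n i) = 1"
  shows "(\<Prod>j\<in>S. f j ((n(i := m)) j)) = f i m * (\<Prod>j\<in>S. f j (n j))"
proof -
  have "(\<Prod>j\<in>S. f j ((n(i := m)) j)) = f i m * (\<Prod>j\<in>S - {i}. f j ((n(i := m)) j))"
    using assms by (subst prod.remove[of S i]) auto
  also have "(\<Prod>j\<in>S - {i}. f j ((n(i := m)) j)) = (\<Prod>j\<in>S - {i}. f j (n j))"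
    by (rule prod.cong) auto
  also have "\<dots> = (\<Prod>j\<in>S. f j (n j))"
    using assms by (simp add: prod.remove[of S i])
  finally show ?thesis .
qed

text \<open>The Dirichlet moments factor except for a denominator depending on the total degree only;
  expanding one exponential at a time keeps this shape, the monomial collecting the factors
  already expanded.\<close>
lemma dirichlet_exp_moment_aux:
  assumes k: "k > 0" and a: "a > 0"
  shows "finite J \<Longrightarrow> J \<subseteq> {..<k} \<Longrightarrow> (\<forall>j\<in>J. n j = 0) \<Longrightarrow>
    has_bochner_integral (dir_meas k a)
      (\<lambda>t. (\<Prod>j<k. ext_t k t j ^ n j) * fps_nth (\<Prod>j\<in>J. fps_exp (ext_t k t j * x j)) N)
      ((\<Prod>j<k. pochhammer a (n j)) / pochhammer (real k * a) ((\<Sum>j<k. n j) + N) * fps_nth (\<Prod>j\<in>J. gfps a (x j)) N)"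
proof (induction J arbitrary: n N rule: finite_induct)
  case empty
  show ?case using dirichlet_moment[OF k a, of n] by (cases "N = 0") (simp_all add: has_bochner_integral_zero)
next
  case (insert i J)
  let ?e = "\<lambda>t. \<Prod>j\<in>J. fps_exp (ext_t k t j * x j)" and ?G = "\<Prod>j\<in>J. gfps a (x j)"
  let ?S = "\<Sum>j<k. n j"
  have i: "i < k" "n i = 0" using insert by auto
  have "has_bochner_integral (dir_meas k a)
      (\<lambda>t. \<Sum>m=0..N. x i ^ m / fact m * ((\<Prod>j<k. ext_t k t j ^ (n(i := m)) j) * fps_nth (?e t) (N - m)))
      (\<Sum>m=0..N. x i ^ m / fact m * ((\<Prod>j<k. pochhammer a ((n(i := m)) j)) /
          pochhammer (real k * a) ((\<Sum>j<k. (n(i := m)) j) + (N - m)) * fps_nth ?G (N - m)))"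
  proof (intro has_bochner_integral_sum has_bochner_integral_mult_right)
    fix m
    show "has_bochner_integral (dir_meas k a)
      (\<lambda>t. (\<Prod>j<k. ext_t k t j ^ (n(i := m)) j) * fps_nth (?e t) (N - m))
      ((\<Prod>j<k. pochhammer a ((n(i := m)) j)) / pochhammer (real k * a) ((\<Sum>j<k. (n(i := m)) j) + (N - m)) * fps_nth ?G (N - m))"
      by (rule insert.IH) (use insert in auto)
  qed
  moreover have "(\<Sum>m=0..N. x i ^ m / fact m * ((\<Prod>j<k. ext_t k t j ^ (n(i := m)) j) * fps_nth (?e t) (N - m))) =
     (\<Prod>j<k. ext_t k t j ^ n j) * fps_nth (\<Prod>j\<in>insert i J. fps_exp (ext_t k t j * x j)) N" for t
  proof -
    have p: "(\<Prod>j<k. ext_t k t j ^ (n(i := m)) j) = ext_t k t i ^ m * (\<Prod>j<k. ext_t k t j ^ n j)" for m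
      using i by (intro prod_fun_upd) auto
    show ?thesis unfolding p using insert(1,2)
      by (simp add: fps_mult_nth sum_distrib_left power_mult_distrib mult_ac)
  qed
  moreover have "(\<Sum>m=0..N. x i ^ m / fact m * ((\<Prod>j<k. pochhammer a ((n(i := m)) j)) /
          pochhammer (real k * a) ((\<Sum>j<k. (n(i := m)) j) + (N - m)) * fps_nth ?G (N - m))) =
     (\<Prod>j<k. pochhammer a (n j)) / pochhammer (real k * a) (?S + N) * fps_nth (\<Prod>j\<in>insert i J. gfps a (x j)) N"
  proof -
    have p: "(\<Prod>j<k. pochhammer a ((n(i := m)) j)) = pochhammer a m * (\<Prod>j<k. pochhammer a (n j))" for m
      using i by (intro prod_fun_upd) auto
    have s: "(\<Sum>j<k. (n(i := m)) j) = m + ?S" for m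
    proof -
      have "(\<Sum>j<k. (n(i := m)) j) = m + (\<Sum>j\<in>{..<k} - {i}. (n(i := m)) j)"
        using i by (subst sum.remove[of _ i]) auto
      also have "(\<Sum>j\<in>{..<k} - {i}. (n(i := m)) j) = (\<Sum>j\<in>{..<k} - {i}. n j)" by (rule sum.cong) auto
      also have "\<dots> = ?S" using i by (simp add: sum.remove[of _ i])
      finally show ?thesis .
    qed
    have idx: "m + ?S + (N - m) = ?S + N" if "m \<le> N" for m using that by simp
    show ?thesis unfolding p s using insert(1,2)
      by (simp add: fps_mult_nth sum_distrib_left gfps_def idx mult_ac)
  qed
  ultimately show ?case by (simp only:)
qed

lemma prod_fps_exp: "finite J \<Longrightarrow> (\<Prod>j\<in>J. fps_exp (c j :: real)) = fps_exp (\<Sum>j\<in>J. c j)"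
  by (induction J rule: finite_induct) (simp_all add: fps_exp_add_mult)

text \<open>With all factors expanded, the product of formal exponentials is the exponential of the
  linear form; its coefficient N is read off.\<close>

lemma dirichlet_exp_moment:
  assumes k: "k > 0" and a: "a > 0"
  shows "has_bochner_integral (dir_meas k a) (\<lambda>t. (\<Sum>j<k. ext_t k t j * x j) ^ N / fact N)
      (fps_nth (\<Prod>j<k. gfps a (x j)) N / pochhammer (real k * a) N)"
  using dirichlet_exp_moment_aux[OF k a, of "{..<k}" "\<lambda>_. 0" x N]
  by (simp add: prod_fps_exp)

text \<open>On a finite measure space a summable sequence of constant bounds dominates the series,
  so integration is termwise. The bound is almost everywhere because both measures live on UNIV-like
  spaces but are concentrated on a bounded set.\<close>

lemma finite_measure_sums:
  fixes f :: "nat \<Rightarrow> 'a \<Rightarrow> real"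
  assumes "finite_measure M" "\<And>N. f N \<in> borel_measurable M"
    and "AE x in M. \<forall>N. \<bar>f N x\<bar> \<le> B N" "summable B"
  shows "integrable M (\<lambda>x. \<Sum>N. f N x)" "(\<lambda>N. \<integral>x. f N x \<partial>M) sums (\<integral>x. (\<Sum>N. f N x) \<partial>M)"
proof -
  interpret finite_measure M by fact
  have int: "integrable M (f N)" for N
    using assms(3) by (intro integrable_const_bound[where B = "B N"] assms(2)) auto
  have 1: "AE x in M. summable (\<lambda>N. norm (f N x))"
    using assms(3) by eventually_elim (intro summable_comparison_test'[OF assms(4), where N = 0], auto)
  have "(\<integral>x. norm (f N x) \<partial>M) \<le> (\<integral>x. B N \<partial>M)" for N
    using assms(3) int by (intro integral_mono_AE) auto
  then have 2: "summable (\<lambda>N. \<integral>x. norm (f N x) \<partial>M)"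
    by (intro summable_comparison_test'[OF summable_mult2[OF assms(4), of "measure M (space M)"], where N = 0])
       (auto simp: mult.commute)
  show "integrable M (\<lambda>x. \<Sum>N. f N x)" by (rule integrable_suminf[OF int 1 2])
  show "(\<lambda>N. \<integral>x. f N x \<partial>M) sums (\<integral>x. (\<Sum>N. f N x) \<partial>M)" by (rule sums_integral[OF int 1 2])
qed

lemma finite_measure_dir_meas:
  assumes k: "k > 0" and a: "a > 0"
  shows "finite_measure (dir_meas k a)"
proof (rule finite_measureI)
  have "has_bochner_integral (dir_meas k a) (\<lambda>t. 1::real) 1"
    using dirichlet_moment[OF k a, of "\<lambda>_. 0"] by simp
  then have "integrable (dir_meas k a) (\<lambda>t. 1::real)" by (rule integrable.intros)
  then show "emeasure (dir_meas k a) (space (dir_meas k a)) \<noteq> \<infinity>"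
    by (simp add: integrable_iff_bounded)
qed

lemma dirichlet_exp_integral:
  assumes k: "k > 0" and a: "a > 0"
  shows "integrable (dir_meas k a) (\<lambda>t. exp (\<Sum>j<k. ext_t k t j * x j))"
    and "(\<lambda>N. fps_nth (\<Prod>j<k. gfps a (x j)) N / pochhammer (real k * a) N) sums
       (\<integral>t. exp (\<Sum>j<k. ext_t k t j * x j) \<partial>dir_meas k a)"
proof -
  let ?f = "\<lambda>N t. (\<Sum>j<k. ext_t k t j * x j) ^ N / fact N" and ?b = "\<Sum>j<k. \<bar>x j\<bar>"
  have m: "?f N \<in> borel_measurable (dir_meas k a)" for N
    using dirichlet_exp_moment[OF k a, of x N] by (auto simp: has_bochner_integral_iff)
  have bnd: "AE t in dir_meas k a. \<forall>N. \<bar>?f N t\<bar> \<le> ?b ^ N / fact N"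
    using AE_dir_meas
  proof eventually_elim
    fix t assume t: "t \<in> simplex_T k"
    have le1: "ext_t k t j \<le> 1" if "j < k" for j
    proof -
      have "ext_t k t j \<le> (\<Sum>j<k. ext_t k t j)"
        using that by (intro member_le_sum) (auto intro: less_imp_le[OF simplex_ext_t_pos[OF t]])
      then show ?thesis by (simp add: sum_ext_t[OF k])
    qed
    have "\<bar>\<Sum>j<k. ext_t k t j * x j\<bar> \<le> (\<Sum>j<k. \<bar>ext_t k t j * x j\<bar>)" by (rule sum_abs)
    also have "\<dots> \<le> ?b"
      using le1 simplex_ext_t_pos[OF t]
      by (intro sum_mono) (simp add: abs_mult mult_left_le_one_le less_imp_le)
    finally have "\<bar>\<Sum>j<k. ext_t k t j * x j\<bar> \<le> ?b" .
    then show "\<forall>N. \<bar>?f N t\<bar> \<le> ?b ^ N / fact N"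
      by (auto simp: power_abs intro!: divide_right_mono power_mono)
  qed
  have e: "(\<Sum>N. ?f N t) = exp (\<Sum>j<k. ext_t k t j * x j)" for t
    by (simp add: exp_def divide_inverse mult.commute)
  have sm: "summable (\<lambda>N. ?b ^ N / fact N)" using summable_exp[of ?b] by (simp add: field_simps)
  note * = finite_measure_sums[OF finite_measure_dir_meas[OF k a] m bnd sm]
  show "integrable (dir_meas k a) (\<lambda>t. exp (\<Sum>j<k. ext_t k t j * x j))" using *(1) unfolding e .
  have "(\<integral>t. ?f N t \<partial>dir_meas k a) = fps_nth (\<Prod>j<k. gfps a (x j)) N / pochhammer (real k * a) N" for N
    using dirichlet_exp_moment[OF k a, of x N] by (simp add: has_bochner_integral_iff)
  then show "(\<lambda>N. fps_nth (\<Prod>j<k. gfps a (x j)) N / pochhammer (real k * a) N) sums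
       (\<integral>t. exp (\<Sum>j<k. ext_t k t j * x j) \<partial>dir_meas k a)" using *(2) unfolding e by simp
qed

section \<open>The integral representation\<close>

lemma kth_root_eq: "kth_root k j c = kth_root k 0 c * cis (2 * pi * real j / real k)"
  by (simp add: kth_root_def cis_conv_exp)

lemma kth_root_0_power:
  assumes "k > 0"
  shows "kth_root k 0 c ^ k = c"
proof (cases "c = 0")
  case False
  have "(c powr (1 / of_nat k)) ^ k = exp (of_nat k * (1 / of_nat k * Ln c))"
    using False by (simp only: powr_def if_False exp_of_nat_mult)
  also have "\<dots> = c" using assms False by simp
  finally show ?thesis by (simp add: kth_root_def)
qed (use assms in \<open>simp add: kth_root_def\<close>)

lemma norm_kth_root_0: "k > 0 \<Longrightarrow> norm (kth_root k 0 c) = root k (norm c)"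
  using kth_root_0_power[of k c] real_root_power_cancel[of k "norm (kth_root k 0 c)"]
  by (metis norm_ge_zero norm_power)

text \<open>A product over all roots is insensitive to their order; here the orderings p and q
  disappear.\<close>

lemma prod_kth_root:
  assumes "k > 0" "p permutes {..<k}"
  shows "(\<Prod>j<k. gfps a (Re (kth_root k (p j) c))) = root_prod k a (kth_root k 0 c)"
proof -
  have "(\<Prod>j<k. gfps a (Re (kth_root k (p j) c))) = (\<Prod>j<k. gfps a (Re (kth_root k j c)))"
    using prod.permute[OF assms(2), of "\<lambda>j. gfps a (Re (kth_root k j c))"] by (simp add: o_def)
  also have "\<dots> = (\<Prod>j<k. gfps a (Re (kth_root k 0 c * cis (2 * pi * real j / real k))))"
    by (subst kth_root_eq) (rule refl)
  also have "\<dots> = root_prod k a (kth_root k 0 c)"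
    unfolding root_prod_def by (rule prod.reindex_bij_betw[OF roots_of_unity_bij[OF assms(1)]])
  finally show ?thesis .
qed

text \<open>Here q is the squared modulus of any k-th root of c.\<close>

definition dir_root :: "nat \<Rightarrow> real \<Rightarrow> nat \<Rightarrow> complex \<Rightarrow> real" where
  "dir_root k a N c = dir_avg k a N ((root k (norm c))\<^sup>2) c"

lemma dir_root_eq: "k > 0 \<Longrightarrow> dir_root k a N c = dir_avg k a N (kth_root k 0 c \<bullet> kth_root k 0 c) (kth_root k 0 c ^ k)"
  by (simp add: dir_root_def dot_square_norm norm_kth_root_0 kth_root_0_power)

lemma dir_root_sums:
  assumes "k > 0" "a > 0" "p permutes {..<k}"
  shows "(\<lambda>N. dir_root k a N c) sums (\<integral>t. exp (\<Sum>j<k. ext_t k t j * Re (kth_root k (p j) c)) \<partial>dir_meas k a)"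
  using dirichlet_exp_integral(2)[OF assms(1,2), of "\<lambda>j. Re (kth_root k (p j) c)"]
  unfolding prod_kth_root[OF assms(1,3)] dir_root_eq[OF assms(1)] dir_avg_eq_root_prod[OF assms(1,2)] .

lemma abs_dir_root_le:
  assumes k: "k > 0" and a: "a > 0"
  shows "\<bar>dir_root k a N c\<bar> \<le> (4 * root k (norm c)) ^ N / fact N"
proof -
  interpret dihedral k a 0 using assms by unfold_locales auto
  let ?\<zeta> = "kth_root k 0 c"
  have "real k * \<bar>dir_root k a N c\<bar> = \<bar>\<Sum>i<k. E N (?\<zeta> * \<omega> (2 * i)) 1\<bar>"
    unfolding dir_root_eq[OF k] dir_avg_eq_sum[OF k a, symmetric] by (simp add: abs_mult)
  also have "\<dots> \<le> (\<Sum>i<k. \<bar>E N (?\<zeta> * \<omega> (2 * i)) 1\<bar>)" by (rule sum_abs)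
  also have "\<dots> \<le> (\<Sum>i<k. 4 ^ N / fact N * norm ?\<zeta> ^ N)"
  proof (rule sum_mono)
    fix i
    show "\<bar>E N (?\<zeta> * \<omega> (2 * i)) 1\<bar> \<le> 4 ^ N / fact N * norm ?\<zeta> ^ N"
      using abs_hom_kernel_le[of N "?\<zeta> * \<omega> (2 * i)" 1] by (simp add: norm_mult)
  qed
  finally have "real k * \<bar>dir_root k a N c\<bar> \<le> real k * ((4 * root k (norm c)) ^ N / fact N)"
    by (simp add: norm_kth_root_0[OF k] power_mult_distrib)
  then show ?thesis using k by (simp only: mult_le_cancel_left_pos of_nat_0_less_iff)
qed

text \<open>The branch cut of \<open>kth_root\<close> causes no jump: the average is polynomial in q
  and in the real and imaginary parts of c, and q is continuous in c.\<close>

lemma continuous_on_dir_root: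
  assumes "k > 0" "continuous_on S f"
  shows "continuous_on S (\<lambda>x. dir_root k a N (f x))"
proof -
  have h: "continuous_on S (\<lambda>x. if b then t * hterm 1 a 0 m (f x) 1 else 0)" for b t m
    using assms(2) by (cases b) (auto intro!: continuous_intros)
  show ?thesis
    unfolding dir_root_def dir_avg_def by (intro continuous_intros assms h)
qed

section \<open>The complex number R + i D\<close>

lemma R_val_eq: "R_val k u v z w = v * (Re (z ^ k) * Re (w ^ k)) + u * (Im (z ^ k) * Im (w ^ k))"
  by (simp add: R_val_def del: complex_cnj_power)

lemma D_val_eq: "D_val k u v z w = sqrt ((norm (z ^ k * w ^ k))\<^sup>2 - (R_val k u v z w)\<^sup>2)"
  by (simp add: D_val_def norm_mult norm_power power_mult_distrib mult.commute[of 2] power_mult flip: power_mult_distrib)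

lemma abs_bilinear_le:
  fixes c d :: complex
  assumes "\<bar>u\<bar> \<le> 1" "\<bar>v\<bar> \<le> 1"
  shows "\<bar>v * (Re c * Re d) + u * (Im c * Im d)\<bar> \<le> norm (c * d)"
proof -
  have "\<bar>v * (Re c * Re d) + u * (Im c * Im d)\<bar> \<le> \<bar>v\<bar> * (\<bar>Re c\<bar> * \<bar>Re d\<bar>) + \<bar>u\<bar> * (\<bar>Im c\<bar> * \<bar>Im d\<bar>)"
    by (rule order_trans[OF abs_triangle_ineq]) (simp add: abs_mult)
  also have "\<dots> \<le> 1 * (\<bar>Re c\<bar> * \<bar>Re d\<bar>) + 1 * (\<bar>Im c\<bar> * \<bar>Im d\<bar>)"
    using assms by (intro add_mono mult_right_mono) auto
  also have "\<dots> = Complex \<bar>Re c\<bar> \<bar>Im c\<bar> \<bullet> Complex \<bar>Re d\<bar> \<bar>Im d\<bar>" by (simp add: inner_complex_def)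
  also have "\<dots> \<le> norm (Complex \<bar>Re c\<bar> \<bar>Im c\<bar>) * norm (Complex \<bar>Re d\<bar> \<bar>Im d\<bar>)" by (rule norm_cauchy_schwarz)
  also have "\<dots> = norm c * norm d" by (simp add: cmod_def)
  also have "\<dots> = norm (c * d)" by (rule norm_mult[symmetric])
  finally show ?thesis .
qed

text \<open>The pair is (v, u), in the order of the iterated integral, so that the outer variable
  comes first.\<close>

definition cval :: "complex \<Rightarrow> complex \<Rightarrow> real \<times> real \<Rightarrow> complex" where
  "cval c d x = (let R = fst x * (Re c * Re d) + snd x * (Im c * Im d)
     in Complex R (sqrt ((norm (c * d))\<^sup>2 - R\<^sup>2)))"

text \<open>True on the whole plane because the real \<open>sqrt\<close> is continuous at negative
  arguments too; these occur only off the square where the measures live.\<close>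

lemma continuous_on_cval: "continuous_on UNIV (cval c d)"
  unfolding cval_def Let_def Complex_eq by (intro continuous_intros)

text \<open>The second radicand is the mirror image of the first in the imaginary axis, so both have
  the same modulus.\<close>

lemma Complex_val_eq_cval:
  "Complex (R_val k u v z w) (D_val k u v z w) = cval (z ^ k) (w ^ k) (v, u)"
  "Complex (- R_val k u v z w) (D_val k u v z w) = - cnj (cval (z ^ k) (w ^ k) (v, u))"
  by (simp_all add: cval_def Let_def D_val_eq R_val_eq complex_eq_iff)

text \<open>By Cauchy-Schwarz |R| is at most |c d|, so D is a genuine square root and the modulus
  does not depend on the point of the square.\<close>

lemma norm_cval:
  assumes "fst x \<in> {-1..1}" "snd x \<in> {-1..1}"
  shows "norm (cval c d x) = norm (c * d)"
proof -
  let ?R = "fst x * (Re c * Re d) + snd x * (Im c * Im d)"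
  have "\<bar>?R\<bar> \<le> norm (c * d)" using assms by (intro abs_bilinear_le) auto
  then have "?R\<^sup>2 \<le> (norm (c * d))\<^sup>2" by (metis abs_ge_zero power2_abs power_mono)
  then show ?thesis by (simp add: cval_def Let_def complex_norm)
qed

lemma root_norm_cval:
  assumes "k > 0" "fst x \<in> {-1..1}" "snd x \<in> {-1..1}"
  shows "root k (norm (cval (z ^ k) (w ^ k) x)) = norm z * norm w"
  unfolding norm_cval[OF assms(2,3)] using assms(1)
  by (simp add: norm_mult norm_power real_root_power_cancel flip: power_mult_distrib)

definition nu_pair :: "real \<Rightarrow> real \<Rightarrow> (real \<times> real) measure" where
  "nu_pair \<alpha> \<beta> = nu_meas \<beta> \<Otimes>\<^sub>M nu_meas \<alpha>"

text \<open>c -> -cnj c is the reflection j = 1 of the group for k = 1, which conjugates the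
  polynomial up to (-1)^m. At w = 1 the coefficient is real, because 1 is fixed by conjugation, so
  conjugating does not change the real part.\<close>

lemma hterm_minus_cnj:
  assumes "a > 0"
  shows "hterm 1 a 0 m (- cnj c) 1 = (-1) ^ m * hterm 1 a 0 m c 1"
proof -
  interpret dihedral 1 a 0 using assms by unfold_locales auto
  have "cnj (A m 1) = A m 1" using hcoef_refl[of m 1 0] by simp
  then have r: "A m 1 = of_real (Re (A m 1))" by (metis complex_cnj_cancel_iff Reals_cnj_iff of_real_Re)
  have "\<phi> m (- cnj c) = (-1) ^ m * cnj (\<phi> m c)" using harm_refl[of m c 1] by simp
  then have "hterm 1 a 0 m (- cnj c) 1 = 2 * Re (of_real (Re (A m 1)) * (of_real ((-1) ^ m) * cnj (\<phi> m c)))"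
    using r by (simp add: hterm_def)
  also have "\<dots> = (-1) ^ m * (2 * Re (of_real (Re (A m 1)) * \<phi> m c))"
    by (simp only: Re_complex_of_real times_complex.sel Im_complex_of_real complex_cnj) simp
  also have "\<dots> = (-1) ^ m * hterm 1 a 0 m c 1" using r by (metis hterm_def)
  finally show ?thesis .
qed

lemma binomial_fact_expansion:
  fixes x y :: real
  shows "(x + y) ^ N / fact N = (\<Sum>i\<le>N. (x ^ i / fact i) * (y ^ (N - i) / fact (N - i)))"
proof -
  have "real (N choose i) * x ^ i * y ^ (N - i) / fact N = (x ^ i / fact i) * (y ^ (N - i) / fact (N - i))" if "i \<le> N" for i
    using that by (simp add: binomial_fact field_simps)
  then show ?thesis unfolding binomial_ring sum_divide_distrib by (intro sum.cong) auto
qed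

locale nu_params =
  fixes \<alpha> \<beta> :: real assumes alpha_pos: "\<alpha> > 0" and beta_pos: "\<beta> > 0"
begin

abbreviation P where "P \<equiv> nu_pair \<alpha> \<beta>"

sublocale nu: pair_sigma_finite "nu_meas \<beta>" "nu_meas \<alpha>"
proof -
  interpret b: finite_measure "nu_meas \<beta>" by (rule finite_measure_nu_meas[OF beta_pos])
  interpret a: finite_measure "nu_meas \<alpha>" by (rule finite_measure_nu_meas[OF alpha_pos])
  show "pair_sigma_finite (nu_meas \<beta>) (nu_meas \<alpha>)" ..
qed

lemma finite_measure_P: "finite_measure P"
  unfolding nu_pair_def
  by (rule finite_measure_pair_measure[OF finite_measure_nu_meas[OF alpha_pos] finite_measure_nu_meas[OF beta_pos]])

lemma sets_P: "sets P = sets borel"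
  unfolding nu_pair_def by (metis borel_prod sets_nu_meas sets_pair_measure_cong)

lemma measurable_P_continuous: "continuous_on UNIV f \<Longrightarrow> f \<in> borel_measurable P"
  for f :: "real \<times> real \<Rightarrow> real"
  using borel_measurable_continuous_onI[of f] measurable_cong_sets[OF sets_P refl] by blast

lemma AE_P: "AE x in P. fst x \<in> {-1..1} \<and> snd x \<in> {-1..1}"
  unfolding nu_pair_def
proof (rule nu.AE_pair_measure)
  have "closed {x :: real \<times> real. fst x \<in> {-1..1} \<and> snd x \<in> {-1..1}}"
    unfolding atLeastAtMost_iff by (intro closed_Collect_conj closed_Collect_le continuous_intros)
  then show "{x \<in> space (nu_meas \<beta> \<Otimes>\<^sub>M nu_meas \<alpha>). fst x \<in> {-1..1} \<and> snd x \<in> {-1..1}} \<in> sets (nu_meas \<beta> \<Otimes>\<^sub>M nu_meas \<alpha>)"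
    using sets_P unfolding nu_pair_def by (simp add: space_pair_measure borel_closed)
  show "AE x in nu_meas \<beta>. AE y in nu_meas \<alpha>. fst (x, y) \<in> {-1..1} \<and> snd (x, y) \<in> {-1..1}"
    using AE_nu_meas[of \<beta>]
  proof eventually_elim
    fix x :: real assume "x \<in> {-1..1}"
    then show "AE y in nu_meas \<alpha>. fst (x, y) \<in> {-1..1} \<and> snd (x, y) \<in> {-1..1}"
      using AE_nu_meas[of \<alpha>] by simp
  qed
qed

lemma integrable_P:
  fixes f :: "real \<times> real \<Rightarrow> real"
  assumes "continuous_on UNIV f"
  shows "integrable P f"
proof -
  interpret finite_measure P by (rule finite_measure_P)
  let ?K = "{-1..1} \<times> {-1..1} :: (real \<times> real) set"
  have "compact (f ` ?K)"
    by (intro compact_continuous_image continuous_on_subset[OF assms] compact_Times) auto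
  then obtain B where B: "\<And>x. x \<in> ?K \<Longrightarrow> norm (f x) \<le> B"
    using compact_imp_bounded bounded_iff by (metis imageI)
  have "AE x in P. norm (f x) \<le> B"
    using AE_P by eventually_elim (rule B, simp add: mem_Times_iff)
  then show ?thesis by (rule integrable_const_bound) (rule measurable_P_continuous[OF assms])
qed

lemma P_moment:
  "(\<integral>x. fst x ^ i * snd x ^ j \<partial>P) = (if even i then fact i * rcoef \<beta> i else 0) * (if even j then fact j * rcoef \<alpha> j else 0)"
proof -
  have "(\<integral>x. fst x ^ i * snd x ^ j \<partial>P) = (\<integral>v. \<integral>u. v ^ i * u ^ j \<partial>nu_meas \<alpha> \<partial>nu_meas \<beta>)"
    using nu.integral_fst'[of "\<lambda>x. fst x ^ i * snd x ^ j"] integrable_P[of "\<lambda>x. fst x ^ i * snd x ^ j"]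
    by (simp add: nu_pair_def continuous_intros)
  then show ?thesis by (simp add: nu_meas_moment[OF alpha_pos] nu_meas_moment[OF beta_pos])
qed

text \<open>The average kernel for k = 1 is the double integral of exp R, in degree N: the odd
  moments vanish and the even ones are the coefficients in \<open>hom_bessel_1\<close>.\<close>

lemma R_moment:
  "(\<integral>x. (fst x * (Re c * Re d) + snd x * (Im c * Im d)) ^ N / fact N \<partial>P) = hom_bessel 1 \<alpha> \<beta> N c d"
proof -
  let ?X = "Re c * Re d" and ?Y = "Im c * Im d"
  have "(\<integral>x. (fst x * ?X + snd x * ?Y) ^ N / fact N \<partial>P) =
    (\<integral>x. (\<Sum>i\<le>N. (?X ^ i * ?Y ^ (N - i) / (fact i * fact (N - i))) * (fst x ^ i * snd x ^ (N - i))) \<partial>P)"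
    unfolding binomial_fact_expansion by (simp add: power_mult_distrib mult_ac)
  also have "\<dots> = (\<Sum>i\<le>N. (?X ^ i * ?Y ^ (N - i) / (fact i * fact (N - i))) * (\<integral>x. fst x ^ i * snd x ^ (N - i) \<partial>P))"
    by (subst Bochner_Integration.integral_sum) (auto intro!: integrable_mult_right integrable_P continuous_intros)
  also have "\<dots> = hom_bessel 1 \<alpha> \<beta> N c d"
    unfolding P_moment hom_bessel_1[OF less_imp_le[OF alpha_pos] less_imp_le[OF beta_pos] add_pos_pos[OF alpha_pos beta_pos]]
    by (rule sum.cong) (auto simp: field_simps)
  finally show ?thesis .
qed

text \<open>Both members of \<open>R_moment\<close> are sums over j with the same coefficients, once
  exp R is expanded as a kernel with multiplicity (alpha + beta, 0) at \<open>cval\<close>. The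
  terms of lower degree agree by induction; subtracting them leaves j = 0, whose coefficient is 1.
  The parity of N - 2 j is that of N.\<close>

lemma havg_eq_integral:
  "even m \<Longrightarrow> havg 1 \<alpha> \<beta> m c d = (\<integral>x. hterm 1 (\<alpha> + \<beta>) 0 m (cval c d x) 1 \<partial>P)"
proof (induction m rule: less_induct)
  case (less N)
  let ?a = "\<alpha> + \<beta>" and ?q = "(c \<bullet> c) * (d \<bullet> d)"
  let ?\<theta> = "\<lambda>j. bessel_coef (real 1 * ?a) j (N - 2 * j) * ?q ^ j"
  let ?H = "\<lambda>n. \<integral>x. hterm 1 ?a 0 n (cval c d x) 1 \<partial>P"
  have a: "?a > 0" using alpha_pos beta_pos by simp
  have cont: "continuous_on UNIV (\<lambda>x. hterm 1 ?a 0 n (cval c d x) 1)" for n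
    by (intro continuous_intros continuous_on_cval)
  have "hom_bessel 1 \<alpha> \<beta> N c d = (\<integral>x. (fst x * (Re c * Re d) + snd x * (Im c * Im d)) ^ N / fact N \<partial>P)"
    by (rule R_moment[symmetric])
  \<comment> \<open>The bilinear form R is the real part of \<open>cval c d x\<close>.\<close>
  also have "\<dots> = (\<integral>x. hom_kernel 1 ?a 0 N (cval c d x) 1 \<partial>P)"
    unfolding hom_kernel_1_real[OF a] by (simp add: cval_def Let_def)
  also have "\<dots> = (\<integral>x. (\<Sum>j\<le>N div 2. ?\<theta> j * hterm 1 ?a 0 (N - 2 * j) (cval c d x) 1) \<partial>P)"
  proof (rule integral_cong_AE)
    show "(\<lambda>x. hom_kernel 1 ?a 0 N (cval c d x) 1) \<in> borel_measurable P"
      unfolding hom_kernel_def by (intro measurable_P_continuous continuous_intros continuous_on_cval)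
    show "(\<lambda>x. \<Sum>j\<le>N div 2. ?\<theta> j * hterm 1 ?a 0 (N - 2 * j) (cval c d x) 1) \<in> borel_measurable P"
      by (intro measurable_P_continuous continuous_intros cont)
    show "AE x in P. hom_kernel 1 ?a 0 N (cval c d x) 1 = (\<Sum>j\<le>N div 2. ?\<theta> j * hterm 1 ?a 0 (N - 2 * j) (cval c d x) 1)"
      using AE_P
    proof eventually_elim
      fix x :: "real \<times> real" assume "fst x \<in> {-1..1} \<and> snd x \<in> {-1..1}"
      then have "norm (cval c d x) = norm (c * d)" by (intro norm_cval) auto
      then have "cval c d x \<bullet> cval c d x = ?q"
        by (simp add: dot_square_norm norm_mult power_mult_distrib)
      then show "hom_kernel 1 ?a 0 N (cval c d x) 1 = (\<Sum>j\<le>N div 2. ?\<theta> j * hterm 1 ?a 0 (N - 2 * j) (cval c d x) 1)"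
        by (simp add: hom_kernel_def dot_square_norm[of "1::complex"])
    qed
  qed
  also have "\<dots> = (\<Sum>j\<le>N div 2. ?\<theta> j * ?H (N - 2 * j))"
    using integrable_P[OF cont] by (subst Bochner_Integration.integral_sum) (simp_all only: integrable_mult_right integral_mult_right_zero)
  finally have "(\<Sum>j\<le>N div 2. ?\<theta> j * havg 1 \<alpha> \<beta> (N - 2 * j) c d) = (\<Sum>j\<le>N div 2. ?\<theta> j * ?H (N - 2 * j))"
    unfolding hom_bessel_def .
  moreover have "(\<Sum>j\<in>{..N div 2} - {0}. ?\<theta> j * havg 1 \<alpha> \<beta> (N - 2 * j) c d) = (\<Sum>j\<in>{..N div 2} - {0}. ?\<theta> j * ?H (N - 2 * j))"
  proof (rule sum.cong[OF refl])
    fix j assume "j \<in> {..N div 2} - {0}"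
    then have "N - 2 * j < N" "even (N - 2 * j)" using less.prems by auto
    then show "?\<theta> j * havg 1 \<alpha> \<beta> (N - 2 * j) c d = ?\<theta> j * ?H (N - 2 * j)" using less.IH by simp
  qed
  ultimately show ?case by (simp add: sum.remove[of "{..N div 2}" 0])
qed

text \<open>The weights \<open>tweight\<close> and the Bessel coefficients for k are common to both
  sides, so \<open>havg_eq_integral\<close> can be inserted term by term.\<close>

lemma integral_dir_avg_pair:
  assumes k: "k > 0"
  shows "(\<integral>x. dir_root k (\<alpha> + \<beta>) N (cval (z ^ k) (w ^ k) x) + dir_root k (\<alpha> + \<beta>) N (- cnj (cval (z ^ k) (w ^ k) x)) \<partial>P)
     = 2 * hom_bessel k \<alpha> \<beta> N z w"
proof -
  interpret dihedral k \<alpha> \<beta> using k alpha_pos beta_pos by unfold_locales auto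
  let ?a = "\<alpha> + \<beta>" and ?c = "cval (z ^ k) (w ^ k)" and ?q = "(z \<bullet> z) * (w \<bullet> w)"
  let ?\<theta> = "\<lambda>j. bessel_coef (real k * ?a) j (N - 2 * j) * ?q ^ j"
  let ?h = "\<lambda>m x. hterm 1 ?a 0 m (?c x) 1"
  \<comment> \<open>The factor 1 + (-1)^m is 2 or 0 and records the sum of the two exponentials. For
    k not dividing N - 2 j the weight is 0, so the rounded quotient \<open>?m j\<close> does not
    matter.\<close>
  let ?W = "\<lambda>j. if k dvd N - 2 * j then tweight k ?a ((N - 2 * j) div k) * (1 + (-1) ^ ((N - 2 * j) div k)) else 0"
  let ?m = "\<lambda>j. (N - 2 * j) div k"
  have a: "?a > 0" using alpha_pos beta_pos by simp
  have cont: "continuous_on UNIV (?h m)" for m by (intro continuous_intros continuous_on_cval)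
  have "(\<integral>x. dir_root k ?a N (?c x) + dir_root k ?a N (- cnj (?c x)) \<partial>P) =
      (\<integral>x. (\<Sum>j\<le>N div 2. (?\<theta> j * ?W j) * ?h (?m j) x) \<partial>P)"
  proof (rule integral_cong_AE)
    show "(\<lambda>x. dir_root k ?a N (?c x) + dir_root k ?a N (- cnj (?c x))) \<in> borel_measurable P"
      by (intro measurable_P_continuous continuous_intros continuous_on_dir_root[OF k] continuous_on_cval)
    show "(\<lambda>x. \<Sum>j\<le>N div 2. (?\<theta> j * ?W j) * ?h (?m j) x) \<in> borel_measurable P"
      by (intro measurable_P_continuous continuous_on_sum continuous_on_mult continuous_on_const cont)
    show "AE x in P. dir_root k ?a N (?c x) + dir_root k ?a N (- cnj (?c x)) = (\<Sum>j\<le>N div 2. (?\<theta> j * ?W j) * ?h (?m j) x)"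
      using AE_P
    proof eventually_elim
      fix x :: "real \<times> real" assume "fst x \<in> {-1..1} \<and> snd x \<in> {-1..1}"
      then have "root k (norm (?c x)) = norm z * norm w" using k by (intro root_norm_cval) auto
      then have q: "(root k (norm (?c x)))\<^sup>2 = ?q" by (simp add: dot_square_norm power_mult_distrib)
      have "dir_root k ?a N (?c x) + dir_root k ?a N (- cnj (?c x)) =
        (\<Sum>j\<le>N div 2. ?\<theta> j * (if k dvd N - 2 * j then tweight k ?a (?m j) * ?h (?m j) x else 0) +
           ?\<theta> j * (if k dvd N - 2 * j then tweight k ?a (?m j) * ((-1) ^ ?m j * ?h (?m j) x) else 0))"
        unfolding dir_root_def dir_avg_def norm_minus_cancel complex_mod_cnj q hterm_minus_cnj[OF a] sum.distrib ..
      also have "\<dots> = (\<Sum>j\<le>N div 2. (?\<theta> j * ?W j) * ?h (?m j) x)"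
        by (rule sum.cong) (auto simp: algebra_simps)
      finally show "dir_root k ?a N (?c x) + dir_root k ?a N (- cnj (?c x)) = (\<Sum>j\<le>N div 2. (?\<theta> j * ?W j) * ?h (?m j) x)" .
    qed
  qed
  also have "\<dots> = (\<Sum>j\<le>N div 2. (?\<theta> j * ?W j) * (\<integral>x. ?h (?m j) x \<partial>P))"
    using integrable_P[OF cont] by (subst Bochner_Integration.integral_sum) (simp_all only: integrable_mult_right integral_mult_right_zero)
  also have "\<dots> = (\<Sum>j\<le>N div 2. 2 * (?\<theta> j * havg k \<alpha> \<beta> (N - 2 * j) z w))"
  proof (rule sum.cong[OF refl])
    fix j
    show "(?\<theta> j * ?W j) * (\<integral>x. ?h (?m j) x \<partial>P) = 2 * (?\<theta> j * havg k \<alpha> \<beta> (N - 2 * j) z w)"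
    proof (cases "even (?m j)")
      case True
      then show ?thesis unfolding havg_mult[of "N - 2 * j"] havg_eq_integral[OF True] by simp
    next
      case False
      then have "havg 1 \<alpha> \<beta> (?m j) (z ^ k) (w ^ k) = 0" by (simp add: havg_def)
      then show ?thesis unfolding havg_mult[of "N - 2 * j"] using False by simp
    qed
  qed
  finally show ?thesis by (simp only: hom_bessel_def sum_distrib_left)
qed

end

theorem mainTheorem10:
  fixes k :: nat and \<alpha> \<beta> :: real and z w :: complex and p q :: "nat \<Rightarrow> nat"
  assumes "k \<ge> 2" and "\<alpha> > 0" and "\<beta> > 0"
    and "p permutes {..<k}" and "q permutes {..<k}"
  shows "gen_bessel k \<alpha> \<beta> z w =
    Gamma (real k * (\<alpha> + \<beta>)) / (2 * Gamma (\<alpha> + \<beta>) ^ k) *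
    (\<integral>v. (\<integral>u. (\<integral>t. indicator (simplex_T k) t *
        (h_fun k p q u v (ext_t k t) z w *
         (\<Prod>j<k. ext_t k t j powr (\<alpha> + \<beta> - 1)))
      \<partial>(PiM {1..<k} (\<lambda>_. lborel))) \<partial>(nu_meas \<alpha>)) \<partial>(nu_meas \<beta>))"
proof -
  have k: "k > 0" using assms(1) by simp
  interpret dihedral k \<alpha> \<beta> using assms(2,3) k by unfold_locales auto
  interpret nu_params \<alpha> \<beta> using assms(2,3) by unfold_locales
  let ?a = "\<alpha> + \<beta>"
  \<comment> \<open>The prefactor without 1/2: it turns the powers of the t_j into the density
    \<open>dir_dens\<close>.\<close>
  let ?C = "Gamma (real k * ?a) / Gamma ?a ^ k"
  let ?c = "cval (z ^ k) (w ^ k)"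
  \<comment> \<open>The part of degree N of the normalised simplex integral.\<close>
  define Q where "Q N x = dir_root k ?a N (?c x) + dir_root k ?a N (- cnj (?c x))" for N x
  let ?T = "\<lambda>u v. \<integral>t. indicator (simplex_T k) t *
        (h_fun k p q u v (ext_t k t) z w * (\<Prod>j<k. ext_t k t j powr (?a - 1))) \<partial>(PiM {1..<k} (\<lambda>_. lborel))"
  have a: "?a > 0" using assms(2,3) by simp
  \<comment> \<open>valid for all real \<open>u\<close>, \<open>v\<close>, so no measurability of the inner integral is needed\<close>
  have inner: "?C * ?T u v = (\<Sum>N. Q N (v, u))" for u v
  proof -
    let ?e1 = "\<lambda>t. exp (\<Sum>j<k. ext_t k t j * Re (kth_root k (p j) (?c (v, u))))"
    let ?e2 = "\<lambda>t. exp (\<Sum>j<k. ext_t k t j * Re (kth_root k (q j) (- cnj (?c (v, u)))))"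
    note i1 = dirichlet_exp_integral(1)[OF k a, of "\<lambda>j. Re (kth_root k (p j) (?c (v, u)))"]
    note i2 = dirichlet_exp_integral(1)[OF k a, of "\<lambda>j. Re (kth_root k (q j) (- cnj (?c (v, u))))"]
    have h: "h_fun k p q u v (ext_t k t) z w = ?e1 t + ?e2 t" for t
      unfolding h_fun_def Complex_val_eq_cval ..
    have m: "(\<lambda>t. ?e1 t + ?e2 t) \<in> borel_measurable (PiM {1..<k} (\<lambda>_. lborel))"
      using borel_measurable_integrable[OF Bochner_Integration.integrable_add[OF i1 i2]]
      by (simp add: dir_meas_def)
    have "?C * ?T u v = (\<integral>t. dir_dens k ?a t *\<^sub>R (?e1 t + ?e2 t) \<partial>PiM {1..<k} (\<lambda>_. lborel))"
      unfolding h integral_mult_right_zero[symmetric]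
      by (rule Bochner_Integration.integral_cong) (simp_all add: dir_dens_def mult_ac)
    also have "\<dots> = (\<integral>t. ?e1 t + ?e2 t \<partial>dir_meas k ?a)"
      unfolding dir_meas_def
      by (rule integral_density[OF m measurable_dir_dens, symmetric]) (simp add: dir_dens_nonneg[OF k a])
    also have "\<dots> = (\<integral>t. ?e1 t \<partial>dir_meas k ?a) + (\<integral>t. ?e2 t \<partial>dir_meas k ?a)"
      by (rule Bochner_Integration.integral_add[OF i1 i2])
    finally have eq: "?C * ?T u v = (\<integral>t. ?e1 t \<partial>dir_meas k ?a) + (\<integral>t. ?e2 t \<partial>dir_meas k ?a)" .
    have "(\<lambda>N. Q N (v, u)) sums (?C * ?T u v)"
      unfolding Q_def eq
      by (intro sums_add dir_root_sums[OF k a assms(4)] dir_root_sums[OF k a assms(5)])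
    then show ?thesis by (rule sums_unique)
  qed
  have mQ: "Q N \<in> borel_measurable P" for N
    unfolding Q_def
    by (intro measurable_P_continuous continuous_intros continuous_on_dir_root[OF k] continuous_on_cval)
  let ?B = "\<lambda>N. 2 * ((4 * (norm z * norm w)) ^ N / fact N)"
  have bQ: "AE x in P. \<forall>N. \<bar>Q N x\<bar> \<le> ?B N"
    using AE_P
  proof eventually_elim
    fix x :: "real \<times> real" assume "fst x \<in> {-1..1} \<and> snd x \<in> {-1..1}"
    then have r: "root k (norm (?c x)) = norm z * norm w" using k by (intro root_norm_cval) auto
    show "\<forall>N. \<bar>Q N x\<bar> \<le> ?B N"
    proof
      fix N
      have "\<bar>Q N x\<bar> \<le> \<bar>dir_root k ?a N (?c x)\<bar> + \<bar>dir_root k ?a N (- cnj (?c x))\<bar>"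
        unfolding Q_def by (rule abs_triangle_ineq)
      also have "\<dots> \<le> (4 * root k (norm (?c x))) ^ N / fact N + (4 * root k (norm (- cnj (?c x)))) ^ N / fact N"
        by (intro add_mono abs_dir_root_le[OF k a])
      finally show "\<bar>Q N x\<bar> \<le> ?B N" by (simp add: r)
    qed
  qed
  have sB: "summable ?B" by (intro summable_mult summable_exp_terms)
  note S = finite_measure_sums[OF finite_measure_P mQ bQ sB]
  \<comment> \<open>The 1/2 compensates the 2 in \<open>integral_dir_avg_pair\<close>.\<close>
  have "(\<lambda>N. (1/2) * (\<integral>x. Q N x \<partial>P)) sums ((1/2) * (\<integral>x. (\<Sum>N. Q N x) \<partial>P))"
    by (intro sums_mult S(2))
  then have "(\<lambda>N. hom_bessel k \<alpha> \<beta> N z w) sums ((1/2) * (\<integral>x. (\<Sum>N. Q N x) \<partial>P))"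
    unfolding Q_def integral_dir_avg_pair[OF k] by simp
  then have "gen_bessel k \<alpha> \<beta> z w = (1/2) * (\<integral>x. (\<Sum>N. Q N x) \<partial>P)"
    using gen_bessel_sums sums_unique2 by blast
  also have "(\<integral>x. (\<Sum>N. Q N x) \<partial>P) = (\<integral>v. \<integral>u. (\<Sum>N. Q N (v, u)) \<partial>nu_meas \<alpha> \<partial>nu_meas \<beta>)"
    using nu.integral_fst'[of "\<lambda>x. \<Sum>N. Q N x"] S(1) by (simp add: nu_pair_def)
  also have "\<dots> = ?C * (\<integral>v. \<integral>u. ?T u v \<partial>nu_meas \<alpha> \<partial>nu_meas \<beta>)"
    unfolding inner[symmetric] by (simp only: integral_mult_right_zero)
  finally show ?thesis by simp
qed

end
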